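(* Let $G$ be a countably infinite discrete amenable group acting by homeomorphisms on a compact metric space $X$, and let $\mu$ be an ergodic $G$-invariant Borel probability measure on $X$. For any tempered Følner sequence $\mathcal{F}=\{F_n\}_{n\ge1}$ of $G$ and any integer $K\ge2$, the following three subsets of $X^{(K)}\setminus\Delta_K(X)$ coincide: the set of $\mu$-sequence entropy $K$-tuples, the set of $\mu$-mean sensitive $K$-tuples along $\mathcal{F}$, and the set of $\mu$-sensitive in the mean $K$-tuples along $\mathcal{F}$.
   Context: $X^{(K)}$ is the $K$-fold product and $\Delta_K(X)=\{(x,\ldots,x)\in X^{(K)}:x\in X\}$. $\mathcal{B}_X^\mu$ is the $\mu$-completion of the Borel $\sigma$-algebra. A Følner sequence of $G$ is a sequence $\{F_n\}_{n\ge1}$ of finite nonempty subsets of $G$ with $\lim_{n\to\infty}|gF_n\Delta F_n|/|F_n|=0$ for every $g\in G$. It is tempered if there is $C>0$ with $|\bigcup_{k<n}F_k^{-1}F_n|\le C|F_n|$ for all $n\in\mathbb{N}$. Sequence entropy tuples: $\mathcal{P}_X^\mu$ is the set of finite families $\alpha$ of pairwise disjoint sets in $\mathcal{B}_X^\mu$ whose union has full $\mu$-measure; $H_\mu(\alpha)=-\sum_{A\in\alpha}\mu(A)\log\mu(A)$. For a sequence $\mathcal{A}=\{g_i\}_{i\in\mathbb{N}}$ in $G$, $h_\mu^{\mathcal{A}}(G,\alpha)=\limsup_{n\to\infty}\frac1n H_\mu(\bigvee_{i=1}^n g_i^{-1}\alpha)$, and $h_\mu^*(G,\alpha)=\sup_{\mathcal{A}}h_\mu^{\mathcal{A}}(G,\alpha)$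 over all sequences in $G$. A partition $\{A_1,\ldots,A_L\}\in\mathcal{P}_X^\mu$ is admissible with respect to $(x_1,\ldots,x_K)$ if for each $l$ there is $1\le k_l\le K$ with $x_{k_l}\notin\overline{A_l}$. A tuple in $X^{(K)}\setminus\Delta_K(X)$ is a $\mu$-sequence entropy $K$-tuple if $h_\mu^*(G,\alpha)>0$ for every $\alpha\in\mathcal{P}_X^\mu$ admissible with respect to it. A tuple $(x_1,\ldots,x_K)\in X^{(K)}\setminus\Delta_K(X)$ is: (1) a $\mu$-mean sensitive $K$-tuple along $\mathcal{F}$ if for any open neighborhoods $U_k$ of $x_k$ ($1\le k\le K$) there is $\delta>0$ such that for any $A\in\mathcal{B}_X^\mu$ with $\mu(A)>0$ there are $y_1,\ldots,y_K\in A$ with $$\limsup_{n\to\infty}\frac{|\{g\in F_n:gy_k\in U_k,\ k=1,\ldots,K\}|}{|F_n|}>\delta;$$ (2) a $\mu$-sensitive in the mean $K$-tuple along $\mathcal{F}$ if for any open neighborhoods $U_k$ of $x_k$ ($1\le k\le K$) there is $\delta>0$ such that for any $A\in\mathcal{B}_X^\mu$ with $\mu(A)>0$ there are $n\in\mathbb{N}$ and $y_1^n,\ldots,y_K^n\in A$ with $$\frac{|\{g\in F_n:gy_k^n\in U_k,\ k=1,\ldots,K\}|}{|F_n|}>\delta.$$ *)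

theory Defs
  imports "HOL-Probability.Probability" "HOL-Algebra.Group_Action"
begin

text \<open>
  All sequences are indexed by the positive integers: values at index 0 are never constrained
  and never used. The group is a \<open>HOL-Algebra\<close> group \<open>G\<close>, the space \<open>X\<close> is a whole type, and
  \<open>\<phi> g x\<close> is the point usually written \<open>g x\<close>, so that \<open>\<phi> g -` A\<close> is \<open>g\<^sup>-\<^sup>1 A\<close>.
\<close>

definition folner_seq :: "('g, 'm) monoid_scheme \<Rightarrow> (nat \<Rightarrow> 'g set) \<Rightarrow> bool" where
  "folner_seq G F \<longleftrightarrow>
     (\<forall>n\<ge>1. finite (F n) \<and> F n \<noteq> {} \<and> F n \<subseteq> carrier G) \<and>
     (\<forall>g\<in>carrier G.
        (\<lambda>n. real (card (sym_diff (g <#\<^bsub>G\<^esub> F n) (F n))) / real (card (F n))) \<longlonglongrightarrow> 0)"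

text \<open>Folner's characterization, appropriate for countable discrete groups.\<close>

definition amenable :: "('g, 'm) monoid_scheme \<Rightarrow> bool" where
  "amenable G \<longleftrightarrow> (\<exists>F. folner_seq G F)"

definition tempered :: "('g, 'm) monoid_scheme \<Rightarrow> (nat \<Rightarrow> 'g set) \<Rightarrow> bool" where
  "tempered G F \<longleftrightarrow>
     (\<exists>C>0. \<forall>n\<ge>1. real (card (\<Union>k\<in>{1..<n}. (set_inv\<^bsub>G\<^esub> (F k)) <#>\<^bsub>G\<^esub> F n))
                    \<le> C * real (card (F n)))"

definition acts_by_homeomorphisms ::
    "('g, 'm) monoid_scheme \<Rightarrow> ('g \<Rightarrow> 'x \<Rightarrow> 'x::topological_space) \<Rightarrow> bool" where
  "acts_by_homeomorphisms G \<phi> \<longleftrightarrow>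
     group_action G UNIV \<phi> \<and>
     (\<forall>g\<in>carrier G. homeomorphism UNIV UNIV (\<phi> g) (\<phi> (inv\<^bsub>G\<^esub> g)))"

definition invariant_measure ::
    "('g, 'm) monoid_scheme \<Rightarrow> ('g \<Rightarrow> 'x \<Rightarrow> 'x) \<Rightarrow> 'x measure \<Rightarrow> bool" where
  "invariant_measure G \<phi> M \<longleftrightarrow> (\<forall>g\<in>carrier G. distr M M (\<phi> g) = M)"

definition ergodic_measure ::
    "('g, 'm) monoid_scheme \<Rightarrow> ('g \<Rightarrow> 'x \<Rightarrow> 'x) \<Rightarrow> 'x measure \<Rightarrow> bool" where
  "ergodic_measure G \<phi> M \<longleftrightarrow>
     (\<forall>A\<in>sets M. (\<forall>g\<in>carrier G. \<phi> g -` A = A) \<longrightarrow> measure M A = 0 \<or> measure M A = 1)"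

text \<open>
  \<open>K\<close>-tuples are functions on \<open>{1..K}\<close>, made unique by being \<open>undefined\<close> elsewhere.
\<close>

definition tuples :: "nat \<Rightarrow> (nat \<Rightarrow> 'x) set" where
  "tuples K = {1..K} \<rightarrow>\<^sub>E UNIV"

definition diagonal :: "nat \<Rightarrow> (nat \<Rightarrow> 'x) set" where
  "diagonal K = {restrict (\<lambda>_. x) {1..K} | x. True}"

definition measurable_partitions :: "'x measure \<Rightarrow> 'x set set set" where
  "measurable_partitions M =
     {\<alpha>. finite \<alpha> \<and> \<alpha> \<subseteq> sets (completion M) \<and> disjoint \<alpha> \<and>
         measure (completion M) (\<Union>\<alpha>) = 1}"

text \<open>The value \<open>ln 0 = 0\<close> gives the usual convention \<open>0 log 0 = 0\<close>.\<close>

definition part_entropy :: "'x measure \<Rightarrow> 'x set set \<Rightarrow> real" where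
  "part_entropy M \<alpha> =
     - (\<Sum>A\<in>\<alpha>. measure (completion M) A * ln (measure (completion M) A))"

definition join :: "'i set \<Rightarrow> ('i \<Rightarrow> 'x set set) \<Rightarrow> 'x set set" where
  "join I P = {\<Inter>i\<in>I. B i | B. \<forall>i\<in>I. B i \<in> P i}"

definition seq_entropy_along ::
    "('g \<Rightarrow> 'x \<Rightarrow> 'x) \<Rightarrow> 'x measure \<Rightarrow> (nat \<Rightarrow> 'g) \<Rightarrow> 'x set set \<Rightarrow> ereal" where
  "seq_entropy_along \<phi> M s \<alpha> =
     limsup (\<lambda>n. ereal (part_entropy M (join {1..n} (\<lambda>i. (\<lambda>A. \<phi> (s i) -` A) ` \<alpha>)) / real n))"

definition max_seq_entropy ::
    "('g, 'm) monoid_scheme \<Rightarrow> ('g \<Rightarrow> 'x \<Rightarrow> 'x) \<Rightarrow> 'x measure \<Rightarrow> 'x set set \<Rightarrow> ereal" where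
  "max_seq_entropy G \<phi> M \<alpha> =
     (SUP s\<in>{s. \<forall>i\<ge>1. s i \<in> carrier G}. seq_entropy_along \<phi> M s \<alpha>)"

definition admissible :: "nat \<Rightarrow> (nat \<Rightarrow> 'x::topological_space) \<Rightarrow> 'x set set \<Rightarrow> bool" where
  "admissible K x \<alpha> \<longleftrightarrow> (\<forall>A\<in>\<alpha>. \<exists>k\<in>{1..K}. x k \<notin> closure A)"

definition seq_entropy_tuples ::
    "('g, 'm) monoid_scheme \<Rightarrow> ('g \<Rightarrow> 'x \<Rightarrow> 'x::topological_space) \<Rightarrow> 'x measure \<Rightarrow> nat
      \<Rightarrow> (nat \<Rightarrow> 'x) set" where
  "seq_entropy_tuples G \<phi> M K =
     {x \<in> tuples K - diagonal K.
        \<forall>\<alpha>\<in>measurable_partitions M. admissible K x \<alpha> \<longrightarrow> max_seq_entropy G \<phi> M \<alpha> > 0}"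

definition open_nbhds :: "nat \<Rightarrow> (nat \<Rightarrow> 'x::topological_space) \<Rightarrow> (nat \<Rightarrow> 'x set) \<Rightarrow> bool" where
  "open_nbhds K x U \<longleftrightarrow> (\<forall>k\<in>{1..K}. open (U k) \<and> x k \<in> U k)"

definition hit_frequency ::
    "('g \<Rightarrow> 'x \<Rightarrow> 'x) \<Rightarrow> nat \<Rightarrow> (nat \<Rightarrow> 'x) \<Rightarrow> (nat \<Rightarrow> 'x set) \<Rightarrow> 'g set \<Rightarrow> real" where
  "hit_frequency \<phi> K y U E =
     real (card {g \<in> E. \<forall>k\<in>{1..K}. \<phi> g (y k) \<in> U k}) / real (card E)"

definition mean_sensitive_tuples ::
    "('g \<Rightarrow> 'x \<Rightarrow> 'x::topological_space) \<Rightarrow> 'x measure \<Rightarrow> (nat \<Rightarrow> 'g set) \<Rightarrow> nat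
      \<Rightarrow> (nat \<Rightarrow> 'x) set" where
  "mean_sensitive_tuples \<phi> M F K =
     {x \<in> tuples K - diagonal K.
        \<forall>U. open_nbhds K x U \<longrightarrow>
          (\<exists>\<delta>::real>0. \<forall>A\<in>sets (completion M). measure (completion M) A > 0 \<longrightarrow>
             (\<exists>y. (\<forall>k\<in>{1..K}. y k \<in> A) \<and>
                  limsup (\<lambda>n. ereal (hit_frequency \<phi> K y U (F n))) > ereal \<delta>))}"

definition sensitive_in_the_mean_tuples ::
    "('g \<Rightarrow> 'x \<Rightarrow> 'x::topological_space) \<Rightarrow> 'x measure \<Rightarrow> (nat \<Rightarrow> 'g set) \<Rightarrow> nat
      \<Rightarrow> (nat \<Rightarrow> 'x) set" where
  "sensitive_in_the_mean_tuples \<phi> M F K =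
     {x \<in> tuples K - diagonal K.
        \<forall>U. open_nbhds K x U \<longrightarrow>
          (\<exists>\<delta>::real>0. \<forall>A\<in>sets (completion M). measure (completion M) A > 0 \<longrightarrow>
             (\<exists>n\<ge>1. \<exists>y. (\<forall>k\<in>{1..K}. y k \<in> A) \<and> hit_frequency \<phi> K y U (F n) > \<delta>))}"

end

(*
  Let Kr be the sigma-algebra of events whose orbit is totally bounded in L1. A partition has zero
  sequence entropy along every sequence exactly when all its atoms lie in Kr: if the orbit of an atom
  is not totally bounded, one can keep choosing translates far from everything measurable with respect
  to the finite partition generated so far, and each of them adds a fixed amount of entropy.

  For finitely many functions f_i with totally bounded orbit, the mean ergodic theorem on the product
  X * X turns d(x,y) = sum |f_i x - f_i y| into an invariant pseudometric rho(x,y) = lim avg d(gx,gy),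
  whose small balls have positive measure; rho replaces the metric of the Kronecker factor, so that
  neither a compact group nor Haar measure is needed.

  Sensitive in the mean ==> sequence entropy: if the atoms of an admissible partition are in Kr, apply
  this to their indicators. With theta(x) the mean of d(x,-) over a rho-ball around x, the triangle
  inequality gives d(gx,gy) <= theta(gx) + theta(gy) + const * rho(x,y), and the maximal inequality for
  tempered Folner sequences bounds the averages of theta for all n at once. Hence points of some set of
  positive measure lie in a common atom most of the time.

  Sequence entropy ==> mean sensitive: let h_k be the conditional expectation of the indicator of U_k
  given Kr. If the product of the h_k vanished, the sets {h_k = 0} would yield an admissible partition in
  Kr. Otherwise, on a subset A' of A with small rho-diameter, the average over g of the product of the
  mu(A' Int g^-1 U_k) / mu(A') tends to about the integral of the product of the h_k, since
  the part of the indicator orthogonal to Kr is weakly mixing. Fatou's lemma yields the points y_k.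
*)
theory Submission
  imports Defs
begin

section \<open>Covering and the maximal inequality for tempered Folner sequences\<close>

text \<open>The tuples are defined through actual points \<open>y k\<close> of an arbitrary set of
  positive measure, whereas ergodic theory yields statements up to null sets. This shapes most
  constructions: limits are represented by limits superior along a fixed subsequence, so that \<rho>
  is symmetric and satisfies the triangle inequality at all points; its invariance, which holds only
  for almost every pair, is exploited through one generic centre; exceptional null sets are removed
  before points are compared. A second difficulty is uniformity, since \<delta> is fixed before
  \<open>A\<close>. For mean sensitivity it comes from the integral of the product of the
  conditional expectations, a number in which \<open>A\<close> does not occur; shrinking
  \<open>A\<close> to a set of small diameter affects only the speed of convergence. In the
  direction from sensitivity in the mean, one bad set must control every finite \<open>n\<close> and
  not just the limit, because a visit may be witnessed at any index. A mean ergodic theorem cannot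
  give this; temperedness provides it through a weak type maximal inequality, whose constant enters
  the radius of the bumps.\<close>

lemma (in group) greedy_selection:
  fixes f :: "'a \<Rightarrow> real" and l C :: real
  assumes F: "finite F" "F \<noteq> {}" "F \<subseteq> carrier G"
    and D: "finite D" "D \<subseteq> carrier G"
    and nonneg: "\<And>g. 0 \<le> f g" and C: "0 \<le> C"
    and large: "\<And>d. d \<in> D \<Longrightarrow> l * card F \<le> (\<Sum>h\<in>F. f (h \<otimes> d))"
  shows "\<exists>S\<subseteq>D. l * (card D + C * card F * card S) \<le> (2 + 2 * C) * (\<Sum>g\<in>F <#> S. f g)"
proof -
  have fin: "finite (F <#> S)" if "finite S" for S
    using that F(1) by (auto simp: set_mult_def)
  \<comment> \<open>The factor 2 asks that on average each selected translate brings half of its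
    guaranteed mass \<open>l * card F\<close> to the union \<open>F <#> S\<close>. Mass is counted
    once on the union, so translates may overlap.\<close>
  define P where "P S \<longleftrightarrow> S \<subseteq> D \<and> l * card F * card S \<le> 2 * (\<Sum>g\<in>F <#> S. f g)" for S
  have "P {}" by (simp add: P_def set_mult_def)
  moreover have "finite {S. P S}"
    by (rule finite_subset[of _ "Pow D"]) (auto simp: P_def D)
  ultimately obtain S where S: "P S" and max: "\<And>T. P T \<Longrightarrow> S \<subseteq> T \<Longrightarrow> T = S"
    using finite_has_maximal[of "{S. P S}"] by auto
  have SD: "S \<subseteq> D" and Scount: "l * card F * card S \<le> 2 * (\<Sum>g\<in>F <#> S. f g)"
    using S by (auto simp: P_def)
  have finS: "finite S" using SD D(1) finite_subset by auto
  define FS where "FS = F <#> S"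
  have finFS: "finite FS" using fin[OF finS] FS_def by simp
  \<comment> \<open>Maximality of \<open>S\<close>: if less than half of \<open>l * card F\<close>
    were found inside \<open>FS\<close>, more than half would lie outside, and \<open>d\<close>
    could be added to \<open>S\<close>.\<close>
  have sat: "l * card F \<le> 2 * (\<Sum>h\<in>F. if h \<otimes> d \<in> FS then f (h \<otimes> d) else 0)" if d: "d \<in> D" for d
  proof (cases "d \<in> S")
    case True
    then have "h \<otimes> d \<in> FS" if "h \<in> F" for h
      using that by (auto simp: FS_def set_mult_def)
    then have "(\<Sum>h\<in>F. if h \<otimes> d \<in> FS then f (h \<otimes> d) else 0) = (\<Sum>h\<in>F. f (h \<otimes> d))"
      by (intro sum.cong) auto
    moreover have "0 \<le> (\<Sum>h\<in>F. f (h \<otimes> d))" by (intro sum_nonneg nonneg)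
    ultimately show ?thesis using large[OF d] by linarith
  next
    case False
    show ?thesis
    proof (rule ccontr)
      assume neg: "\<not> ?thesis"
      have dc: "d \<in> carrier G" using d D by auto
      have inj: "inj_on (\<lambda>h. h \<otimes> d) F" using F(3) dc by (intro inj_onI) (metis right_cancel subsetD)
      have split: "(\<Sum>h\<in>F. f (h \<otimes> d)) = (\<Sum>h\<in>F. if h \<otimes> d \<in> FS then f (h \<otimes> d) else 0)
             + (\<Sum>h\<in>F. if h \<otimes> d \<notin> FS then f (h \<otimes> d) else 0)"
        by (subst sum.distrib[symmetric], intro sum.cong) auto
      have new: "(\<Sum>h\<in>F. if h \<otimes> d \<notin> FS then f (h \<otimes> d) else 0) = sum f ((\<lambda>h. h \<otimes> d) ` F - FS)"
      proof -
        have eq: "(\<lambda>h. h \<otimes> d) ` F - FS = (\<lambda>h. h \<otimes> d) ` {h\<in>F. h \<otimes> d \<notin> FS}" by auto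
        show ?thesis unfolding eq
          by (subst sum.reindex) (use inj F(1) in \<open>auto simp: inj_on_def sum.inter_filter\<close>)
      qed
      have ins: "F <#> insert d S = FS \<union> ((\<lambda>h. h \<otimes> d) ` F - FS)"
        by (auto simp: FS_def set_mult_def)
      have "sum f (F <#> insert d S) = sum f FS + sum f ((\<lambda>h. h \<otimes> d) ` F - FS)"
        unfolding ins by (rule sum.union_disjoint) (use F finFS in auto)
      then have "l * card F * card (insert d S) \<le> 2 * sum f (F <#> insert d S)"
        using neg large[OF d] split new Scount False finS
        by (simp add: FS_def algebra_simps)
      then have "P (insert d S)" using d SD by (auto simp: P_def)
      then show False using max[of "insert d S"] False by auto
    qed
  qed
  \<comment> \<open>Double counting of the saturation bound: for fixed \<open>h\<close> the points
    \<open>h \<otimes> d\<close> are distinct, so every \<open>h\<close> sees at most the mass of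
    \<open>FS\<close>.\<close>
  have "l * card F * card D = (\<Sum>d\<in>D. l * card F)" by simp
  also have "\<dots> \<le> (\<Sum>d\<in>D. 2 * (\<Sum>h\<in>F. if h \<otimes> d \<in> FS then f (h \<otimes> d) else 0))"
    by (intro sum_mono sat)
  also have "\<dots> = 2 * (\<Sum>h\<in>F. \<Sum>d\<in>D. if h \<otimes> d \<in> FS then f (h \<otimes> d) else 0)"
    by (simp add: sum_distrib_left[symmetric] sum.swap[of _ D])
  also have "\<dots> \<le> 2 * (\<Sum>h\<in>F. sum f FS)"
  proof (intro mult_left_mono sum_mono)
    fix h assume h: "h \<in> F"
    have inj: "inj_on (\<lambda>d. h \<otimes> d) {d\<in>D. h \<otimes> d \<in> FS}"
      using h F(3) D(2) by (intro inj_onI) (metis (mono_tags, lifting) Units_eq Units_l_cancel mem_Collect_eq subsetD)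
    have "(\<Sum>d\<in>D. if h \<otimes> d \<in> FS then f (h \<otimes> d) else 0) = sum f ((\<lambda>d. h \<otimes> d) ` {d\<in>D. h \<otimes> d \<in> FS})"
      by (subst sum.reindex) (use inj D(1) in \<open>auto simp: sum.inter_filter\<close>)
    also have "\<dots> \<le> sum f FS"
      by (rule sum_mono2) (use finFS nonneg in auto)
    finally show "(\<Sum>d\<in>D. if h \<otimes> d \<in> FS then f (h \<otimes> d) else 0) \<le> sum f FS" .
  qed auto
  finally have "real (card F) * (l * card D) \<le> real (card F) * (2 * sum f FS)"
    by (simp add: algebra_simps)
  then have a: "l * card D \<le> 2 * sum f FS"
    using F by (simp add: card_gt_0_iff)
  have b: "C * (l * card F * card S) \<le> C * (2 * sum f FS)"
    using Scount C by (intro mult_left_mono) (auto simp: FS_def)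
  \<comment> \<open>The summand 2 pays for \<open>card D\<close>, the summand \<open>2 * C\<close>
    for \<open>C * card F * card S\<close>, the number of base points that may have to be discarded
    because their translates meet the selected ones.\<close>
  have "l * (card D + C * card F * card S) \<le> (2 + 2 * C) * sum f FS"
  proof -
    have "l * (card D + C * card F * card S) = l * card D + C * (l * card F * card S)"
      by (simp add: algebra_simps)
    also have "\<dots> \<le> 2 * sum f FS + C * (2 * sum f FS)" using a b by linarith
    finally show ?thesis by (simp add: algebra_simps)
  qed
  then show ?thesis using SD unfolding FS_def by blast
qed

text \<open>The selection runs from the largest index downwards. A base point of smaller index
  \<open>k\<close> whose translate meets the chosen translates of \<open>F (Suc N)\<close> lies in
  the inverse of \<open>F k\<close> times \<open>F (Suc N)\<close> times \<open>S\<close>, and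
  temperedness bounds the number of such points. The surviving base points do not see the chosen
  region, so setting \<open>f\<close> to zero there leaves their averages unchanged and the masses
  add up.\<close>

lemma (in group) tempered_covering:
  fixes f :: "'a \<Rightarrow> real" and F :: "nat \<Rightarrow> 'a set" and l C :: real
  assumes F: "\<And>n. 1 \<le> n \<Longrightarrow> finite (F n) \<and> F n \<noteq> {} \<and> F n \<subseteq> carrier G"
    and C: "0 \<le> C"
    and temp: "\<And>n. 1 \<le> n \<Longrightarrow>
        real (card (\<Union>k\<in>{1..<n}. (set_inv (F k)) <#> F n)) \<le> C * real (card (F n))"
    and l: "0 \<le> l"
    and D: "finite D" "D \<subseteq> carrier G" and W: "finite W"
    and nonneg: "\<And>g. 0 \<le> f g"
    and \<kappa>: "\<And>d. d \<in> D \<Longrightarrow> 1 \<le> \<kappa> d \<and> \<kappa> d \<le> N"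
    and large: "\<And>d. d \<in> D \<Longrightarrow> l * card (F (\<kappa> d)) \<le> (\<Sum>h\<in>F (\<kappa> d). f (h \<otimes> d))"
    and FW: "\<And>d h. d \<in> D \<Longrightarrow> h \<in> F (\<kappa> d) \<Longrightarrow> h \<otimes> d \<in> W"
  shows "l * card D \<le> (2 + 2 * C) * sum f W"
  using D nonneg \<kappa> large FW
proof (induction N arbitrary: D f)
  case 0
  have "D = {}" using 0(4) by fastforce
  moreover have "0 \<le> (2 + 2 * C) * sum f W" by (intro mult_nonneg_nonneg sum_nonneg 0(3)) (use C in simp)
  ultimately show ?case by simp
next
  case (Suc N)
  define DN where "DN = {d\<in>D. \<kappa> d = Suc N}"
  have FN: "finite (F (Suc N))" "F (Suc N) \<noteq> {}" "F (Suc N) \<subseteq> carrier G" using F[of "Suc N"] by auto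
  have DN: "finite DN" "DN \<subseteq> carrier G" using Suc.prems(1,2) by (auto simp: DN_def)
  have "l * card (F (Suc N)) \<le> (\<Sum>h\<in>F (Suc N). f (h \<otimes> d))" if "d \<in> DN" for d
    using that Suc.prems(5)[of d] by (auto simp: DN_def)
  from greedy_selection[OF FN DN Suc.prems(3) C this] obtain S where S: "S \<subseteq> DN"
    and Sb: "l * (card DN + C * card (F (Suc N)) * card S) \<le> (2 + 2 * C) * sum f (F (Suc N) <#> S)"
    by auto
  have finS: "finite S" using S DN finite_subset by blast
  define FS where "FS = F (Suc N) <#> S"
  have FSW: "FS \<subseteq> W"
  proof
    fix g assume "g \<in> FS"
    then obtain h s where "g = h \<otimes> s" "h \<in> F (Suc N)" "s \<in> S" by (auto simp: FS_def set_mult_def)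
    moreover then have "s \<in> D" "\<kappa> s = Suc N" using S by (auto simp: DN_def)
    ultimately show "g \<in> W" using Suc.prems(6)[of s h] by simp
  qed
  define Bad where "Bad = {d\<in>D. \<kappa> d \<le> N \<and> (\<exists>h\<in>F (\<kappa> d). h \<otimes> d \<in> FS)}"
  define D' where "D' = {d\<in>D. \<kappa> d \<le> N \<and> (\<forall>h\<in>F (\<kappa> d). h \<otimes> d \<notin> FS)}"
  define f' where "f' g = (if g \<in> FS then 0 else f g)" for g
  define A where "A = (\<Union>k\<in>{1..<Suc N}. (set_inv (F k)) <#> F (Suc N))"
  have finA: "finite A"
    unfolding A_def set_mult_def SET_INV_def using F FN by auto
  have "Bad \<subseteq> (\<lambda>(a,s). a \<otimes> s) ` (A \<times> S)"
  proof
    fix d assume "d \<in> Bad"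
    then obtain h where d: "d \<in> D" "\<kappa> d \<le> N" and h: "h \<in> F (\<kappa> d)" "h \<otimes> d \<in> FS"
      by (auto simp: Bad_def)
    then obtain h' s where h': "h' \<in> F (Suc N)" "s \<in> S" "h \<otimes> d = h' \<otimes> s"
      by (auto simp: FS_def set_mult_def)
    have k: "1 \<le> \<kappa> d" using Suc.prems(4) d by auto
    have c: "h \<in> carrier G" "d \<in> carrier G" "h' \<in> carrier G" "s \<in> carrier G"
      using F[OF k] h d Suc.prems(2) FN h' S DN by auto
    have "d = inv h \<otimes> (h \<otimes> d)" using c by (simp add: m_assoc[symmetric])
    also have "\<dots> = (inv h \<otimes> h') \<otimes> s" using c h' by (simp add: m_assoc)
    finally have "d = (inv h \<otimes> h') \<otimes> s" .
    moreover have "inv h \<otimes> h' \<in> A"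
    proof -
      have "inv h \<otimes> h' \<in> (set_inv (F (\<kappa> d))) <#> F (Suc N)"
        using h(1) h'(1) unfolding set_mult_def SET_INV_def by blast
      moreover have "\<kappa> d \<in> {1..<Suc N}" using k d by simp
      ultimately show ?thesis unfolding A_def by blast
    qed
    ultimately show "d \<in> (\<lambda>(a,s). a \<otimes> s) ` (A \<times> S)" using h' by force
  qed
  then have "card Bad \<le> card ((\<lambda>(a,s). a \<otimes> s) ` (A \<times> S))"
    using finA finS by (intro card_mono) auto
  also have "\<dots> \<le> card (A \<times> S)" by (rule card_image_le) (use finA finS in auto)
  finally have "real (card Bad) \<le> real (card A) * real (card S)"
    by (simp add: card_cartesian_product flip: of_nat_mult)
  also have "\<dots> \<le> C * card (F (Suc N)) * card S"
    using temp[of "Suc N"] by (intro mult_right_mono) (auto simp: A_def)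
  finally have bad: "l * real (card Bad) \<le> l * (C * card (F (Suc N)) * card S)"
    using l by (rule mult_left_mono)
  have IH: "l * card D' \<le> (2 + 2 * C) * sum f' W"
  proof (rule Suc.IH)
    show "finite D'" "D' \<subseteq> carrier G" using Suc.prems(1,2) by (auto simp: D'_def)
    show "0 \<le> f' g" for g using Suc.prems(3) by (simp add: f'_def)
    show "1 \<le> \<kappa> d \<and> \<kappa> d \<le> N" if "d \<in> D'" for d using that Suc.prems(4) by (auto simp: D'_def)
    show "l * card (F (\<kappa> d)) \<le> (\<Sum>h\<in>F (\<kappa> d). f' (h \<otimes> d))" if "d \<in> D'" for d
    proof -
      have "(\<Sum>h\<in>F (\<kappa> d). f' (h \<otimes> d)) = (\<Sum>h\<in>F (\<kappa> d). f (h \<otimes> d))"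
        using that by (intro sum.cong) (auto simp: D'_def f'_def)
      then show ?thesis using that Suc.prems(5)[of d] by (auto simp: D'_def)
    qed
    show "h \<otimes> d \<in> W" if "d \<in> D'" "h \<in> F (\<kappa> d)" for d h
      using that Suc.prems(6) by (auto simp: D'_def)
  qed
  have "sum f W = sum f FS + sum f (W - FS)"
    using FSW W by (metis add.commute sum.subset_diff)
  moreover have "sum f' W = sum f (W - FS)"
    using W by (intro sum.mono_neutral_cong_right) (auto simp: f'_def)
  ultimately have sums: "sum f W = sum f FS + sum f' W" by simp
  have "\<kappa> d = Suc N \<or> \<kappa> d \<le> N" if "d \<in> D" for d
    using Suc.prems(4)[OF that] by auto
  then have "D = DN \<union> (Bad \<union> D')"
    by (auto simp: DN_def Bad_def D'_def)
  then have "card D \<le> card DN + (card Bad + card D')"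
    using card_Un_le[of DN "Bad \<union> D'"] card_Un_le[of Bad D'] by simp
  then have "l * card D \<le> l * (card DN + (card Bad + card D'))"
    using l by (intro mult_left_mono) linarith+
  also have "\<dots> \<le> (2 + 2 * C) * sum f W"
  proof -
    have "l * (card DN + (card Bad + card D')) =
        l * card DN + l * card Bad + l * card D'" by (simp add: algebra_simps)
    also have "\<dots> \<le> l * (card DN + C * card (F (Suc N)) * card S) + (2 + 2 * C) * sum f' W"
      using bad IH by (simp add: distrib_left)
    also have "\<dots> \<le> (2 + 2 * C) * sum f FS + (2 + 2 * C) * sum f' W"
      using Sb by (simp add: FS_def)
    finally show ?thesis unfolding sums by (simp add: distrib_left)
  qed
  finally show ?case .
qed

text \<open>The locale is interpreted for the given action and again for the diagonal action on the
  product, which may fail to be ergodic. Hence ergodicity is added only in a later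
  extension.\<close>

locale folner_action = group G + prob_space M
  for G :: "('g, 'm) monoid_scheme" (structure) and M :: "'a measure" +
  fixes \<psi> :: "'g \<Rightarrow> 'a \<Rightarrow> 'a" and F :: "nat \<Rightarrow> 'g set"
  assumes countable_carrier: "countable (carrier G)"
    and folner: "folner_seq G F"
    and action_measurable [measurable]: "g \<in> carrier G \<Longrightarrow> \<psi> g \<in> measurable M M"
    and action_distr: "g \<in> carrier G \<Longrightarrow> distr M M (\<psi> g) = M"
    and action_mult: "g \<in> carrier G \<Longrightarrow> h \<in> carrier G \<Longrightarrow> \<psi> (g \<otimes> h) x = \<psi> g (\<psi> h x)"
    and action_one: "\<psi> \<one> x = x"
begin

lemma folner_finite: "1 \<le> n \<Longrightarrow> finite (F n)"
  and folner_nonempty: "1 \<le> n \<Longrightarrow> F n \<noteq> {}"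
  and folner_carrier: "1 \<le> n \<Longrightarrow> F n \<subseteq> carrier G"
  and folner_card_pos: "1 \<le> n \<Longrightarrow> 0 < card (F n)"
  using folner by (auto simp: folner_seq_def card_gt_0_iff)

lemma folner_tendsto:
  "g \<in> carrier G \<Longrightarrow>
    (\<lambda>n. real (card (sym_diff (g <#\<^bsub>G\<^esub> F n) (F n))) / real (card (F n))) \<longlonglongrightarrow> 0"
  using folner by (auto simp: folner_seq_def)

definition avg :: "nat \<Rightarrow> ('a \<Rightarrow> real) \<Rightarrow> 'a \<Rightarrow> real" where
  "avg n f x = (\<Sum>h\<in>F n. f (\<psi> h x)) / card (F n)"

lemma measurable_action_comp:
  "f \<in> measurable M N \<Longrightarrow> g \<in> carrier G \<Longrightarrow> (\<lambda>x. f (\<psi> g x)) \<in> measurable M N"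
  using measurable_compose[OF action_measurable] by auto

lemma borel_measurable_avg [measurable]:
  assumes "1 \<le> n" and [measurable]: "f \<in> borel_measurable M"
  shows "avg n f \<in> borel_measurable M"
  unfolding avg_def using folner_carrier[OF assms(1)]
  by (intro borel_measurable_divide borel_measurable_sum) auto

lemma abs_avg_le:
  assumes "\<And>x. \<bar>f x\<bar> \<le> B"
  shows "\<bar>avg n f x\<bar> \<le> B"
proof (cases "card (F n) = 0")
  case True
  then show ?thesis using assms[of x] by (simp add: avg_def)
next
  case False
  have "\<bar>\<Sum>h\<in>F n. f (\<psi> h x)\<bar> \<le> (\<Sum>h\<in>F n. B)"
    by (rule order_trans[OF sum_abs]) (intro sum_mono assms)
  then show ?thesis using False by (simp add: avg_def field_simps)
qed

lemma avg_nonneg: "(\<And>x. 0 \<le> f x) \<Longrightarrow> 0 \<le> avg n f x"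
  unfolding avg_def by (intro divide_nonneg_nonneg sum_nonneg) auto

lemma integrable_bounded:
  fixes f :: "'a \<Rightarrow> real"
  assumes "f \<in> borel_measurable M" and "\<And>x. \<bar>f x\<bar> \<le> B"
  shows "integrable M f"
  using assms by (intro integrable_const_bound[of _ B]) auto

lemma integral_action_comp:
  fixes f :: "'a \<Rightarrow> real"
  assumes "g \<in> carrier G" and [measurable]: "f \<in> borel_measurable M"
  shows "(\<integral>x. f (\<psi> g x) \<partial>M) = integral\<^sup>L M f"
proof -
  have "integral\<^sup>L M f = integral\<^sup>L (distr M M (\<psi> g)) f" using action_distr assms by simp
  also have "\<dots> = (\<integral>x. f (\<psi> g x) \<partial>M)" using assms by (intro integral_distr) auto
  finally show ?thesis by simp
qed

lemma integrable_action_comp: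
  fixes f :: "'a \<Rightarrow> real"
  assumes "g \<in> carrier G" and f: "integrable M f"
  shows "integrable M (\<lambda>x. f (\<psi> g x))"
proof -
  have "integrable (distr M M (\<psi> g)) f" using f action_distr assms by simp
  then show ?thesis by (rule integrable_distr[OF action_measurable[OF assms(1)]])
qed

lemma AE_action_comp:
  assumes "g \<in> carrier G" and "AE x in M. P x"
  shows "AE x in M. P (\<psi> g x)"
proof -
  have "AE x in distr M M (\<psi> g). P x" using assms(2) by (subst action_distr[OF assms(1)])
  then show ?thesis using AE_distrD[of "\<psi> g" M M P] assms by auto
qed

lemma integral_avg:
  fixes f :: "'a \<Rightarrow> real"
  assumes n: "1 \<le> n" and f: "integrable M f"
  shows "(\<integral>x. avg n f x \<partial>M) = integral\<^sup>L M f"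
proof -
  have "(\<integral>x. avg n f x \<partial>M) = (\<Sum>h\<in>F n. \<integral>x. f (\<psi> h x) \<partial>M) / card (F n)"
    unfolding avg_def using integrable_action_comp[OF _ f] folner_carrier[OF n]
    by (subst integral_divide_zero, subst Bochner_Integration.integral_sum) auto
  also have "\<dots> = (\<Sum>h\<in>F n. integral\<^sup>L M f) / card (F n)"
    using integral_action_comp f folner_carrier[OF n]
    by (intro arg_cong2[where f="(/)"] sum.cong) auto
  finally show ?thesis using folner_card_pos[OF n] by simp
qed

text \<open>The translate enters on the left of the averaging variable, which is where a left Folner
  sequence is almost invariant.\<close>

lemma avg_translate_bound:
  assumes g: "g \<in> carrier G" and n: "1 \<le> n" and B: "\<And>x. \<bar>f x\<bar> \<le> B"
  shows "\<bar>avg n (\<lambda>y. f (\<psi> g y)) x - avg n f x\<bar>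
          \<le> B * (real (card (sym_diff (g <#\<^bsub>G\<^esub> F n) (F n))) / real (card (F n)))"
proof -
  have cF: "h \<in> carrier G" if "h \<in> F n" for h using that folner_carrier[OF n] by auto
  have inj: "inj_on (\<lambda>h. g \<otimes> h) (F n)" using g cF by (auto simp: inj_on_def)
  define gF where "gF = g <#\<^bsub>G\<^esub> F n"
  have gF: "gF = (\<lambda>h. g \<otimes> h) ` F n" by (auto simp: gF_def l_coset_def)
  let ?f = "\<lambda>h. f (\<psi> h x)"
  have eq: "(\<Sum>h\<in>F n. f (\<psi> g (\<psi> h x))) = sum ?f (gF)"
    unfolding gF sum.reindex[OF inj] by (intro sum.cong) (simp_all add: action_mult g cF)
  have diff: "sum ?f A - sum ?f B' = sum ?f (A - B') - sum ?f (B' - A)"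
    if "finite A" "finite B'" for A B'
    using sum.Int_Diff[OF that(1), of ?f B'] sum.Int_Diff[OF that(2), of ?f A]
    unfolding Int_commute[of B' A] by linarith
  have "finite gF" using folner_finite[OF n] unfolding gF by simp
  from diff[OF this folner_finite[OF n]] have "(\<Sum>h\<in>F n. f (\<psi> g (\<psi> h x))) - sum ?f (F n)
        = sum ?f (gF - F n) - sum ?f (F n - gF)"
    unfolding eq .
  also have "\<bar>\<dots>\<bar> \<le> sum (\<lambda>h. \<bar>?f h\<bar>) (gF - F n) + sum (\<lambda>h. \<bar>?f h\<bar>) (F n - gF)"
    using sum_abs[of ?f "gF - F n"] sum_abs[of ?f "F n - gF"] by linarith
  also have "\<dots> = sum (\<lambda>h. \<bar>?f h\<bar>) (sym_diff (gF) (F n))"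
    by (rule sum.union_disjoint[symmetric]) (use folner_finite[OF n] gF in auto)
  also have "\<dots> \<le> B * real (card (sym_diff (gF) (F n)))"
    by (subst mult.commute, rule sum_bounded_above, rule B)
  finally have "\<bar>(\<Sum>h\<in>F n. f (\<psi> g (\<psi> h x))) - sum ?f (F n)\<bar> / real (card (F n))
      \<le> B * real (card (sym_diff gF (F n))) / real (card (F n))"
    by (rule divide_right_mono) simp
  moreover have "\<bar>avg n (\<lambda>y. f (\<psi> g y)) x - avg n f x\<bar>
      = \<bar>(\<Sum>h\<in>F n. f (\<psi> g (\<psi> h x))) - sum ?f (F n)\<bar> / real (card (F n))"
    unfolding avg_def diff_divide_distrib[symmetric] by (simp only: abs_divide abs_of_nat)
  ultimately show ?thesis unfolding gF_def by (simp only: times_divide_eq_right)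
qed

section \<open>Transference and the weak type maximal inequality\<close>

lemma integrable_indicator_event:
  "A \<in> sets M \<Longrightarrow> integrable M (indicator A :: 'a \<Rightarrow> real)"
  by (intro integrable_bounded[of _ 1]) (auto simp: indicator_def)

text \<open>Calderon transference: the covering lemma is applied on the group to the function
  sending \<open>g\<close> to \<open>f (\<psi> g x)\<close>, with base points in a large Folner set
  \<open>F m\<close>. All translates that occur stay in a set \<open>W\<close> of nearly the same
  size, so integrating over \<open>x\<close> and letting \<open>m\<close> grow gives the inequality
  on the space.\<close>

lemma maximal_inequality_bounded_range:
  assumes temp: "0 \<le> C" "\<And>n. 1 \<le> n \<Longrightarrow>
        real (card (\<Union>k\<in>{1..<n}. (set_inv (F k)) <#> F n)) \<le> C * real (card (F n))"
    and l: "0 \<le> l"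
    and [measurable]: "f \<in> borel_measurable M" and nonneg: "\<And>x. 0 \<le> f x" and fB: "\<And>x. f x \<le> B"
  shows "l * prob {x\<in>space M. \<exists>n\<in>{1..N}. l < avg n f x} \<le> (2 + 2 * C) * integral\<^sup>L M f"
proof -
  define E where "E = {x\<in>space M. \<exists>n\<in>{1..N}. l < avg n f x}"
  have E [measurable]: "E \<in> sets M" unfolding E_def by measurable
  define KK where "KK = (\<Union>n\<in>{1..N}. F n)"
  have KK: "finite KK" "KK \<subseteq> carrier G"
    unfolding KK_def using folner_finite folner_carrier by (auto simp: subset_eq)
  have intf: "integrable M f" using nonneg fB by (intro integrable_bounded[of _ B]) (auto simp: abs_le_iff intro: order_trans)
  \<comment> \<open>Integration loses the ratio of \<open>card W\<close> to
    \<open>card (F m)\<close>, which is at most one plus the relative boundaries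
    \<open>r m k\<close>.\<close>
  define r where "r m k = real (card (sym_diff (k <#\<^bsub>G\<^esub> F m) (F m))) / real (card (F m))" for m k
  have key: "l * prob E \<le> (2 + 2 * C) * ((1 + (\<Sum>k\<in>KK. r m k)) * integral\<^sup>L M f)" if m: "1 \<le> m" for m
  proof -
    define W where "W = F m \<union> (\<Union>k\<in>KK. k <#\<^bsub>G\<^esub> F m)"
    have Fm: "finite (F m)" "F m \<subseteq> carrier G" "card (F m) > 0"
      using folner_finite folner_carrier folner_card_pos m by auto
    have W: "finite W" "W \<subseteq> carrier G"
      unfolding W_def l_coset_def using Fm KK by (auto intro!: m_closed)
    have "card W \<le> card (F m \<union> (\<Union>k\<in>KK. sym_diff (k <#\<^bsub>G\<^esub> F m) (F m)))"
      by (rule card_mono) (use Fm KK in \<open>auto simp: W_def l_coset_def\<close>)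
    also have "\<dots> \<le> card (F m) + (\<Sum>k\<in>KK. card (sym_diff (k <#\<^bsub>G\<^esub> F m) (F m)))"
      by (rule order_trans[OF card_Un_le add_left_mono[OF card_UN_le[OF KK(1)]]])
    finally have le: "card W \<le> card (F m) + (\<Sum>k\<in>KK. card (sym_diff (k <#\<^bsub>G\<^esub> F m) (F m)))" .
    have "real (card W) \<le> card (F m) + (\<Sum>k\<in>KK. real (card (sym_diff (k <#\<^bsub>G\<^esub> F m) (F m))))"
      using of_nat_mono[OF le, where 'a=real] by simp
    then have cardW: "real (card W) \<le> card (F m) * (1 + (\<Sum>k\<in>KK. r m k))"
      using Fm(3) by (simp add: r_def sum_divide_distrib[symmetric] distrib_left)
    have pointwise: "l * card {d\<in>F m. \<psi> d x \<in> E} \<le> (2 + 2 * C) * (\<Sum>g\<in>W. f (\<psi> g x))" for x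
    proof -
      define \<kappa> where "\<kappa> d = (SOME n. n \<in> {1..N} \<and> l < avg n f (\<psi> d x))" for d
      have \<kappa>: "\<kappa> d \<in> {1..N} \<and> l < avg (\<kappa> d) f (\<psi> d x)" if "\<psi> d x \<in> E" for d
        unfolding \<kappa>_def by (rule someI_ex) (use that in \<open>auto simp: E_def\<close>)
      show ?thesis
      proof (rule tempered_covering[of F C l _ W "\<lambda>g. f (\<psi> g x)" \<kappa> N])
        show "finite (F n) \<and> F n \<noteq> {} \<and> F n \<subseteq> carrier G" if "1 \<le> n" for n
          using folner_finite folner_nonempty folner_carrier that by auto
        show "{d \<in> F m. \<psi> d x \<in> E} \<subseteq> carrier G" "finite {d \<in> F m. \<psi> d x \<in> E}" using Fm by auto
        show "1 \<le> \<kappa> d \<and> \<kappa> d \<le> N" if "d \<in> {d \<in> F m. \<psi> d x \<in> E}" for d using \<kappa>[of d] that by auto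
        show "l * card (F (\<kappa> d)) \<le> (\<Sum>h\<in>F (\<kappa> d). f (\<psi> (h \<otimes> d) x))"
          if d: "d \<in> {d \<in> F m. \<psi> d x \<in> E}" for d
        proof -
          have k: "1 \<le> \<kappa> d" "l < avg (\<kappa> d) f (\<psi> d x)" using \<kappa>[of d] d by auto
          have "(\<Sum>h\<in>F (\<kappa> d). f (\<psi> (h \<otimes> d) x)) = (\<Sum>h\<in>F (\<kappa> d). f (\<psi> h (\<psi> d x)))"
            using folner_carrier[OF k(1)] d Fm(2) by (intro sum.cong) (auto simp: action_mult subset_eq)
          then show ?thesis using k folner_card_pos[OF k(1)] by (simp add: avg_def field_simps)
        qed
        show "h \<otimes> d \<in> W" if "d \<in> {d \<in> F m. \<psi> d x \<in> E}" "h \<in> F (\<kappa> d)" for d h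
          using \<kappa>[of d] that unfolding W_def KK_def l_coset_def by blast
      qed (use temp l nonneg W in auto)
    qed
    have "l * (card (F m) * prob E) = l * (\<Sum>d\<in>F m. prob E)" by simp
    also have "\<dots> = l * (\<Sum>d\<in>F m. \<integral>x. indicator E (\<psi> d x) \<partial>M)"
      using integral_action_comp[of _ "indicator E"] Fm(2)
      by (intro arg_cong[where f="(*) l"] sum.cong) (auto simp: subset_eq)
    also have "\<dots> = (\<integral>x. l * card {d\<in>F m. \<psi> d x \<in> E} \<partial>M)"
    proof -
      have "real (card {d\<in>F m. \<psi> d x \<in> E}) = (\<Sum>d\<in>F m. indicator E (\<psi> d x))" for x
        using Fm(1) by (simp add: indicator_def sum.inter_filter[symmetric] Int_def)
      moreover have "integrable M (\<lambda>x. indicator E (\<psi> d x) :: real)" if "d \<in> F m" for d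
        using that Fm(2) by (intro integrable_action_comp integrable_indicator_event) auto
      ultimately show ?thesis by (simp add: Bochner_Integration.integral_sum)
    qed
    also have "\<dots> \<le> (\<integral>x. (2 + 2 * C) * (\<Sum>g\<in>W. f (\<psi> g x)) \<partial>M)"
    proof (rule integral_mono)
      have [measurable]: "d \<in> carrier G" if "d \<in> F m" for d using Fm that by auto
      have "(\<lambda>x. real (card {d\<in>F m. \<psi> d x \<in> E})) = (\<lambda>x. \<Sum>d\<in>F m. indicator E (\<psi> d x))"
        using Fm(1) by (simp add: indicator_def sum.inter_filter[symmetric] Int_def)
      moreover have "integrable M (\<lambda>x. \<Sum>d\<in>F m. indicator E (\<psi> d x) :: real)"
        using Fm(2) by (intro Bochner_Integration.integrable_sum integrable_action_comp integrable_indicator_event) auto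
      ultimately have "integrable M (\<lambda>x. real (card {d\<in>F m. \<psi> d x \<in> E}))" by simp
      then show "integrable M (\<lambda>x. l * card {d\<in>F m. \<psi> d x \<in> E})" by simp
      show "integrable M (\<lambda>x. (2 + 2 * C) * (\<Sum>g\<in>W. f (\<psi> g x)))"
        using W integrable_action_comp[OF _ intf]
        by (intro integrable_mult_right Bochner_Integration.integrable_sum) auto
    qed (rule pointwise)
    also have "\<dots> = (2 + 2 * C) * (\<Sum>g\<in>W. \<integral>x. f (\<psi> g x) \<partial>M)"
      using W integrable_action_comp[OF _ intf]
      by (simp add: Bochner_Integration.integral_sum subset_eq)
    also have "\<dots> = (2 + 2 * C) * (card W * integral\<^sup>L M f)"
      using W integral_action_comp[of _ f] by (simp add: subset_eq)
    also have "\<dots> \<le> (2 + 2 * C) * ((card (F m) * (1 + (\<Sum>k\<in>KK. r m k))) * integral\<^sup>L M f)"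
      using cardW temp(1) nonneg by (intro mult_left_mono mult_right_mono) auto
    finally have "card (F m) * (l * prob E) \<le> card (F m) * ((2 + 2 * C) * ((1 + (\<Sum>k\<in>KK. r m k)) * integral\<^sup>L M f))"
      by (simp add: algebra_simps)
    then show ?thesis using Fm(3) by simp
  qed
  \<comment> \<open>\<open>KK\<close> is a fixed finite set, so the Folner property removes all
    boundary terms as \<open>m\<close> grows.\<close>
  have "(\<lambda>m. \<Sum>k\<in>KK. r m k) \<longlonglongrightarrow> (\<Sum>k\<in>KK. 0)"
    unfolding r_def using KK by (intro tendsto_sum folner_tendsto) auto
  then have "(\<lambda>m. (2 + 2 * C) * ((1 + (\<Sum>k\<in>KK. r m k)) * integral\<^sup>L M f))
        \<longlonglongrightarrow> (2 + 2 * C) * ((1 + 0) * integral\<^sup>L M f)"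
    by (intro tendsto_intros) simp
  from LIMSEQ_le_const[OF this] have "l * prob E \<le> (2 + 2 * C) * ((1 + 0) * integral\<^sup>L M f)"
    using key by blast
  then show ?thesis by (simp add: E_def)
qed

lemma maximal_inequality:
  assumes temp: "0 \<le> C" "\<And>n. 1 \<le> n \<Longrightarrow>
        real (card (\<Union>k\<in>{1..<n}. (set_inv (F k)) <#> F n)) \<le> C * real (card (F n))"
    and l: "0 \<le> l"
    and [measurable]: "f \<in> borel_measurable M" and nonneg: "\<And>x. 0 \<le> f x" and fB: "\<And>x. f x \<le> B"
  shows "l * prob {x\<in>space M. \<exists>n\<ge>1. l < avg n f x} \<le> (2 + 2 * C) * integral\<^sup>L M f"
proof -
  define E where "E N = {x\<in>space M. \<exists>n\<in>{1..N}. l < avg n f x}" for N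
  have "E N \<in> sets M" for N unfolding E_def by measurable
  moreover have "incseq E" by (auto simp: incseq_def E_def)
  ultimately have "(\<lambda>N. prob (E N)) \<longlonglongrightarrow> prob (\<Union>N. E N)"
    by (intro finite_Lim_measure_incseq) auto
  then have "(\<lambda>N. l * prob (E N)) \<longlonglongrightarrow> l * prob (\<Union>N. E N)"
    by (rule tendsto_mult_left)
  moreover have "(\<Union>N. E N) = {x\<in>space M. \<exists>n\<ge>1. l < avg n f x}"
    unfolding E_def by fastforce
  moreover have "l * prob (E N) \<le> (2 + 2 * C) * integral\<^sup>L M f" for N
    unfolding E_def by (rule maximal_inequality_bounded_range) (use assms in auto)
  ultimately show ?thesis by (metis LIMSEQ_le_const2)
qed

end

section \<open>The mean ergodic theorem in L1\<close>

text \<open>A limit superior is a representative defined at every point, so an inequality valid for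
  all averages passes to the limit everywhere and not only almost everywhere. An infinite value
  would be sent to 0 by \<open>real_of_ereal\<close>; the comparison lemmas therefore ask for a
  uniform bound.\<close>

definition real_limsup :: "(nat \<Rightarrow> real) \<Rightarrow> real" where
  "real_limsup X = real_of_ereal (limsup (\<lambda>j. ereal (X j)))"

lemma ereal_real_limsup:
  assumes "\<And>j. \<bar>X j\<bar> \<le> B"
  shows "ereal (real_limsup X) = limsup (\<lambda>j. ereal (X j))"
proof -
  have "X j \<le> B \<and> - B \<le> X j" for j using assms[of j] by (simp add: abs_le_iff)
  then have "limsup (\<lambda>j. ereal (X j)) \<le> ereal B" "ereal (- B) \<le> limsup (\<lambda>j. ereal (X j))"
    by (auto intro!: Limsup_bounded le_Limsup)
  then show ?thesis unfolding real_limsup_def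
    by (metis MInfty_neq_ereal(1) PInfty_neq_ereal(1) ereal_infty_less_eq(1,2) ereal_real'
        abs_ereal.elims infinity_ereal_def abs_neq_infinity_cases)
qed

lemma real_limsup_le:
  assumes "\<And>j. \<bar>X j\<bar> \<le> B" and "\<And>j. X j \<le> c"
  shows "real_limsup X \<le> c"
proof -
  have "limsup (\<lambda>j. ereal (X j)) \<le> ereal c" using assms by (intro Limsup_bounded) auto
  then show ?thesis using ereal_real_limsup[of X B] assms(1) by (metis ereal_less_eq(3))
qed

lemma real_limsup_ge:
  assumes "\<And>j. \<bar>X j\<bar> \<le> B" and "\<And>j. c \<le> X j"
  shows "c \<le> real_limsup X"
proof -
  have "ereal c \<le> limsup (\<lambda>j. ereal (X j))" using assms by (intro le_Limsup) auto
  then show ?thesis using ereal_real_limsup[of X B] assms(1) by (metis ereal_less_eq(3))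
qed

lemma real_limsup_triangle:
  assumes B: "\<And>j. \<bar>X j\<bar> \<le> B" "\<And>j. \<bar>Y j\<bar> \<le> B" "\<And>j. \<bar>Z j\<bar> \<le> B"
    and le: "\<And>j. X j \<le> Y j + Z j"
  shows "real_limsup X \<le> real_limsup Y + real_limsup Z"
proof -
  have "ereal (real_limsup X) \<le> limsup (\<lambda>j. ereal (Y j) + ereal (Z j))"
    unfolding ereal_real_limsup[of X, OF B(1)] using le by (intro Limsup_mono) auto
  also have "\<dots> \<le> ereal (real_limsup Y) + ereal (real_limsup Z)"
    unfolding ereal_real_limsup[of Y, OF B(2)] ereal_real_limsup[of Z, OF B(3)]
    by (rule ereal_limsup_add_mono)
  finally show ?thesis by simp
qed

lemma real_limsup_eq_lim:
  assumes "X \<longlonglongrightarrow> l"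
  shows "real_limsup X = l"
proof -
  have "(\<lambda>j. ereal (X j)) \<longlonglongrightarrow> ereal l" using assms by (intro tendsto_ereal)
  then have "limsup (\<lambda>j. ereal (X j)) = ereal l" by (intro lim_imp_Limsup) auto
  then show ?thesis by (simp add: real_limsup_def)
qed

lemma borel_measurable_real_limsup [measurable]:
  assumes [measurable]: "\<And>j. X j \<in> borel_measurable M"
  shows "(\<lambda>x. real_limsup (\<lambda>j. X j x)) \<in> borel_measurable M"
  unfolding real_limsup_def by measurable

text \<open>Closure under midpoints is all that the parallelogram law needs. Elements are finite
  dyadic averages of members of \<open>S\<close>, so bounds and comparisons of averages follow by
  induction.\<close>

inductive_set dyadic_hull :: "('a \<Rightarrow> real) set \<Rightarrow> ('a \<Rightarrow> real) set" for S where
  base: "f \<in> S \<Longrightarrow> f \<in> dyadic_hull S"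
| mid: "u \<in> dyadic_hull S \<Longrightarrow> v \<in> dyadic_hull S \<Longrightarrow> (\<lambda>x. (u x + v x) / 2) \<in> dyadic_hull S"

lemma square_le_square_of_abs_le: "\<bar>a\<bar> \<le> b \<Longrightarrow> a\<^sup>2 \<le> b\<^sup>2" for a b :: real
  by (metis abs_ge_zero power2_abs power_mono)

definition L1_dist :: "'a measure \<Rightarrow> ('a \<Rightarrow> real) \<Rightarrow> ('a \<Rightarrow> real) \<Rightarrow> real" where
  "L1_dist M f g = (\<integral>x. \<bar>f x - g x\<bar> \<partial>M)"

lemma L1_dist_nonneg: "0 \<le> L1_dist M f g"
  unfolding L1_dist_def by simp

lemma L1_dist_commute: "L1_dist M f g = L1_dist M g f"
  unfolding L1_dist_def by (simp add: abs_minus_commute)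

lemma L1_dist_triangle:
  assumes "integrable M f" "integrable M g" "integrable M h"
  shows "L1_dist M f h \<le> L1_dist M f g + L1_dist M g h"
proof -
  have "L1_dist M f h \<le> (\<integral>x. \<bar>f x - g x\<bar> + \<bar>g x - h x\<bar> \<partial>M)"
    unfolding L1_dist_def using assms by (intro integral_mono) auto
  then show ?thesis using assms by (simp add: L1_dist_def)
qed

lemma L1_dist_eq_0_AE:
  assumes "integrable M f" "integrable M g" "L1_dist M f g \<le> 0"
  shows "AE x in M. f x = g x"
proof -
  have "(\<integral>x. \<bar>f x - g x\<bar> \<partial>M) = 0"
    using assms(3) L1_dist_nonneg[of M f g] unfolding L1_dist_def by (rule antisym)
  then have "AE x in M. \<bar>f x - g x\<bar> = 0"
    using assms by (subst (asm) integral_nonneg_eq_0_iff_AE) auto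
  then show ?thesis by auto
qed

section \<open>Almost invariant functions in the hull of an orbit\<close>

context folner_action begin

lemma L1_dist_action:
  assumes "g \<in> carrier G" and [measurable]: "f \<in> borel_measurable M" "h \<in> borel_measurable M"
  shows "L1_dist M (\<lambda>x. f (\<psi> g x)) (\<lambda>x. h (\<psi> g x)) = L1_dist M f h"
  unfolding L1_dist_def by (rule integral_action_comp[where f="\<lambda>x. \<bar>f x - h x\<bar>"]) (use assms in auto)

definition orbit_functions :: "('a \<Rightarrow> real) \<Rightarrow> ('a \<Rightarrow> real) set" where
  "orbit_functions f = {\<lambda>x. f (\<psi> g x) | g. g \<in> carrier G}"

lemma hull_bounded_measurable:
  assumes [measurable]: "f \<in> borel_measurable M" and B: "\<And>x. \<bar>f x\<bar> \<le> B"
    and "v \<in> dyadic_hull (orbit_functions f)"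
  shows "v \<in> borel_measurable M \<and> (\<forall>x. \<bar>v x\<bar> \<le> B)"
  using assms(3)
proof induction
  case (base v)
  then show ?case using B by (auto simp: orbit_functions_def)
next
  case (mid u v)
  have "\<bar>(u x + v x) / 2\<bar> \<le> B" for x
    using mid.IH(1)[THEN conjunct2, rule_format, of x] mid.IH(2)[THEN conjunct2, rule_format, of x]
    by (simp add: abs_le_iff)
  then show ?case using mid.IH by auto
qed

lemma hull_action:
  assumes "v \<in> dyadic_hull (orbit_functions f)" and g: "g \<in> carrier G"
  shows "(\<lambda>x. v (\<psi> g x)) \<in> dyadic_hull (orbit_functions f)"
  using assms(1)
proof induction
  case (base v)
  then obtain h where h: "h \<in> carrier G" "v = (\<lambda>x. f (\<psi> h x))" by (auto simp: orbit_functions_def)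
  have "(\<lambda>x. v (\<psi> g x)) = (\<lambda>x. f (\<psi> (h \<otimes> g) x))" using h g by (simp add: action_mult)
  then show ?case
    using h g by (intro dyadic_hull.base) (auto simp: orbit_functions_def)
next
  case (mid u v)
  then show ?case by (intro dyadic_hull.mid)
qed

text \<open>Averages of a translate differ from those of \<open>f\<close> by a boundary term
  independent of \<open>x\<close>, and a midpoint inherits the mean of two such errors. The whole
  hull thus has asymptotically the same averages, uniformly in \<open>x\<close>.\<close>

lemma avg_hull_tendsto:
  assumes B: "\<And>x. \<bar>f x\<bar> \<le> B" and "v \<in> dyadic_hull (orbit_functions f)"
  shows "\<exists>\<epsilon>. \<epsilon> \<longlonglongrightarrow> 0 \<and> (\<forall>n\<ge>1. \<forall>x. \<bar>avg n v x - avg n f x\<bar> \<le> \<epsilon> n)"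
  using assms(2)
proof induction
  case (base v)
  then obtain h where h: "h \<in> carrier G" "v = (\<lambda>x. f (\<psi> h x))" by (auto simp: orbit_functions_def)
  have "(\<lambda>n. B * (real (card (sym_diff (h <#\<^bsub>G\<^esub> F n) (F n))) / real (card (F n)))) \<longlonglongrightarrow> B * 0"
    by (intro tendsto_mult_left folner_tendsto h)
  moreover have "\<bar>avg n v x - avg n f x\<bar>
      \<le> B * (real (card (sym_diff (h <#\<^bsub>G\<^esub> F n) (F n))) / real (card (F n)))" if "1 \<le> n" for n x
    unfolding h(2) by (rule avg_translate_bound[OF h(1) that B])
  ultimately show ?case unfolding mult_zero_right by blast
next
  case (mid u v)
  then obtain a b where a: "a \<longlonglongrightarrow> 0" "\<And>n x. 1 \<le> n \<Longrightarrow> \<bar>avg n u x - avg n f x\<bar> \<le> a n"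
    and b: "b \<longlonglongrightarrow> 0" "\<And>n x. 1 \<le> n \<Longrightarrow> \<bar>avg n v x - avg n f x\<bar> \<le> b n"
    by blast
  have eq: "avg n (\<lambda>x. (u x + v x) / 2) x = (avg n u x + avg n v x) / 2" for n x
    by (simp add: avg_def sum_divide_distrib[symmetric] sum.distrib add_divide_distrib)
  have "\<bar>avg n (\<lambda>x. (u x + v x) / 2) x - avg n f x\<bar> \<le> (a n + b n) / 2" if "1 \<le> n" for n x
    using a(2)[OF that, of x] b(2)[OF that, of x] unfolding eq by (simp add: abs_le_iff field_simps)
  moreover have "(\<lambda>n. (a n + b n) / 2) \<longlonglongrightarrow> (0 + 0) / 2" by (intro tendsto_intros a b) simp
  then have "(\<lambda>n. (a n + b n) / 2) \<longlonglongrightarrow> 0" by (simp only: add_0 div_0)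
  ultimately show ?case by blast
qed

text \<open>Two almost minimal elements of the hull have a midpoint in the hull, so by the parallelogram
  law they are close; a translate of an almost minimal element is almost minimal.\<close>

lemma hull_almost_invariant:
  assumes [measurable]: "f \<in> borel_measurable M" and B: "\<And>x. \<bar>f x\<bar> \<le> B" and e: "0 < e"
  shows "\<exists>v\<in>dyadic_hull (orbit_functions f). \<forall>g\<in>carrier G. L1_dist M (\<lambda>x. v (\<psi> g x)) v \<le> e"
proof -
  define H where "H = dyadic_hull (orbit_functions f)"
  have H: "v \<in> borel_measurable M" "\<bar>v x\<bar> \<le> B" if "v \<in> H" for v x
    using hull_bounded_measurable[OF assms(1) B] that by (auto simp: H_def)
  have int2: "integrable M (\<lambda>x. (v x)\<^sup>2)" if "v \<in> H" for v
    using H[OF that]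
    by (intro integrable_bounded[of _ "B\<^sup>2"]) (auto intro: square_le_square_of_abs_le)
  define q where "q v = (\<integral>x. (v x)\<^sup>2 \<partial>M)" for v :: "'a \<Rightarrow> real"
  define c where "c = Inf (q ` H)"
  have "f \<in> H" unfolding H_def
    by (rule dyadic_hull.base) (auto simp: orbit_functions_def action_one intro!: exI[of _ \<one>])
  then have ne: "q ` H \<noteq> {}" by auto
  have bdd: "bdd_below (q ` H)" by (rule bdd_belowI[of _ 0]) (auto simp: q_def)
  have c: "c \<le> q v" if "v \<in> H" for v unfolding c_def using that bdd by (intro cInf_lower) auto
  \<comment> \<open>Chosen so that the final bound \<open>t\<^sup>2 / t + t\<close> equals
    \<open>e\<close>.\<close>
  define t where "t = e / 2"
  have t: "t > 0" using e by (simp add: t_def)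
  have "Inf (q ` H) < c + t\<^sup>2" using t by (simp add: c_def)
  then obtain v where v: "v \<in> H" "q v < c + t\<^sup>2" using cInf_lessD[OF ne] by blast
  note vm [measurable] = H(1)[OF v(1)]
  have "L1_dist M (\<lambda>x. v (\<psi> g x)) v \<le> e" if g: "g \<in> carrier G" for g
  proof -
    note [measurable] = g
    define u where "u x = v (\<psi> g x)" for x
    have u: "u \<in> H" unfolding u_def H_def using hull_action[OF _ g] v H_def by auto
    have m: "(\<lambda>x. (u x + v x) / 2) \<in> H" using dyadic_hull.mid u v by (auto simp: H_def)
    have qu: "q u = q v"
      unfolding q_def u_def by (rule integral_action_comp[OF g, where f="\<lambda>x. (v x)\<^sup>2"]) simp
    have [measurable]: "u \<in> borel_measurable M" by (rule H(1)[OF u])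
    have intd: "integrable M (\<lambda>x. ((u x - v x) / 2)\<^sup>2)"
    proof (rule integrable_bounded[of _ "B\<^sup>2"])
      show "\<bar>((u x - v x) / 2)\<^sup>2\<bar> \<le> B\<^sup>2" for x
        using H(2)[OF u, of x] H(2)[OF v(1), of x]
        unfolding abs_power2 by (intro square_le_square_of_abs_le) (simp add: abs_le_iff field_simps)
    qed simp
    have "(\<integral>x. ((u x - v x) / 2)\<^sup>2 \<partial>M) = (\<integral>x. ((u x)\<^sup>2 + (v x)\<^sup>2) / 2 - ((u x + v x) / 2)\<^sup>2 \<partial>M)"
      by (intro Bochner_Integration.integral_cong) (auto simp: power2_eq_square field_simps)
    also have "\<dots> = (q u + q v) / 2 - q (\<lambda>x. (u x + v x) / 2)"
      unfolding q_def using int2[OF u] int2[OF v(1)] int2[OF m] by simp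
    also have "\<dots> \<le> t\<^sup>2" using qu v(2) c[OF m] by simp
    finally have small: "(\<integral>x. ((u x - v x) / 2)\<^sup>2 \<partial>M) \<le> t\<^sup>2" .
    \<comment> \<open>Young's inequality with parameter \<open>t\<close>, in place of
      Cauchy-Schwarz, turns the bound on the square integral into one on the L1 distance.\<close>
    have "\<bar>u x - v x\<bar> \<le> ((u x - v x) / 2)\<^sup>2 / t + t" for x
    proof -
      have "0 \<le> (\<bar>(u x - v x) / 2\<bar> - t)\<^sup>2" by simp
      then have "2 * t * \<bar>(u x - v x) / 2\<bar> \<le> ((u x - v x) / 2)\<^sup>2 + t\<^sup>2"
        unfolding power2_diff power2_abs by (simp add: mult_ac)
      then show ?thesis using t by (simp add: field_simps power2_eq_square)
    qed
    then have "L1_dist M u v \<le> (\<integral>x. ((u x - v x) / 2)\<^sup>2 / t + t \<partial>M)"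
      unfolding L1_dist_def using intd H[OF u] H[OF v(1)]
      by (intro integral_mono integrable_abs Bochner_Integration.integrable_diff integrable_bounded[of u B] integrable_bounded[of v B]) auto
    also have "\<dots> = (\<integral>x. ((u x - v x) / 2)\<^sup>2 \<partial>M) / t + t"
      using intd by (simp add: prob_space)
    also have "\<dots> \<le> t\<^sup>2 / t + t" using small t by (simp add: divide_right_mono)
    also have "\<dots> = e" using t by (simp add: power2_eq_square t_def)
    finally show ?thesis by (simp add: u_def[abs_def])
  qed
  then show ?thesis using v H_def by blast
qed

lemma L1_dist_avg_le:
  assumes [measurable]: "v \<in> borel_measurable M" and B: "\<And>x. \<bar>v x\<bar> \<le> B" and n: "1 \<le> n"
    and inv: "\<And>g. g \<in> carrier G \<Longrightarrow> L1_dist M (\<lambda>x. v (\<psi> g x)) v \<le> e"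
  shows "L1_dist M (avg n v) v \<le> e"
proof -
  have intv: "integrable M v" using B by (intro integrable_bounded) auto
  have c: "0 < card (F n)" using folner_card_pos[OF n] .
  have Fc: "h \<in> carrier G" if "h \<in> F n" for h using folner_carrier[OF n] that by auto
  have int: "integrable M (\<lambda>x. \<bar>v (\<psi> h x) - v x\<bar>)" if "h \<in> F n" for h
    using integrable_action_comp[OF Fc[OF that] intv] intv by auto
  have "\<bar>avg n v x - v x\<bar> \<le> (\<Sum>h\<in>F n. \<bar>v (\<psi> h x) - v x\<bar>) / card (F n)" for x
  proof -
    have "avg n v x - v x = (\<Sum>h\<in>F n. v (\<psi> h x) - v x) / card (F n)"
      using c by (simp add: avg_def sum_subtractf field_simps)
    then show ?thesis by (simp add: abs_divide divide_right_mono sum_abs)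
  qed
  moreover have "integrable M (avg n v)"
    using n B by (intro integrable_bounded[of _ B] abs_avg_le) auto
  ultimately have "L1_dist M (avg n v) v \<le> (\<integral>x. (\<Sum>h\<in>F n. \<bar>v (\<psi> h x) - v x\<bar>) / card (F n) \<partial>M)"
    unfolding L1_dist_def using int intv integrable_action_comp[OF Fc intv]
    by (intro integral_mono integrable_abs Bochner_Integration.integrable_diff
        integrable_divide Bochner_Integration.integrable_sum) auto
  also have "\<dots> = (\<Sum>h\<in>F n. L1_dist M (\<lambda>x. v (\<psi> h x)) v) / card (F n)"
    unfolding L1_dist_def using int by (simp add: Bochner_Integration.integral_sum)
  also have "\<dots> \<le> (\<Sum>h\<in>F n. e) / card (F n)"
    using inv Fc by (intro divide_right_mono sum_mono) auto
  also have "\<dots> = e" using c by simp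
  finally show ?thesis .
qed

text \<open>One \<open>v\<close> serves all large \<open>n\<close>: the averages of \<open>f\<close>
  approach those of \<open>v\<close> uniformly, and averaging moves the almost invariant
  \<open>v\<close> only a little.\<close>

lemma avg_close_to_hull:
  assumes [measurable]: "f \<in> borel_measurable M" and B: "\<And>x. \<bar>f x\<bar> \<le> B" and e: "0 < e"
  shows "\<exists>v N. v \<in> dyadic_hull (orbit_functions f) \<and> (\<forall>g\<in>carrier G. L1_dist M (\<lambda>x. v (\<psi> g x)) v \<le> e)
            \<and> 1 \<le> N \<and> (\<forall>n\<ge>N. L1_dist M (avg n f) v \<le> e)"
proof -
  from hull_almost_invariant[OF assms(1) B, of "e / 2"] e
  obtain v where v: "v \<in> dyadic_hull (orbit_functions f)"
    and inv: "\<And>g. g \<in> carrier G \<Longrightarrow> L1_dist M (\<lambda>x. v (\<psi> g x)) v \<le> e / 2" by auto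
  have vm [measurable]: "v \<in> borel_measurable M" and vB: "\<And>x. \<bar>v x\<bar> \<le> B"
    using hull_bounded_measurable[OF assms(1) B v] by auto
  from avg_hull_tendsto[OF B v] obtain \<epsilon> where lim: "\<epsilon> \<longlonglongrightarrow> 0"
    and \<epsilon>: "\<And>n x. 1 \<le> n \<Longrightarrow> \<bar>avg n v x - avg n f x\<bar> \<le> \<epsilon> n" by blast
  from order_tendstoD(2)[OF lim, of "e / 2"] e obtain N0 where N0: "\<And>n. N0 \<le> n \<Longrightarrow> \<epsilon> n < e / 2"
    by (auto simp: eventually_sequentially)
  have "L1_dist M (avg n f) v \<le> e" if n: "max 1 N0 \<le> n" for n
  proof -
    have n1: "1 \<le> n" using n by simp
    have i: "integrable M (avg n f)" "integrable M (avg n v)" "integrable M v"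
      using n1 B vB by (auto intro!: integrable_bounded[of _ B] abs_avg_le)
    have "L1_dist M (avg n f) (avg n v) \<le> (\<integral>x. e / 2 \<partial>M)"
      unfolding L1_dist_def
    proof (rule integral_mono)
      show "\<bar>avg n f x - avg n v x\<bar> \<le> e / 2" for x
        using \<epsilon>[OF n1, of x] N0[of n] n by (simp add: abs_minus_commute)
    qed (use i in auto)
    then have "L1_dist M (avg n f) (avg n v) \<le> e / 2" by (simp add: prob_space)
    moreover have "L1_dist M (avg n v) v \<le> e / 2" by (rule L1_dist_avg_le[OF vm vB n1 inv])
    ultimately show ?thesis using L1_dist_triangle[OF i] by simp
  qed
  moreover have "L1_dist M (\<lambda>x. v (\<psi> g x)) v \<le> e" if "g \<in> carrier G" for g
    using inv[OF that] e by simp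
  ultimately show ?thesis using v by (intro exI[of _ v] exI[of _ "max 1 N0"]) auto
qed

text \<open>The averages are Cauchy in L1 because all late ones are close to a single almost
  invariant function. The formula of \<open>p\<close> as a limit superior is part of the conclusion,
  since symmetry and the triangle inequality of the later pseudometric are read off from it at every
  point.\<close>

theorem mean_ergodic:
  assumes fm [measurable]: "f \<in> borel_measurable M" and B: "\<And>x. \<bar>f x\<bar> \<le> B"
  shows "\<exists>r p. (\<forall>j. 1 \<le> r j) \<and> (\<forall>x. p x = real_limsup (\<lambda>j. avg (r j) f x)) \<and>
    p \<in> borel_measurable M \<and> (\<forall>x. \<bar>p x\<bar> \<le> B) \<and>
    (\<lambda>n. L1_dist M (avg n f) p) \<longlonglongrightarrow> 0 \<and>
    (\<forall>g\<in>carrier G. AE x in M. p (\<psi> g x) = p x)"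
proof -
  \<comment> \<open>The shift by one skips \<open>F 0\<close>, which is unconstrained.\<close>
  define s where "s j = avg (Suc j) f" for j
  have sm [measurable]: "s j \<in> borel_measurable M" for j unfolding s_def by simp
  have sB: "\<bar>s j x\<bar> \<le> B" for j x unfolding s_def by (rule abs_avg_le[OF B])
  have sint: "integrable M (s j)" for j using sB by (intro integrable_bounded[of _ B]) auto
  have cauchy: "\<exists>N. \<forall>i\<ge>N. \<forall>j\<ge>N. L1_dist M (s i) (s j) < e" if e: "0 < e" for e
  proof -
    from avg_close_to_hull[OF fm B, of "e / 3"] e obtain v N where
      v: "v \<in> dyadic_hull (orbit_functions f)" and N: "\<And>n. N \<le> n \<Longrightarrow> L1_dist M (avg n f) v \<le> e / 3"
      by auto
    have "integrable M v" using hull_bounded_measurable[OF fm B v] by (intro integrable_bounded[of _ B]) auto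
    then have "L1_dist M (s i) (s j) \<le> L1_dist M (s i) v + L1_dist M (s j) v" for i j
      using L1_dist_triangle[OF sint _ sint] by (metis L1_dist_commute)
    note tri = this
    have near: "L1_dist M (s i) v \<le> e / 3" if "N \<le> i" for i using N[of "Suc i"] that by (simp add: s_def)
    have "L1_dist M (s i) (s j) < e" if "N \<le> i" "N \<le> j" for i j
      using tri[of i j] near[OF that(1)] near[OF that(2)] e by linarith
    then show ?thesis by blast
  qed
  obtain r' where r': "strict_mono r'" "AE x in M. Cauchy (\<lambda>i. s (r' i) x)"
    by (rule cauchy_L1_AE_cauchy_subseq[OF sint]) (use cauchy in \<open>auto simp: L1_dist_def\<close>)
  define p where "p x = real_limsup (\<lambda>i. s (r' i) x)" for x
  have pm [measurable]: "p \<in> borel_measurable M" unfolding p_def by measurable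
  have pB: "\<bar>p x\<bar> \<le> B" for x
  proof -
    have "- B \<le> s (r' j) x" "s (r' j) x \<le> B" for j using sB[of "r' j" x] by (simp_all add: abs_le_iff)
    then show ?thesis
      using real_limsup_le[of "\<lambda>i. s (r' i) x" B B] real_limsup_ge[of "\<lambda>i. s (r' i) x" B "- B"]
        sB unfolding p_def by (simp add: abs_le_iff)
  qed
  have pint: "integrable M p" using pB by (intro integrable_bounded[of _ B]) auto
  have AElim: "AE x in M. (\<lambda>i. s (r' i) x) \<longlonglongrightarrow> p x"
    using r'(2)
  proof eventually_elim
    case (elim x)
    then obtain l where l: "(\<lambda>i. s (r' i) x) \<longlonglongrightarrow> l" using Cauchy_convergent convergent_def by blast
    then show ?case unfolding p_def using real_limsup_eq_lim[OF l] by simp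
  qed
  have sub: "(\<lambda>i. L1_dist M (s (r' i)) p) \<longlonglongrightarrow> 0"
  proof -
    have "(\<lambda>i. \<integral>x. \<bar>s (r' i) x - p x\<bar> \<partial>M) \<longlonglongrightarrow> (\<integral>x. 0 \<partial>M)"
    proof (rule integral_dominated_convergence[where w="\<lambda>_. 2 * B"])
      show "AE x in M. (\<lambda>i. \<bar>s (r' i) x - p x\<bar>) \<longlonglongrightarrow> 0"
        using AElim by eventually_elim (auto intro: tendsto_rabs_zero simp: LIM_zero_iff)
      show "AE x in M. norm \<bar>s (r' i) x - p x\<bar> \<le> 2 * B" for i
        using sB[of "r' i"] pB by (intro AE_I2) (smt (verit) real_norm_def)
    qed auto
    then show ?thesis by (simp add: L1_dist_def)
  qed
  have lim: "(\<lambda>j. L1_dist M (s j) p) \<longlonglongrightarrow> 0"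
  proof (rule LIMSEQ_I)
    fix e :: real assume e: "0 < e"
    obtain N where N: "\<And>i j. N \<le> i \<Longrightarrow> N \<le> j \<Longrightarrow> L1_dist M (s i) (s j) < e / 2"
      using cauchy[of "e / 2"] e by auto
    from order_tendstoD(2)[OF sub, of "e / 2"] e obtain N' where N': "\<And>i. N' \<le> i \<Longrightarrow> L1_dist M (s (r' i)) p < e / 2"
      by (auto simp: eventually_sequentially)
    define i where "i = max N N'"
    have ri: "N \<le> r' i" using seq_suble[OF r'(1), of i] by (simp add: i_def)
    have "L1_dist M (s j) p < e" if "N \<le> j" for j
      using L1_dist_triangle[OF sint sint pint, of j "r' i"] N[OF that ri] N'[of i] by (simp add: i_def)
    then show "\<exists>no. \<forall>n\<ge>no. norm (L1_dist M (s n) p - 0) < e"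
      by (intro exI[of _ N]) (simp add: abs_of_nonneg[OF L1_dist_nonneg])
  qed
  then have lim': "(\<lambda>n. L1_dist M (avg n f) p) \<longlonglongrightarrow> 0"
    unfolding s_def by (rule LIMSEQ_imp_Suc)
  have inv: "AE x in M. p (\<psi> g x) = p x" if g: "g \<in> carrier G" for g
  proof -
    have pg: "integrable M (\<lambda>x. p (\<psi> g x))" by (rule integrable_action_comp[OF g pint])
    have "L1_dist M (\<lambda>x. p (\<psi> g x)) p \<le> 0 + e" if e: "0 < e" for e
    proof -
      \<comment> \<open>Passing between \<open>p\<close> and \<open>v\<close> costs two fifths of
        \<open>e\<close>, before and after translation, and translating \<open>v\<close> costs the
        remaining fifth.\<close>
      from avg_close_to_hull[OF fm B, of "e / 5"] e obtain v N where
        v: "v \<in> dyadic_hull (orbit_functions f)"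
        and vi: "L1_dist M (\<lambda>x. v (\<psi> g x)) v \<le> e / 5"
        and N: "1 \<le> N" "\<And>n. N \<le> n \<Longrightarrow> L1_dist M (avg n f) v \<le> e / 5"
        using g by auto
      from order_tendstoD(2)[OF lim', of "e / 5"] e obtain N' where N': "\<And>i. N' \<le> i \<Longrightarrow> L1_dist M (avg i f) p < e / 5"
        by (auto simp: eventually_sequentially)
      define n where "n = max N N'"
      have vm [measurable]: "v \<in> borel_measurable M" and vint: "integrable M v"
        using hull_bounded_measurable[OF fm B v] by (auto intro!: integrable_bounded[of _ B])
      have n1: "1 \<le> n" using N by (simp add: n_def)
      have an [measurable]: "avg n f \<in> borel_measurable M" using n1 by simp
      have aint: "integrable M (avg n f)" using B by (intro integrable_bounded[of _ B] abs_avg_le) auto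
      have vp: "L1_dist M v p \<le> 2 * (e / 5)"
        using L1_dist_triangle[OF vint aint pint] N(2)[of n] N'[of n]
        by (simp add: n_def L1_dist_commute[of M v])
      have "L1_dist M (\<lambda>x. p (\<psi> g x)) (\<lambda>x. v (\<psi> g x)) = L1_dist M p v"
        by (rule L1_dist_action[OF g]) auto
      then show ?thesis
        using L1_dist_triangle[OF pg integrable_action_comp[OF g vint] pint]
          L1_dist_triangle[OF integrable_action_comp[OF g vint] vint pint] vp vi e
        by (simp add: L1_dist_commute[of M p v])
    qed
    then have "L1_dist M (\<lambda>x. p (\<psi> g x)) p \<le> 0" by (rule field_le_epsilon)
    then show ?thesis by (rule L1_dist_eq_0_AE[OF pg pint])
  qed
  have p_eq: "p x = real_limsup (\<lambda>j. avg (Suc (r' j)) f x)" for x by (simp add: p_def s_def)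
  show ?thesis
    by (intro exI[of _ "\<lambda>j. Suc (r' j)"] exI[of _ p] conjI allI ballI pm pB lim' inv p_eq) simp_all
qed

end

section \<open>Almost periodic functions and the Kronecker algebra\<close>

context folner_action begin

text \<open>Total boundedness of the orbit in L1, written as a finite colouring of the group in
  which equal colours mean L1 distance below \<open>e\<close>. The colours are subsets of the group
  because a definition cannot quantify over the type of colours; \<open>almost_periodicI\<close>
  admits any type by passing to fibres.\<close>

definition almost_periodic :: "('a \<Rightarrow> real) \<Rightarrow> bool" where
  "almost_periodic f \<longleftrightarrow> (\<forall>e>0. \<exists>r::'g \<Rightarrow> 'g set. finite (r ` carrier G) \<and>
     (\<forall>g\<in>carrier G. \<forall>h\<in>carrier G. r g = r h \<longrightarrow> L1_dist M (\<lambda>x. f (\<psi> g x)) (\<lambda>x. f (\<psi> h x)) < e))"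

lemma almost_periodicI:
  fixes r :: "real \<Rightarrow> 'g \<Rightarrow> 'c"
  assumes fin: "\<And>e. 0 < e \<Longrightarrow> finite (r e ` carrier G)"
    and r: "\<And>e g h. 0 < e \<Longrightarrow> g \<in> carrier G \<Longrightarrow> h \<in> carrier G \<Longrightarrow> r e g = r e h \<Longrightarrow>
        L1_dist M (\<lambda>x. f (\<psi> g x)) (\<lambda>x. f (\<psi> h x)) < e"
  shows "almost_periodic f"
  unfolding almost_periodic_def
proof (intro allI impI)
  fix e :: real assume e: "0 < e"
  define q where "q g = {h\<in>carrier G. r e h = r e g}" for g
  have "q ` carrier G \<subseteq> (\<lambda>c. {h\<in>carrier G. r e h = c}) ` (r e ` carrier G)"
    by (auto simp: q_def)
  then have "finite (q ` carrier G)" using fin[OF e] finite_surj by blast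
  moreover have "r e g = r e h" if "g \<in> carrier G" "h \<in> carrier G" "q g = q h" for g h
    using that by (auto simp: q_def)
  ultimately show "\<exists>q::'g \<Rightarrow> 'g set. finite (q ` carrier G) \<and>
     (\<forall>g\<in>carrier G. \<forall>h\<in>carrier G. q g = q h \<longrightarrow> L1_dist M (\<lambda>x. f (\<psi> g x)) (\<lambda>x. f (\<psi> h x)) < e)"
    using r[OF e] by (intro exI[of _ q]) blast
qed

lemma almost_periodic_joint:
  fixes f :: "'i \<Rightarrow> 'a \<Rightarrow> real"
  assumes I: "finite I" and ap: "\<And>i. i \<in> I \<Longrightarrow> almost_periodic (f i)" and e: "0 < e"
  shows "\<exists>r::'g \<Rightarrow> 'i \<Rightarrow> 'g set. finite (r ` carrier G) \<and>
     (\<forall>g\<in>carrier G. \<forall>h\<in>carrier G. r g = r h \<longrightarrow>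
        (\<forall>i\<in>I. L1_dist M (\<lambda>x. f i (\<psi> g x)) (\<lambda>x. f i (\<psi> h x)) < e))"
proof -
  have "\<forall>i\<in>I. \<exists>r::'g \<Rightarrow> 'g set. finite (r ` carrier G) \<and>
     (\<forall>g\<in>carrier G. \<forall>h\<in>carrier G. r g = r h \<longrightarrow> L1_dist M (\<lambda>x. f i (\<psi> g x)) (\<lambda>x. f i (\<psi> h x)) < e)"
    using ap e by (simp add: almost_periodic_def)
  from bchoice[OF this] obtain r :: "'i \<Rightarrow> 'g \<Rightarrow> 'g set" where R: "\<forall>i\<in>I. finite (r i ` carrier G) \<and>
     (\<forall>g\<in>carrier G. \<forall>h\<in>carrier G. r i g = r i h \<longrightarrow> L1_dist M (\<lambda>x. f i (\<psi> g x)) (\<lambda>x. f i (\<psi> h x)) < e)"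
    by (rule exE)
  have fin: "\<And>i. i \<in> I \<Longrightarrow> finite (r i ` carrier G)"
    and r: "\<And>i g h. i \<in> I \<Longrightarrow> g \<in> carrier G \<Longrightarrow> h \<in> carrier G \<Longrightarrow> r i g = r i h \<Longrightarrow>
        L1_dist M (\<lambda>x. f i (\<psi> g x)) (\<lambda>x. f i (\<psi> h x)) < e"
    using R by blast+
  \<comment> \<open>The joint colour of \<open>g\<close> is the tuple of its colours for the single
    functions.\<close>
  define q where "q g = restrict (\<lambda>i. r i g) I" for g
  have "q ` carrier G \<subseteq> PiE I (\<lambda>i. r i ` carrier G)" by (auto simp: q_def)
  then have "finite (q ` carrier G)"
    by (rule finite_subset) (rule finite_PiE[OF I fin])
  moreover have "r i g = r i h" if "q g = q h" "i \<in> I" for g h i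
    using that by (metis q_def restrict_apply')
  ultimately show ?thesis using r by (intro exI[of _ q]) blast
qed

lemma integrable_comp_bounded:
  assumes "f \<in> borel_measurable M" "\<And>x. \<bar>f x\<bar> \<le> B" "g \<in> carrier G"
  shows "integrable M (\<lambda>x. f (\<psi> g x) :: real)"
  using assms by (intro integrable_bounded[of _ B]) auto

text \<open>A colouring adapted to all \<open>f i\<close> at a smaller scale also serves
  \<open>u\<close>. This is the common source of closure properties: unions, complements, cutoffs
  and step functions are Lipschitz in the functions from which they are built.\<close>

lemma almost_periodic_lipschitz:
  fixes f :: "'i \<Rightarrow> 'a \<Rightarrow> real"
  assumes I: "finite I" and ap: "\<And>i. i \<in> I \<Longrightarrow> almost_periodic (f i)"
    and fm: "\<And>i. i \<in> I \<Longrightarrow> f i \<in> borel_measurable M" and fB: "\<And>i x. i \<in> I \<Longrightarrow> \<bar>f i x\<bar> \<le> B"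
    and um: "u \<in> borel_measurable M" and uB: "\<And>x. \<bar>u x\<bar> \<le> B'" and C: "0 \<le> C"
    and lip: "\<And>x y. x \<in> space M \<Longrightarrow> y \<in> space M \<Longrightarrow> \<bar>u x - u y\<bar> \<le> C * (\<Sum>i\<in>I. \<bar>f i x - f i y\<bar>)"
  shows "almost_periodic u"
proof -
  \<comment> \<open>The summand 1 keeps the denominator positive when \<open>C * card I\<close>
    vanishes and makes the final inequality strict.\<close>
  define d where "d e = e / (C * card I + 1)" for e
  have pos: "0 < C * card I + 1" using C by (simp add: add_nonneg_pos)
  have "\<forall>e\<in>{0<..}. \<exists>r::'g \<Rightarrow> 'i \<Rightarrow> 'g set. finite (r ` carrier G) \<and>
     (\<forall>g\<in>carrier G. \<forall>h\<in>carrier G. r g = r h \<longrightarrow>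
        (\<forall>i\<in>I. L1_dist M (\<lambda>x. f i (\<psi> g x)) (\<lambda>x. f i (\<psi> h x)) < d e))"
    using pos by (intro ballI almost_periodic_joint[OF I ap]) (auto simp: d_def)
  from bchoice[OF this] obtain r where R: "\<forall>e\<in>{0<..}. finite ((r e :: 'g \<Rightarrow> 'i \<Rightarrow> 'g set) ` carrier G) \<and>
     (\<forall>g\<in>carrier G. \<forall>h\<in>carrier G. r e g = r e h \<longrightarrow>
        (\<forall>i\<in>I. L1_dist M (\<lambda>x. f i (\<psi> g x)) (\<lambda>x. f i (\<psi> h x)) < d e))"
    by (rule exE)
  have fin: "\<And>e. 0 < e \<Longrightarrow> finite ((r e :: 'g \<Rightarrow> 'i \<Rightarrow> 'g set) ` carrier G)"
    and r: "\<And>e g h i. 0 < e \<Longrightarrow> g \<in> carrier G \<Longrightarrow> h \<in> carrier G \<Longrightarrow> r e g = r e h \<Longrightarrow> i \<in> I \<Longrightarrow>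
        L1_dist M (\<lambda>x. f i (\<psi> g x)) (\<lambda>x. f i (\<psi> h x)) < d e"
    using R by auto
  show ?thesis
  proof (rule almost_periodicI[of r, OF fin])
    fix e :: real and g h
    assume e: "0 < e" and g: "g \<in> carrier G" and h: "h \<in> carrier G" and eq: "r e g = r e h"
    have sp: "\<psi> k x \<in> space M" if "k \<in> carrier G" "x \<in> space M" for k x
      using measurable_space[OF action_measurable[OF that(1)] that(2)] .
    have int: "integrable M (\<lambda>x. \<bar>f i (\<psi> g x) - f i (\<psi> h x)\<bar>)" if "i \<in> I" for i
      using integrable_comp_bounded[OF fm[OF that] fB[OF that]] g h by auto
    have intu: "integrable M (\<lambda>x. \<bar>u (\<psi> g x) - u (\<psi> h x)\<bar>)"
      using integrable_comp_bounded[OF um uB] g h by auto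
    have "L1_dist M (\<lambda>x. u (\<psi> g x)) (\<lambda>x. u (\<psi> h x))
        \<le> (\<integral>x. C * (\<Sum>i\<in>I. \<bar>f i (\<psi> g x) - f i (\<psi> h x)\<bar>) \<partial>M)"
      unfolding L1_dist_def using intu int lip sp g h
      by (intro integral_mono integrable_mult_right Bochner_Integration.integrable_sum) auto
    also have "\<dots> = C * (\<Sum>i\<in>I. L1_dist M (\<lambda>x. f i (\<psi> g x)) (\<lambda>x. f i (\<psi> h x)))"
      unfolding L1_dist_def using int by (simp add: Bochner_Integration.integral_sum)
    also have "\<dots> \<le> C * (\<Sum>i\<in>I. d e)"
      using r[OF e g h eq] C by (intro mult_left_mono sum_mono) (auto intro: less_imp_le)
    also have "\<dots> = e * (C * card I / (C * card I + 1))" by (simp add: d_def)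
    also have "\<dots> < e * 1" using e pos by (intro mult_strict_left_mono) (auto simp: divide_less_eq)
    finally show "L1_dist M (\<lambda>x. u (\<psi> g x)) (\<lambda>x. u (\<psi> h x)) < e" by simp
  qed
qed

text \<open>The action preserves L1 distances, so an approximation of \<open>f\<close> is equally
  good along the whole orbit and its colouring can be reused.\<close>

lemma almost_periodic_limit:
  assumes fm: "f \<in> borel_measurable M" and fi: "integrable M f"
    and approx: "\<And>e. 0 < e \<Longrightarrow> \<exists>f'. almost_periodic f' \<and> integrable M f' \<and> L1_dist M f f' \<le> e"
  shows "almost_periodic f"
proof -
  have "\<forall>e\<in>{0<..}. \<exists>f'. almost_periodic f' \<and> integrable M f' \<and> L1_dist M f f' \<le> e / 3"
    by (intro ballI approx) simp
  from bchoice[OF this] obtain f' where R: "\<forall>e\<in>{0<..}. almost_periodic (f' e) \<and> integrable M (f' e) \<and> L1_dist M f (f' e) \<le> e / 3"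
    by (rule exE)
  then have f': "\<And>e. 0 < e \<Longrightarrow> almost_periodic (f' e)" "\<And>e. 0 < e \<Longrightarrow> integrable M (f' e)"
    "\<And>e. 0 < e \<Longrightarrow> L1_dist M f (f' e) \<le> e / 3" by auto
  have "\<forall>e\<in>{0<..}. \<exists>r::'g \<Rightarrow> 'g set. finite (r ` carrier G) \<and>
     (\<forall>g\<in>carrier G. \<forall>h\<in>carrier G. r g = r h \<longrightarrow>
       L1_dist M (\<lambda>x. f' e (\<psi> g x)) (\<lambda>x. f' e (\<psi> h x)) < e / 3)"
  proof
    fix e :: real assume "e \<in> {0<..}"
    then have "0 < e" "0 < e / 3" by auto
    with f'(1)[of e] show "\<exists>r::'g \<Rightarrow> 'g set. finite (r ` carrier G) \<and>
     (\<forall>g\<in>carrier G. \<forall>h\<in>carrier G. r g = r h \<longrightarrow>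
       L1_dist M (\<lambda>x. f' e (\<psi> g x)) (\<lambda>x. f' e (\<psi> h x)) < e / 3)"
      unfolding almost_periodic_def by blast
  qed
  from bchoice[OF this] obtain r where R: "\<forall>e\<in>{0<..}. finite ((r e :: 'g \<Rightarrow> 'g set) ` carrier G) \<and>
     (\<forall>g\<in>carrier G. \<forall>h\<in>carrier G. r e g = r e h \<longrightarrow>
       L1_dist M (\<lambda>x. f' e (\<psi> g x)) (\<lambda>x. f' e (\<psi> h x)) < e / 3)"
    by (rule exE)
  have fin: "\<And>e. 0 < e \<Longrightarrow> finite ((r e :: 'g \<Rightarrow> 'g set) ` carrier G)"
    and r: "\<And>e g h. 0 < e \<Longrightarrow> g \<in> carrier G \<Longrightarrow> h \<in> carrier G \<Longrightarrow> r e g = r e h \<Longrightarrow>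
        L1_dist M (\<lambda>x. f' e (\<psi> g x)) (\<lambda>x. f' e (\<psi> h x)) < e / 3"
    using R by auto
  show ?thesis
  proof (rule almost_periodicI[of r, OF fin])
    fix e :: real and g h
    assume e: "0 < e" and g: "g \<in> carrier G" and h: "h \<in> carrier G" and eq: "r e g = r e h"
    have [measurable]: "f \<in> borel_measurable M" "f' e \<in> borel_measurable M"
      using fm f'(2)[OF e] by auto
    have i: "integrable M (\<lambda>x. f (\<psi> k x))" "integrable M (\<lambda>x. f' e (\<psi> k x))"
      "L1_dist M (\<lambda>x. f (\<psi> k x)) (\<lambda>x. f' e (\<psi> k x)) \<le> e / 3" if "k \<in> carrier G" for k
      using integrable_action_comp[OF that] fi f'(2,3)[OF e] L1_dist_action[OF that] by auto
    show "L1_dist M (\<lambda>x. f (\<psi> g x)) (\<lambda>x. f (\<psi> h x)) < e"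
      using L1_dist_triangle[OF i(1)[OF g] i(2)[OF g] i(1)[OF h]]
        L1_dist_triangle[OF i(2)[OF g] i(2)[OF h] i(1)[OF h]] i(3)[OF g] i(3)[OF h]
        r[OF e g h eq]
      by (simp add: L1_dist_commute[of M "\<lambda>x. f' e (\<psi> h x)" "\<lambda>x. f (\<psi> h x)"])
  qed
qed

section \<open>The Kronecker sigma-algebra\<close>

definition kronecker_events :: "'a set set" where
  "kronecker_events = {A \<in> sets M. almost_periodic (indicator A)}"

lemma L1_dist_indicator:
  assumes [measurable]: "A \<in> sets M" "B \<in> sets M"
  shows "L1_dist M (indicator A) (indicator B) = prob (sym_diff A B)"
proof -
  have "L1_dist M (indicator A) (indicator B) = (\<integral>x. indicator (sym_diff A B) x \<partial>M)"
    unfolding L1_dist_def by (intro Bochner_Integration.integral_cong) (auto simp: indicator_def)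
  then show ?thesis by simp
qed

lemma kronecker_Un:
  assumes "A \<in> kronecker_events" "B \<in> kronecker_events"
  shows "A \<union> B \<in> kronecker_events"
proof -
  have [measurable]: "A \<in> sets M" "B \<in> sets M" using assms by (auto simp: kronecker_events_def)
  define f :: "bool \<Rightarrow> 'a \<Rightarrow> real" where "f b = indicator (if b then A else B)" for b
  have "almost_periodic (indicator (A \<union> B))"
  proof (rule almost_periodic_lipschitz[of "UNIV :: bool set" f 1 _ 1 1])
    show "almost_periodic (f i)" for i using assms by (auto simp: kronecker_events_def f_def)
    show "\<bar>indicator (A \<union> B) x - indicator (A \<union> B) y :: real\<bar> \<le> 1 * (\<Sum>i\<in>UNIV. \<bar>f i x - f i y\<bar>)" for x y
      by (auto simp: UNIV_bool f_def indicator_def)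
  qed (auto simp: f_def indicator_def)
  then show ?thesis by (simp add: kronecker_events_def)
qed

lemma kronecker_compl:
  assumes "A \<in> kronecker_events"
  shows "space M - A \<in> kronecker_events"
proof -
  have [measurable]: "A \<in> sets M" using assms by (auto simp: kronecker_events_def)
  have "almost_periodic (indicator (space M - A))"
  proof (rule almost_periodic_lipschitz[of "UNIV :: unit set" "\<lambda>_. indicator A" 1 _ 1 1])
    show "almost_periodic (indicator A)" using assms by (auto simp: kronecker_events_def)
  qed (auto simp: indicator_def)
  then show ?thesis by (simp add: kronecker_events_def)
qed

lemma kronecker_sequence_limit:
  assumes "\<And>n. A n \<in> kronecker_events" and B: "B \<in> sets M"
    and lim: "(\<lambda>n. prob (sym_diff B (A n))) \<longlonglongrightarrow> 0"
  shows "B \<in> kronecker_events"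
proof -
  have A: "A n \<in> sets M" "almost_periodic (indicator (A n))" for n
    using assms(1)[of n] by (auto simp: kronecker_events_def)
  have "almost_periodic (indicator B)"
  proof (rule almost_periodic_limit)
    fix e :: real assume "0 < e"
    from order_tendstoD(2)[OF lim this] obtain n where "prob (sym_diff B (A n)) < e"
      by (auto simp: eventually_sequentially)
    then show "\<exists>f'. almost_periodic f' \<and> integrable M f' \<and> L1_dist M (indicator B) f' \<le> e"
      using A B L1_dist_indicator[OF B A(1)[of n]] integrable_indicator_event
      by (intro exI[of _ "indicator (A n)"]) auto
  qed (use B integrable_indicator_event in auto)
  then show ?thesis using B by (simp add: kronecker_events_def)
qed

lemma kronecker_AE_cong:
  assumes "A \<in> kronecker_events" and B: "B \<in> sets M" and eq: "AE x in M. x \<in> A \<longleftrightarrow> x \<in> B"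
  shows "B \<in> kronecker_events"
proof (rule kronecker_sequence_limit[OF assms(1) B])
  have A: "A \<in> sets M" using assms by (auto simp: kronecker_events_def)
  have "prob (sym_diff B A) = prob {}"
    by (rule finite_measure_eq_AE) (use eq A B in auto)
  then show "(\<lambda>n::nat. prob (sym_diff B A)) \<longlonglongrightarrow> 0" by simp
qed

lemma sigma_algebra_kronecker: "sigma_algebra (space M) kronecker_events"
  unfolding sigma_algebra_iff2
proof (intro conjI ballI allI impI)
  show "kronecker_events \<subseteq> Pow (space M)"
    using sets.sets_into_space by (auto simp: kronecker_events_def)
  \<comment> \<open>The index set is empty: a constant satisfies the Lipschitz bound with an empty
    sum.\<close>
  have "almost_periodic (indicator {})"
    by (rule almost_periodic_lipschitz[of "{} :: unit set" "\<lambda>_. indicator {}" 1 _ 1 1])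
      (auto simp: indicator_def)
  then show empty: "{} \<in> kronecker_events" by (simp add: kronecker_events_def)
  show "space M - s \<in> kronecker_events" if "s \<in> kronecker_events" for s
    using kronecker_compl that .
  \<comment> \<open>A countable union is the limit in measure of its finite partial unions.\<close>
  fix A :: "nat \<Rightarrow> 'a set" assume A: "range A \<subseteq> kronecker_events"
  have Am [measurable]: "A i \<in> sets M" for i using A by (auto simp: kronecker_events_def)
  define U where "U n = (\<Union>i<n. A i)" for n
  have U: "U n \<in> kronecker_events" for n
  proof (induction n)
    case 0
    then show ?case by (simp add: U_def empty)
  next
    case (Suc n)
    have "U (Suc n) = U n \<union> A n" by (auto simp: U_def lessThan_Suc)
    moreover have "A n \<in> kronecker_events" using A by auto
    ultimately show ?case using kronecker_Un[OF Suc] by simp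
  qed
  have Um [measurable]: "U n \<in> sets M" for n using U[of n] by (auto simp: kronecker_events_def)
  have "(\<lambda>n. prob (U n)) \<longlonglongrightarrow> prob (\<Union>n. U n)"
  proof (rule finite_Lim_measure_incseq)
    show "incseq U" unfolding incseq_def U_def by (intro allI impI UN_mono) auto
  qed auto
  moreover have "(\<Union>n. U n) = \<Union> (range A)" unfolding U_def by blast
  ultimately have "(\<lambda>n. prob (\<Union> (range A)) - prob (U n)) \<longlonglongrightarrow> 0"
    using tendsto_diff[OF tendsto_const[of "prob (\<Union> (range A))"]] by fastforce
  moreover have "prob (sym_diff (\<Union> (range A)) (U n)) = prob (\<Union> (range A)) - prob (U n)" for n
  proof -
    have "U n \<subseteq> \<Union> (range A)" by (auto simp: U_def)
    moreover then have "sym_diff (\<Union> (range A)) (U n) = \<Union> (range A) - U n" by blast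
    ultimately show ?thesis using finite_measure_Diff[of "\<Union> (range A)" "U n"] by simp
  qed
  ultimately show "\<Union> (range A) \<in> kronecker_events"
    by (intro kronecker_sequence_limit[OF U]) auto
qed

definition kronecker_algebra :: "'a measure" where
  "kronecker_algebra = sigma (space M) kronecker_events"

lemma space_kronecker [simp]: "space kronecker_algebra = space M"
  by (simp add: kronecker_algebra_def space_measure_of_conv)

lemma sets_kronecker: "sets kronecker_algebra = kronecker_events"
  unfolding kronecker_algebra_def
  by (intro sigma_algebra.sets_measure_of_eq sigma_algebra_kronecker)

lemma subalgebra_kronecker: "subalgebra M kronecker_algebra"
  by (auto simp: subalgebra_def sets_kronecker kronecker_events_def)

text \<open>Superlevel sets are reached from \<open>w\<close> by Lipschitz cutoffs:
  \<open>u m\<close> is a ramp of slope \<open>m\<close> starting at the level \<open>t\<close> and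
  capped at 1. It converges to the indicator, which is thus an L1 limit of almost periodic
  functions.\<close>

lemma almost_periodic_kronecker_measurable:
  assumes ap: "almost_periodic w" and wm [measurable]: "w \<in> borel_measurable M" and B: "\<And>x. \<bar>w x\<bar> \<le> B"
  shows "w \<in> borel_measurable kronecker_algebra"
  unfolding borel_measurable_iff_greater
proof
  fix t
  define A where "A = {x\<in>space M. t < w x}"
  have Am [measurable]: "A \<in> sets M" unfolding A_def by measurable
  define u where "u m x = min 1 (real m * max 0 (w x - t))" for m x
  have ub: "0 \<le> u m x" "u m x \<le> 1" for m x by (auto simp: u_def)
  have um [measurable]: "u m \<in> borel_measurable M" for m unfolding u_def by measurable
  have ui: "integrable M (u m)" for m using ub by (intro integrable_bounded[of _ 1]) auto
  have apu: "almost_periodic (u m)" for m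
  proof (rule almost_periodic_lipschitz[of "UNIV :: unit set" "\<lambda>_. w" B _ 1 "real m"])
    show "\<bar>u m x - u m y\<bar> \<le> real m * (\<Sum>i\<in>(UNIV :: unit set). \<bar>w x - w y\<bar>)" for x y
    proof -
      have "\<bar>max 0 (w x - t) - max 0 (w y - t)\<bar> \<le> \<bar>w x - w y\<bar>" by auto
      then have "real m * \<bar>max 0 (w x - t) - max 0 (w y - t)\<bar> \<le> real m * \<bar>w x - w y\<bar>"
        by (intro mult_left_mono) auto
      moreover have "\<bar>u m x - u m y\<bar> \<le> \<bar>real m * max 0 (w x - t) - real m * max 0 (w y - t)\<bar>"
        unfolding u_def by (auto simp: min_def)
      ultimately show ?thesis by (simp add: abs_mult right_diff_distrib[symmetric])
    qed
  qed (use ap B ub in auto)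
  have pt: "(\<lambda>m. u m x) \<longlonglongrightarrow> indicator A x" if x: "x \<in> space M" for x
  proof (cases "t < w x")
    case True
    then have pos: "0 < w x - t" by simp
    obtain N where N: "1 \<le> real N * (w x - t)"
      using reals_Archimedean3[OF pos] by (metis less_imp_le)
    have "u m x = 1" if "N \<le> m" for m
    proof -
      have "real N * (w x - t) \<le> real m * (w x - t)" using that pos by (intro mult_right_mono) auto
      with N have "1 \<le> real m * (w x - t)" by (rule order_trans)
      then show ?thesis using pos by (simp add: u_def max_def)
    qed
    then have "\<forall>\<^sub>F m in sequentially. u m x = 1" by (auto simp: eventually_sequentially)
    then show ?thesis using True x by (intro tendsto_eventually) (simp add: A_def indicator_def)
  next
    case False
    then show ?thesis using x by (simp add: u_def A_def indicator_def max_def)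
  qed
  have "(\<lambda>m. \<integral>x. \<bar>indicator A x - u m x\<bar> \<partial>M) \<longlonglongrightarrow> (\<integral>x. 0 \<partial>M)"
  proof (rule integral_dominated_convergence[where w="\<lambda>_. 1"])
    show "AE x in M. (\<lambda>m. \<bar>indicator A x - u m x\<bar>) \<longlonglongrightarrow> 0"
    proof (rule AE_I2)
      fix x assume "x \<in> space M"
      from pt[OF this] have "(\<lambda>m. indicator A x - u m x) \<longlonglongrightarrow> indicator A x - indicator A x"
        by (intro tendsto_diff tendsto_const)
      then show "(\<lambda>m. \<bar>indicator A x - u m x\<bar>) \<longlonglongrightarrow> 0" by (intro tendsto_rabs_zero) simp
    qed
    show "AE x in M. norm \<bar>indicator A x - u m x\<bar> \<le> 1" for m
    proof (rule AE_I2)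
      show "norm \<bar>indicator A x - u m x\<bar> \<le> 1" for x
        using ub[of m x] by (cases "x \<in> A") auto
    qed
  qed auto
  then have lim: "(\<lambda>m. L1_dist M (indicator A) (u m)) \<longlonglongrightarrow> 0" by (simp add: L1_dist_def)
  have "almost_periodic (indicator A)"
  proof (rule almost_periodic_limit)
    fix e :: real assume "0 < e"
    from order_tendstoD(2)[OF lim this] obtain m where "L1_dist M (indicator A) (u m) < e"
      by (auto simp: eventually_sequentially)
    then show "\<exists>f'. almost_periodic f' \<and> integrable M f' \<and> L1_dist M (indicator A) f' \<le> e"
      using apu ui by (intro exI[of _ "u m"]) auto
  qed (use integrable_indicator_event in auto)
  then have "A \<in> kronecker_events" by (simp add: kronecker_events_def)
  then show "{x \<in> space kronecker_algebra. t < w x} \<in> sets kronecker_algebra"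
    by (simp add: sets_kronecker A_def)
qed

text \<open>The converse direction: \<open>w\<close> is approximated uniformly by the mean of the
  indicators of its superlevel sets at the levels \<open>i / m\<close>, a finite combination of
  Kronecker events.\<close>

lemma kronecker_measurable_almost_periodic:
  assumes wm: "w \<in> borel_measurable kronecker_algebra" and w0: "\<And>x. 0 \<le> w x" and w1: "\<And>x. w x \<le> 1"
  shows "almost_periodic w"
proof -
  have wM [measurable]: "w \<in> borel_measurable M"
    using measurable_from_subalg[OF subalgebra_kronecker wm] .
  define A where "A m i = {x\<in>space M. real i / real m < w x}" for m i
  have A: "A m i \<in> kronecker_events" for m i
    using wm unfolding borel_measurable_iff_greater by (auto simp: A_def sets_kronecker)
  have Am [measurable]: "A m i \<in> sets M" for m i using A by (auto simp: kronecker_events_def)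
  define u where "u m x = (\<Sum>i<m. indicator (A m i) x) / real m" for m x
  have ub: "\<bar>u m x\<bar> \<le> 1" for m x
  proof -
    have "(\<Sum>i<m. indicator (A m i) x :: real) \<le> (\<Sum>i<m. 1)" by (intro sum_mono) (simp add: indicator_def)
    moreover have "0 \<le> (\<Sum>i<m. indicator (A m i) x :: real)" by (intro sum_nonneg) auto
    ultimately show ?thesis by (cases "m = 0") (auto simp: u_def)
  qed
  have um [measurable]: "u m \<in> borel_measurable M" for m unfolding u_def by measurable
  have ap: "almost_periodic (u m)" for m
  proof (rule almost_periodic_lipschitz[of "{..<m}" "\<lambda>i. indicator (A m i)" 1 _ 1 1])
    show "\<bar>u m x - u m y\<bar> \<le> 1 * (\<Sum>i<m. \<bar>indicator (A m i) x - indicator (A m i) y\<bar>)" for x y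
    proof (cases "m = 0")
      case False
      have "\<bar>u m x - u m y\<bar> = \<bar>\<Sum>i<m. indicator (A m i) x - indicator (A m i) y :: real\<bar> / real m"
        by (simp add: u_def sum_subtractf diff_divide_distrib[symmetric] abs_divide)
      also have "\<dots> \<le> (\<Sum>i<m. \<bar>indicator (A m i) x - indicator (A m i) y\<bar>) / real m"
        by (intro divide_right_mono sum_abs) simp
      also have "\<dots> \<le> (\<Sum>i<m. \<bar>indicator (A m i) x - indicator (A m i) y\<bar>) / 1"
        using False by (intro divide_left_mono sum_nonneg) auto
      finally show ?thesis by simp
    qed (simp add: u_def)
  qed (use A ub in \<open>auto simp: kronecker_events_def indicator_def\<close>)
  \<comment> \<open>Exactly the first \<open>nat \<lceil>y\<rceil>\<close> of the \<open>m\<close>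
    superlevel sets contain \<open>x\<close>, so \<open>u m\<close> is \<open>w\<close> rounded up
    to a multiple of \<open>1 / m\<close>.\<close>
  have close: "\<bar>w x - u m x\<bar> \<le> 1 / real m" if x: "x \<in> space M" and m: "0 < m" for x m
  proof -
    define y where "y = real m * w x"
    have y: "0 \<le> y" "y \<le> real m" using w0[of x] w1[of x] m by (auto simp: y_def mult_left_le)
    have cm: "nat \<lceil>y\<rceil> \<le> m" using y by (simp add: nat_le_iff ceiling_le_iff)
    have lt: "real i / real m < w x \<longleftrightarrow> i < nat \<lceil>y\<rceil>" for i
    proof -
      have "real i / real m < w x \<longleftrightarrow> real i < y" using m by (simp add: y_def field_simps)
      also have "\<dots> \<longleftrightarrow> int i < \<lceil>y\<rceil>" by (simp add: less_ceiling_iff)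
      also have "\<dots> \<longleftrightarrow> i < nat \<lceil>y\<rceil>" by auto
      finally show ?thesis .
    qed
    have "(\<Sum>i<m. indicator (A m i) x :: real) = (\<Sum>i<m. if i < nat \<lceil>y\<rceil> then 1 else 0)"
      using x lt by (intro sum.cong) (auto simp: A_def indicator_def)
    also have "\<dots> = real (card {i. i < m \<and> i < nat \<lceil>y\<rceil>})"
      by (simp add: sum.If_cases Int_def)
    also have "{i. i < m \<and> i < nat \<lceil>y\<rceil>} = {..<nat \<lceil>y\<rceil>}" using less_le_trans[OF _ cm] by blast
    finally have s: "(\<Sum>i<m. indicator (A m i) x :: real) = real_of_int \<lceil>y\<rceil>" using y by simp
    have "w x = y / real m" using m by (simp add: y_def)
    then have "w x - u m x = (y - real_of_int \<lceil>y\<rceil>) / real m"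
      by (simp add: u_def s diff_divide_distrib)
    moreover have "\<bar>y - real_of_int \<lceil>y\<rceil>\<bar> \<le> 1" by linarith
    ultimately show ?thesis by (simp add: abs_divide divide_right_mono)
  qed
  have wi: "integrable M w" using w0 w1 by (intro integrable_bounded[of _ 1]) auto
  have ui: "integrable M (u m)" for m using ub by (intro integrable_bounded[of _ 1]) auto
  show ?thesis
  proof (rule almost_periodic_limit[OF wM wi])
    fix e :: real assume e: "0 < e"
    obtain m where m: "0 < m" "1 / real m < e" using e by (metis nat_approx_posE zero_less_Suc)
    have "L1_dist M w (u m) \<le> (\<integral>x. e \<partial>M)"
      unfolding L1_dist_def using wi ui close m
      by (intro integral_mono integrable_abs Bochner_Integration.integrable_diff)
        (auto intro: order_trans[OF close[OF _ m(1)] less_imp_le[OF m(2)]])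
    then have "L1_dist M w (u m) \<le> e" by (simp add: prob_space)
    then show "\<exists>f'. almost_periodic f' \<and> integrable M f' \<and> L1_dist M w f' \<le> e"
      using ap ui by blast
  qed
qed

end

section \<open>Weak mixing orthogonal to the Kronecker algebra\<close>

lemma (in prob_space) abs_expectation_le:
  fixes f :: "'a \<Rightarrow> real"
  assumes "f \<in> borel_measurable M" "\<And>x. \<bar>f x\<bar> \<le> B"
  shows "\<bar>expectation f\<bar> \<le> B"
proof -
  have i: "integrable M f" by (rule integrable_const_bound[of _ B]) (use assms in auto)
  have "\<bar>expectation f\<bar> \<le> expectation (\<lambda>x. \<bar>f x\<bar>)" by (rule integral_abs_bound)
  also have "\<dots> \<le> expectation (\<lambda>x. B)" using assms i by (intro integral_mono) auto
  finally show ?thesis by (simp add: prob_space)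
qed

section \<open>The product system and invariant kernels\<close>

context folner_action begin

abbreviation MM :: "('a \<times> 'a) measure" where "MM \<equiv> M \<Otimes>\<^sub>M M"

definition diag_action :: "'g \<Rightarrow> 'a \<times> 'a \<Rightarrow> 'a \<times> 'a" where
  "diag_action g z = (\<psi> g (fst z), \<psi> g (snd z))"

lemma pair_prob_space: "pair_prob_space M M"
  by unfold_locales

lemma folner_action_diag: "folner_action G MM diag_action F"
proof -
  interpret P: pair_prob_space M M by (rule pair_prob_space)
  show ?thesis
  proof (rule folner_action.intro)
    show "group G" by (rule is_group)
    show "prob_space MM" by (rule P.prob_space_axioms)
    show "folner_action_axioms G MM diag_action F"
    proof
      show "countable (carrier G)" by (rule countable_carrier)
      show "folner_seq G F" by (rule folner)
      show "diag_action \<one> z = z" for z by (simp add: diag_action_def action_one)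
      fix g assume g [measurable]: "g \<in> carrier G"
      show "diag_action g \<in> measurable MM MM"
        unfolding diag_action_def
        by (intro measurable_Pair measurable_compose[OF measurable_fst action_measurable[OF g]]
            measurable_compose[OF measurable_snd action_measurable[OF g]])
      have "distr MM MM (\<lambda>(x, y). (\<psi> g x, \<psi> g y)) = distr M M (\<psi> g) \<Otimes>\<^sub>M distr M M (\<psi> g)"
        by (rule pair_measure_distr[symmetric])
          (use g action_distr[OF g] sigma_finite_measure_axioms in auto)
      then show "distr MM MM (diag_action g) = MM"
        unfolding action_distr[OF g] by (simp add: diag_action_def[abs_def] case_prod_unfold)
      show "diag_action (g \<otimes> h) z = diag_action g (diag_action h z)" if "h \<in> carrier G" for h z
        using g that by (simp add: diag_action_def action_mult)
    qed
  qed
qed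

lemma integral_pair:
  fixes h :: "'a \<times> 'a \<Rightarrow> real"
  assumes hm [measurable]: "h \<in> borel_measurable MM" and B: "\<And>z. \<bar>h z\<bar> \<le> B"
  shows "integrable MM h" "integral\<^sup>L MM h = (\<integral>x. (\<integral>y. h (x, y) \<partial>M) \<partial>M)"
    "(\<lambda>x. \<integral>y. h (x, y) \<partial>M) \<in> borel_measurable M" "\<bar>\<integral>y. h (x, y) \<partial>M\<bar> \<le> B"
proof -
  interpret P: pair_prob_space M M by (rule pair_prob_space)
  show i: "integrable MM h"
    by (rule P.integrable_const_bound[of _ B]) (use B in auto)
  show "integral\<^sup>L MM h = (\<integral>x. (\<integral>y. h (x, y) \<partial>M) \<partial>M)"
    using P.integral_fst'[OF i] by simp
  show "(\<lambda>x. \<integral>y. h (x, y) \<partial>M) \<in> borel_measurable M" by measurable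
  show "\<bar>\<integral>y. h (x, y) \<partial>M\<bar> \<le> B"
  proof (cases "x \<in> space M")
    case True
    then have "(\<lambda>y. h (x, y)) \<in> borel_measurable M" by measurable
    then show ?thesis using B by (rule abs_expectation_le)
  next
    \<comment> \<open>Outside the space a section may fail to be measurable; a non-integrable
      section has integral 0 by default, which also respects the bound.\<close>
    case False
    have "0 \<le> B" using B[of "(x, x)"] by linarith
    have "\<bar>\<integral>y. h (x, y) \<partial>M\<bar> \<le> B"
    proof (cases "integrable M (\<lambda>y. h (x, y))")
      case True
      then show ?thesis using B by (intro abs_expectation_le) auto
    qed (use \<open>0 \<le> B\<close> in \<open>simp add: not_integrable_integral_eq\<close>)
    then show ?thesis .
  qed
qed

lemma AE_pair_fst: "AE z in MM. P z \<Longrightarrow> AE x in M. AE y in M. P (x, y)"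
  using pair_prob_space pair_sigma_finite.AE_pair unfolding pair_prob_space_def by blast

lemma measurable_Pair_section: "h \<in> borel_measurable MM \<Longrightarrow> x \<in> space M \<Longrightarrow> (\<lambda>y. h (x, y)) \<in> borel_measurable M"
  by (rule measurable_compose[OF measurable_Pair1'])

text \<open>The integral operator of an invariant kernel commutes with the action: substitute
  \<open>\<psi> g y\<close> for \<open>y\<close>, which preserves \<open>M\<close>, and apply the
  invariance of \<open>k\<close>.\<close>

lemma kernel_equivariant:
  assumes km [measurable]: "k \<in> borel_measurable MM"
    and inv: "AE z in MM. k (diag_action g z) = k z"
    and um [measurable]: "u \<in> borel_measurable M" and g [measurable]: "g \<in> carrier G"
  shows "AE x in M. (\<integral>y. k (\<psi> g x, y) * u y \<partial>M) = (\<integral>y. k (x, y) * u (\<psi> g y) \<partial>M :: real)"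
  using AE_pair_fst[OF inv] AE_space
proof eventually_elim
  case (elim x)
  then have x: "x \<in> space M" "\<psi> g x \<in> space M"
    using measurable_space[OF action_measurable[OF g]] by auto
  note [measurable] = measurable_Pair_section[OF km x(1)] measurable_Pair_section[OF km x(2)]
  have "(\<integral>y. k (\<psi> g x, y) * u y \<partial>M) = (\<integral>y. k (\<psi> g x, \<psi> g y) * u (\<psi> g y) \<partial>M)"
    using integral_action_comp[OF g, of "\<lambda>y. k (\<psi> g x, y) * u y"] by simp
  also have "\<dots> = (\<integral>y. k (x, y) * u (\<psi> g y) \<partial>M)"
  proof (rule integral_cong_AE)
    have "(\<lambda>y. k (\<psi> g x, \<psi> g y)) \<in> borel_measurable M"
      by (rule measurable_action_comp[OF _ g]) measurable
    then show "(\<lambda>y. k (\<psi> g x, \<psi> g y) * u (\<psi> g y)) \<in> borel_measurable M" by measurable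
    show "(\<lambda>y. k (x, y) * u (\<psi> g y)) \<in> borel_measurable M" by measurable
    show "AE y in M. k (\<psi> g x, \<psi> g y) * u (\<psi> g y) = k (x, y) * u (\<psi> g y)"
      using elim(1) by eventually_elim (simp add: diag_action_def)
  qed
  finally show ?case .
qed

text \<open>If a function is orthogonal to the Kronecker algebra, the invariant kernel obtained from
  averaging \<open>w(x) w(y)\<close> is Hilbert-Schmidt and commutes with the action, so it maps into almost
  periodic functions and must vanish.\<close>

lemma weakly_mixing:
  assumes wm [measurable]: "w \<in> borel_measurable M" and B: "\<And>x. \<bar>w x\<bar> \<le> B"
    and orth: "\<And>u b. u \<in> borel_measurable kronecker_algebra \<Longrightarrow> (\<And>x. \<bar>u x\<bar> \<le> b) \<Longrightarrow> (\<integral>x. w x * u x \<partial>M) = 0"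
    and A [measurable]: "A \<in> sets M"
  shows "(\<lambda>n. (\<Sum>h\<in>F n. (\<integral>x. indicator A x * w (\<psi> h x) \<partial>M)\<^sup>2) / card (F n)) \<longlonglongrightarrow> 0"
proof -
  interpret P: pair_prob_space M M by (rule pair_prob_space)
  interpret D: folner_action G MM diag_action F by (rule folner_action_diag)
  have B0: "0 \<le> B" using B[of undefined] by linarith
  define f where "f z = w (fst z) * w (snd z)" for z
  have fm [measurable]: "f \<in> borel_measurable MM" unfolding f_def by measurable
  have fB: "\<bar>f z\<bar> \<le> B * B" for z unfolding f_def abs_mult by (intro mult_mono B B0) auto
  obtain k where km [measurable]: "k \<in> borel_measurable MM" and kB: "\<And>z. \<bar>k z\<bar> \<le> B * B"
    and klim: "(\<lambda>n. L1_dist MM (D.avg n f) k) \<longlonglongrightarrow> 0"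
    and kinv: "\<And>g. g \<in> carrier G \<Longrightarrow> AE z in MM. k (diag_action g z) = k z"
    using D.mean_ergodic[OF fm fB] by auto
  have kint: "integrable MM k" using kB by (intro D.integrable_bounded) auto
  \<comment> \<open>\<open>Z\<close> is the image of \<open>w\<close> under the integral operator of
    the limit kernel.\<close>
  define Z where "Z x = (\<integral>y. k (x, y) * w y \<partial>M)" for x
  have kw: "\<bar>k z * w (snd z)\<bar> \<le> B * B * B" for z unfolding abs_mult by (intro mult_mono B kB mult_nonneg_nonneg B0) auto
  have kwm: "(\<lambda>z. k z * w (snd z)) \<in> borel_measurable MM" by measurable
  have Zm [measurable]: "Z \<in> borel_measurable M" and ZB: "\<bar>Z x\<bar> \<le> B * B * B" for x
    using integral_pair(3,4)[OF kwm kw] by (auto simp: Z_def[abs_def])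
  have cB: "\<bar>\<integral>y. w (\<psi> h y) * w (\<psi> g y) \<partial>M\<bar> \<le> B * B" if "g \<in> carrier G" "h \<in> carrier G" for g h
  proof (rule abs_expectation_le)
    note [measurable] = that
    show "(\<lambda>y. w (\<psi> h y) * w (\<psi> g y)) \<in> borel_measurable M" by measurable
    show "\<bar>w (\<psi> h y) * w (\<psi> g y)\<bar> \<le> B * B" for y unfolding abs_mult by (intro mult_mono B B0) auto
  qed
  \<comment> \<open>Replacing the kernel by its \<open>n\<close>-th average replaces the translate
    of \<open>Z\<close> by \<open>W n g\<close>, a combination of finitely many functions that do
    not depend on \<open>g\<close>, with bounded coefficients \<open>c h g\<close>.\<close>
  define c where "c h g = (\<integral>y. w (\<psi> h y) * w (\<psi> g y) \<partial>M)" for h g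
  define W where "W n g x = (\<Sum>h\<in>F n. w (\<psi> h x) * c h g) / card (F n)" for n g x
  have WZ: "L1_dist M (\<lambda>x. Z (\<psi> g x)) (W n g) \<le> B * L1_dist MM (D.avg n f) k"
    if g: "g \<in> carrier G" and n: "1 \<le> n" for n g
  proof -
    note [measurable] = g
    define a where "a z = D.avg n f z" for z
    have am [measurable]: "a \<in> borel_measurable MM" unfolding a_def using n by simp
    have aB: "\<bar>a z\<bar> \<le> B * B" for z unfolding a_def by (rule D.abs_avg_le[OF fB])
    have Wa: "W n g x = (\<integral>y. a (x, y) * w (\<psi> g y) \<partial>M)" for x
    proof -
      have int: "integrable M (\<lambda>y. w (\<psi> h y) * w (\<psi> g y))" if "h \<in> F n" for h
      proof (rule integrable_bounded[of _ "B * B"])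
        have [measurable]: "h \<in> carrier G" using that folner_carrier[OF n] by auto
        show "(\<lambda>y. w (\<psi> h y) * w (\<psi> g y)) \<in> borel_measurable M" by measurable
        show "\<bar>w (\<psi> h y) * w (\<psi> g y)\<bar> \<le> B * B" for y unfolding abs_mult by (intro mult_mono B B0) auto
      qed
      have "(\<integral>y. a (x, y) * w (\<psi> g y) \<partial>M)
          = (\<integral>y. (\<Sum>h\<in>F n. w (\<psi> h x) * (w (\<psi> h y) * w (\<psi> g y))) / card (F n) \<partial>M)"
        by (intro Bochner_Integration.integral_cong)
          (simp_all add: a_def D.avg_def f_def diag_action_def sum_distrib_right mult.assoc)
      also have "\<dots> = W n g x"
        unfolding W_def c_def using int
        by (simp add: Bochner_Integration.integral_sum)
      finally show ?thesis by simp
    qed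
    have eq: "AE x in M. Z (\<psi> g x) = (\<integral>y. k (x, y) * w (\<psi> g y) \<partial>M)"
      unfolding Z_def by (rule kernel_equivariant[OF km kinv[OF g] wm g])
    define d where "d z = \<bar>a z - k z\<bar>" for z
    have dm [measurable]: "d \<in> borel_measurable MM" unfolding d_def by measurable
    have dB: "\<bar>d z\<bar> \<le> B * B + B * B" for z using aB[of z] kB[of z] by (simp add: d_def abs_le_iff)
    have "AE x in M. \<bar>Z (\<psi> g x) - W n g x\<bar> \<le> B * (\<integral>y. d (x, y) \<partial>M)"
      using eq AE_space
    proof eventually_elim
      case (elim x)
      note [measurable] = measurable_Pair_section[OF km elim(2)] measurable_Pair_section[OF am elim(2)]
        measurable_Pair_section[OF dm elim(2)]
      have i1: "integrable M (\<lambda>y. k (x, y) * w (\<psi> g y))"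
        by (rule integrable_bounded[of _ "B * B * B"]) (auto simp: abs_mult intro!: mult_mono B kB mult_nonneg_nonneg B0)
      have i2: "integrable M (\<lambda>y. a (x, y) * w (\<psi> g y))"
        by (rule integrable_bounded[of _ "B * B * B"]) (auto simp: abs_mult intro!: mult_mono B aB mult_nonneg_nonneg B0)
      have i3: "integrable M (\<lambda>y. d (x, y))"
        by (rule integrable_bounded[of _ "B * B + B * B"]) (use dB in auto)
      have "\<bar>Z (\<psi> g x) - W n g x\<bar> = \<bar>\<integral>y. k (x, y) * w (\<psi> g y) - a (x, y) * w (\<psi> g y) \<partial>M\<bar>"
        using i1 i2 by (simp add: elim(1) Wa)
      also have "\<dots> \<le> (\<integral>y. \<bar>k (x, y) * w (\<psi> g y) - a (x, y) * w (\<psi> g y)\<bar> \<partial>M)"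
        by (rule integral_abs_bound)
      also have "\<dots> \<le> (\<integral>y. B * d (x, y) \<partial>M)"
      proof (rule integral_mono)
        show "\<bar>k (x, y) * w (\<psi> g y) - a (x, y) * w (\<psi> g y)\<bar> \<le> B * d (x, y)" for y
        proof -
          have "\<bar>k (x, y) * w (\<psi> g y) - a (x, y) * w (\<psi> g y)\<bar> = \<bar>w (\<psi> g y)\<bar> * d (x, y)"
            unfolding d_def abs_mult[symmetric] by (simp add: abs_minus_commute left_diff_distrib mult.commute[of "w (\<psi> g y)"])
          then show ?thesis using B[of "\<psi> g y"] by (simp add: d_def mult_right_mono)
        qed
      qed (use i1 i2 i3 in auto)
      also have "\<dots> = B * (\<integral>y. d (x, y) \<partial>M)" by simp
      finally show ?case .
    qed
    then have "L1_dist M (\<lambda>x. Z (\<psi> g x)) (W n g) \<le> (\<integral>x. B * (\<integral>y. d (x, y) \<partial>M) \<partial>M)"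
      unfolding L1_dist_def
    proof (rule integral_mono_AE[rotated 2])
      have "(\<lambda>x. W n g x) \<in> borel_measurable M"
        unfolding W_def using folner_carrier[OF n] by (intro borel_measurable_divide borel_measurable_sum) auto
      moreover have "\<bar>W n g x\<bar> \<le> B * B * B" for x
        unfolding W_def
      proof -
        have hc: "h \<in> carrier G" if "h \<in> F n" for h using that folner_carrier[OF n] by auto
        have "\<bar>\<Sum>h\<in>F n. w (\<psi> h x) * c h g\<bar> \<le> (\<Sum>h\<in>F n. B * (B * B))"
          using cB[OF g] B B0 hc unfolding c_def
          by (intro order_trans[OF sum_abs] sum_mono) (auto simp: abs_mult intro!: mult_mono)
        then show "\<bar>(\<Sum>h\<in>F n. w (\<psi> h x) * c h g) / real (card (F n))\<bar> \<le> B * B * B"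
          using folner_card_pos[OF n] by (simp add: field_simps)
      qed
      ultimately have "integrable M (W n g)" by (intro integrable_bounded) auto
      moreover have "integrable M (\<lambda>x. Z (\<psi> g x))" by (rule integrable_comp_bounded[OF Zm ZB g])
      ultimately show "integrable M (\<lambda>x. \<bar>Z (\<psi> g x) - W n g x\<bar>)" by auto
      show "integrable M (\<lambda>x. B * (\<integral>y. d (x, y) \<partial>M))"
        using integral_pair(3,4)[OF dm dB] by (intro integrable_mult_right integrable_bounded) auto
    qed
    also have "\<dots> = B * integral\<^sup>L MM d" using integral_pair(2)[OF dm dB] by simp
    finally show ?thesis by (simp add: L1_dist_def d_def[abs_def] a_def)
  qed
  have "almost_periodic Z"
  proof -
    \<comment> \<open>Three errors of size \<open>B * e' e\<close> occur below; the summand 1 makes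
      their total strictly smaller than \<open>e\<close>.\<close>
    define e' where "e' e = e / (3 * B + 1)" for e
    have e': "0 < e' e" if "0 < e" for e using that B0 by (simp add: e'_def add_nonneg_pos)
    have "\<exists>n\<ge>1. L1_dist MM (D.avg n f) k < e' e" if "0 < e" for e
    proof -
      from order_tendstoD(2)[OF klim e'[OF that]] obtain N where "\<And>n. N \<le> n \<Longrightarrow> L1_dist MM (D.avg n f) k < e' e"
        by (auto simp: eventually_sequentially)
      then show ?thesis by (intro exI[of _ "max 1 N"]) auto
    qed
    then have "\<forall>e\<in>{0<..}. \<exists>n. 1 \<le> n \<and> L1_dist MM (D.avg n f) k < e' e" by auto
    from bchoice[OF this] obtain N where "\<forall>e\<in>{0<..}. 1 \<le> N e \<and> L1_dist MM (D.avg (N e) f) k < e' e"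
      by (rule exE)
    then have N: "1 \<le> N e" "L1_dist MM (D.avg (N e) f) k < e' e" if "0 < e" for e using that by auto
    \<comment> \<open>The colour of \<open>g\<close> is its coefficient vector rounded to multiples
      of \<open>e' e\<close>; boundedness leaves finitely many colours.\<close>
    define r where "r e g = restrict (\<lambda>h. \<lfloor>c h g / e' e\<rfloor>) (F (N e))" for e g
    show ?thesis
    proof (rule almost_periodicI[of r])
      fix e :: real assume e: "0 < e"
      have "r e ` carrier G \<subseteq> PiE (F (N e)) (\<lambda>h. {\<lfloor>- (B * B) / e' e\<rfloor>..\<lfloor>(B * B) / e' e\<rfloor>})"
      proof
        fix q assume "q \<in> r e ` carrier G"
        then obtain g where g: "g \<in> carrier G" "q = r e g" by auto
        have "\<lfloor>c h g / e' e\<rfloor> \<in> {\<lfloor>- (B * B) / e' e\<rfloor>..\<lfloor>(B * B) / e' e\<rfloor>}" if "h \<in> F (N e)" for h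
        proof -
          have "h \<in> carrier G" using that folner_carrier[OF N(1)[OF e]] by auto
          from cB[OF g(1) this] have "- (B * B) \<le> c h g" "c h g \<le> B * B" by (auto simp: c_def abs_le_iff)
          then have "- (B * B) / e' e \<le> c h g / e' e" "c h g / e' e \<le> (B * B) / e' e"
            using e'[OF e] by (intro divide_right_mono; simp)+
          then show ?thesis using floor_mono by auto
        qed
        then show "q \<in> PiE (F (N e)) (\<lambda>h. {\<lfloor>- (B * B) / e' e\<rfloor>..\<lfloor>(B * B) / e' e\<rfloor>})"
          by (auto simp: g(2) r_def)
      qed
      then show "finite (r e ` carrier G)"
        by (rule finite_subset) (intro finite_PiE folner_finite N(1)[OF e] finite_atLeastAtMost_int)
      fix g g' assume g: "g \<in> carrier G" and g': "g' \<in> carrier G" and eq: "r e g = r e g'"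
      note n = N(1)[OF e]
      have cc: "\<bar>c h g - c h g'\<bar> \<le> e' e" if "h \<in> F (N e)" for h
      proof -
        have "\<lfloor>c h g / e' e\<rfloor> = \<lfloor>c h g' / e' e\<rfloor>" using eq that by (metis r_def restrict_apply')
        then have "\<bar>c h g / e' e - c h g' / e' e\<bar> \<le> 1" by linarith
        then have "\<bar>(c h g - c h g') / e' e\<bar> \<le> 1" by (simp add: diff_divide_distrib)
        then show ?thesis using e'[OF e] by (simp add: abs_divide)
      qed
      have Wm: "W (N e) g \<in> borel_measurable M" for g
        unfolding W_def using folner_carrier[OF n] by (intro borel_measurable_divide borel_measurable_sum) auto
      have wi: "integrable M (\<lambda>x. w (\<psi> h x))" if "h \<in> F (N e)" for h
        using that folner_carrier[OF n] by (intro integrable_comp_bounded[OF wm B]) auto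
      have Wi: "integrable M (W (N e) g)" for g
        unfolding W_def using wi by (intro integrable_divide Bochner_Integration.integrable_sum integrable_mult_left) auto
      have Zi: "integrable M (\<lambda>x. Z (\<psi> g x))" if "g \<in> carrier G" for g
        by (rule integrable_comp_bounded[OF Zm ZB that])
      have "\<bar>W (N e) g x - W (N e) g' x\<bar> \<le> B * e' e" for x
      proof -
        have "\<bar>W (N e) g x - W (N e) g' x\<bar> = \<bar>\<Sum>h\<in>F (N e). w (\<psi> h x) * (c h g - c h g')\<bar> / card (F (N e))"
          by (simp add: W_def diff_divide_distrib[symmetric] abs_divide sum_subtractf right_diff_distrib)
        also have "\<dots> \<le> (\<Sum>h\<in>F (N e). B * e' e) / card (F (N e))"
          using cc B B0 e'[OF e]
          by (intro divide_right_mono order_trans[OF sum_abs] sum_mono) (auto simp: abs_mult intro!: mult_mono)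
        also have "\<dots> = B * e' e" using folner_card_pos[OF n] by simp
        finally show ?thesis .
      qed
      then have "L1_dist M (W (N e) g) (W (N e) g') \<le> (\<integral>x. B * e' e \<partial>M)"
        unfolding L1_dist_def using Wi by (intro integral_mono) auto
      then have "L1_dist M (W (N e) g) (W (N e) g') \<le> B * e' e" by (simp add: prob_space)
      moreover have "L1_dist M (\<lambda>x. Z (\<psi> h x)) (W (N e) h) \<le> B * e' e" if "h \<in> carrier G" for h
        using WZ[OF that n] N(2)[OF e] mult_left_mono[OF less_imp_le[OF N(2)[OF e]] B0] by linarith
      note this[OF g] this[OF g']
      ultimately have "L1_dist M (\<lambda>x. Z (\<psi> g x)) (\<lambda>x. Z (\<psi> g' x)) \<le> 3 * (B * e' e)"
        using L1_dist_triangle[OF Zi[OF g] Wi Zi[OF g'], of g] L1_dist_triangle[OF Wi Wi Zi[OF g'], of g g']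
        by (simp add: L1_dist_commute[of M "W (N e) g'"])
      also have "\<dots> = e * (3 * B / (3 * B + 1))" by (simp add: e'_def)
      also have "\<dots> < e * 1" using e B0 by (intro mult_strict_left_mono) (auto simp: divide_less_eq)
      finally show "L1_dist M (\<lambda>x. Z (\<psi> g x)) (\<lambda>x. Z (\<psi> g' x)) < e" by simp
    qed
  qed
  then have "Z \<in> borel_measurable kronecker_algebra"
    using ZB by (rule almost_periodic_kronecker_measurable[OF _ Zm])
  then have wZ: "(\<integral>x. w x * Z x \<partial>M) = 0" using ZB by (rule orth)
  \<comment> \<open>By Fubini this is the integral of \<open>w\<close> against \<open>Z\<close>,
    which is Kronecker measurable, so orthogonality applies.\<close>
  have kf: "(\<integral>z. k z * f z \<partial>MM) = 0"
  proof -
    have kfB: "\<bar>k z * f z\<bar> \<le> (B * B) * (B * B)" for z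
      unfolding abs_mult by (intro mult_mono kB fB mult_nonneg_nonneg B0) auto
    have "(\<integral>z. k z * f z \<partial>MM) = (\<integral>x. (\<integral>y. k (x, y) * f (x, y) \<partial>M) \<partial>M)"
      by (rule integral_pair(2)[OF _ kfB]) measurable
    also have "\<dots> = (\<integral>x. w x * Z x \<partial>M)"
    proof (intro Bochner_Integration.integral_cong refl)
      fix x
      have "(\<integral>y. k (x, y) * f (x, y) \<partial>M) = (\<integral>y. w x * (k (x, y) * w y) \<partial>M)"
        by (intro Bochner_Integration.integral_cong refl) (simp add: f_def mult_ac)
      then show "(\<integral>y. k (x, y) * f (x, y) \<partial>M) = w x * Z x" by (simp add: Z_def)
    qed
    finally show ?thesis using wZ by simp
  qed
  have kkB: "\<bar>k z * k z\<bar> \<le> (B * B) * (B * B)" for z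
    unfolding abs_mult by (intro mult_mono kB mult_nonneg_nonneg B0) auto
  \<comment> \<open>Being invariant, \<open>k\<close> is orthogonal to every translate of
    \<open>f\<close>, hence to all averages of \<open>f\<close> and to their limit, which is
    \<open>k\<close> itself.\<close>
  have kk: "(\<integral>z. k z * k z \<partial>MM) = 0"
  proof -
    have eq: "(\<integral>z. k z * D.avg n f z \<partial>MM) = 0" if n: "1 \<le> n" for n
    proof -
      have hc: "h \<in> carrier G" if "h \<in> F n" for h using that folner_carrier[OF n] by auto
      have i: "integrable MM (\<lambda>z. k z * f (diag_action h z))" if "h \<in> F n" for h
      proof (rule D.integrable_bounded)
        note [measurable] = D.measurable_action_comp[OF fm hc[OF that]]
        show "(\<lambda>z. k z * f (diag_action h z)) \<in> borel_measurable MM" by measurable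
        show "\<bar>k z * f (diag_action h z)\<bar> \<le> (B * B) * (B * B)" for z
          unfolding abs_mult by (intro mult_mono kB fB mult_nonneg_nonneg B0) auto
      qed
      have z: "(\<integral>z. k z * f (diag_action h z) \<partial>MM) = 0" if h: "h \<in> F n" for h
      proof -
        note [measurable] = D.measurable_action_comp[OF fm hc[OF h]] D.measurable_action_comp[OF km hc[OF h]]
        have "(\<integral>z. k z * f (diag_action h z) \<partial>MM) = (\<integral>z. k (diag_action h z) * f (diag_action h z) \<partial>MM)"
          by (rule integral_cong_AE) (use kinv[OF hc[OF h]] in \<open>auto elim: eventually_mono\<close>)
        also have "\<dots> = (\<integral>z. k z * f z \<partial>MM)"
          by (rule D.integral_action_comp[OF hc[OF h], where f="\<lambda>z. k z * f z"]) measurable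
        finally show ?thesis using kf by simp
      qed
      have "(\<integral>z. k z * D.avg n f z \<partial>MM) = (\<integral>z. (\<Sum>h\<in>F n. k z * f (diag_action h z)) / card (F n) \<partial>MM)"
        by (intro Bochner_Integration.integral_cong refl) (simp add: D.avg_def sum_distrib_left)
      also have "\<dots> = 0" using i z by (simp add: Bochner_Integration.integral_sum)
      finally show ?thesis .
    qed
    have "\<bar>\<integral>z. k z * k z \<partial>MM\<bar> \<le> B * B * L1_dist MM (D.avg n f) k" if n: "1 \<le> n" for n
    proof -
      have am: "D.avg n f \<in> borel_measurable MM" using n by simp
      have aB: "\<bar>D.avg n f z\<bar> \<le> B * B" for z by (rule D.abs_avg_le[OF fB])
      have ai: "integrable MM (D.avg n f)" using am aB by (rule D.integrable_bounded)
      have i1: "integrable MM (\<lambda>z. k z * k z)"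
        by (rule D.integrable_bounded[OF _ kkB]) measurable
      have i2: "integrable MM (\<lambda>z. k z * D.avg n f z)"
        using am by (intro D.integrable_bounded[of _ "(B * B) * (B * B)"]) (auto simp: abs_mult intro!: mult_mono kB aB mult_nonneg_nonneg B0)
      have "(\<integral>z. k z * k z \<partial>MM) = (\<integral>z. k z * k z - k z * D.avg n f z \<partial>MM)"
        using i1 i2 eq[OF n] by simp
      also have "\<bar>\<dots>\<bar> \<le> (\<integral>z. \<bar>k z * k z - k z * D.avg n f z\<bar> \<partial>MM)" by (rule integral_abs_bound)
      also have "\<dots> \<le> (\<integral>z. B * B * \<bar>D.avg n f z - k z\<bar> \<partial>MM)"
      proof (rule integral_mono)
        show "\<bar>k z * k z - k z * D.avg n f z\<bar> \<le> B * B * \<bar>D.avg n f z - k z\<bar>" for z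
          unfolding right_diff_distrib[symmetric] abs_mult abs_minus_commute[of "k z" "D.avg n f z"]
          by (intro mult_right_mono kB) auto
      qed (use i1 i2 ai kint in auto)
      finally show ?thesis by (simp add: L1_dist_def)
    qed
    moreover have "(\<lambda>n. B * B * L1_dist MM (D.avg n f) k) \<longlonglongrightarrow> B * B * 0"
      by (intro tendsto_mult_left klim)
    ultimately have "\<bar>\<integral>z. k z * k z \<partial>MM\<bar> \<le> B * B * 0" by (intro LIMSEQ_le_const) auto
    then show ?thesis by (simp only: mult_zero_right abs_le_zero_iff)
  qed
  have i1: "integrable MM (\<lambda>z. k z * k z)"
    by (rule D.integrable_bounded[OF _ kkB]) measurable
  have "AE z in MM. k z * k z = 0"
    using kk by (subst (asm) integral_nonneg_eq_0_iff_AE[OF i1]) auto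
  then have k0: "AE z in MM. k z = 0" by eventually_elim simp
  \<comment> \<open>The square of an integral is an integral over the product, where the mean over
    \<open>h\<close> becomes an average of \<open>f\<close> under the diagonal action, cut down to
    pairs in \<open>A\<close>.\<close>
  have Fsq: "(\<Sum>h\<in>F n. (\<integral>x. indicator A x * w (\<psi> h x) \<partial>M)\<^sup>2) / card (F n) \<le> L1_dist MM (D.avg n f) k" if n: "1 \<le> n" for n
  proof -
    have hc: "h \<in> carrier G" if "h \<in> F n" for h using that folner_carrier[OF n] by auto
    define q where "q h z = indicator A (fst z) * w (\<psi> h (fst z)) * (indicator A (snd z) * w (\<psi> h (snd z)))" for h z
    have qm: "q h \<in> borel_measurable MM" if "h \<in> F n" for h
    proof -
      note [measurable] = hc[OF that]
      show ?thesis unfolding q_def by measurable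
    qed
    have qB: "\<bar>q h z\<bar> \<le> B * B" for h z
    proof -
      have "\<bar>indicator A x * w (\<psi> h x)\<bar> \<le> B" for x using B[of "\<psi> h x"] B0 by (auto simp: indicator_def)
      then show ?thesis unfolding q_def abs_mult[of "_ * _"] by (intro mult_mono B0) auto
    qed
    have sq: "(\<integral>x. indicator A x * w (\<psi> h x) \<partial>M)\<^sup>2 = (\<integral>z. q h z \<partial>MM)" if "h \<in> F n" for h
      using integral_pair(2)[OF qm[OF that] qB] by (simp add: q_def power2_eq_square)
    have qi: "integrable MM (q h)" if "h \<in> F n" for h using qm[OF that] qB by (rule D.integrable_bounded)
    have am: "D.avg n f \<in> borel_measurable MM" using n by simp
    have ai: "integrable MM (D.avg n f)" using am D.abs_avg_le[OF fB] by (rule D.integrable_bounded)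
    have "(\<Sum>h\<in>F n. (\<integral>x. indicator A x * w (\<psi> h x) \<partial>M)\<^sup>2) / card (F n)
        = (\<integral>z. (\<Sum>h\<in>F n. q h z) / card (F n) \<partial>MM)"
      using qi by (simp add: sq Bochner_Integration.integral_sum)
    also have "\<dots> \<le> (\<integral>z. \<bar>D.avg n f z\<bar> \<partial>MM)"
    proof (rule integral_mono)
      show "(\<Sum>h\<in>F n. q h z) / card (F n) \<le> \<bar>D.avg n f z\<bar>" for z
      proof -
        have "(\<Sum>h\<in>F n. q h z) / card (F n) = indicator A (fst z) * indicator A (snd z) * D.avg n f z"
          by (simp add: D.avg_def q_def f_def diag_action_def sum_distrib_left mult_ac)
        also have "\<dots> \<le> \<bar>D.avg n f z\<bar>" by (auto simp: indicator_def)
        finally show ?thesis .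
      qed
    qed (use qi ai in auto)
    also have "\<dots> = L1_dist MM (D.avg n f) k"
      unfolding L1_dist_def
    proof (rule integral_cong_AE)
      show "AE z in MM. \<bar>D.avg n f z\<bar> = \<bar>D.avg n f z - k z\<bar>" using k0 by eventually_elim simp
    qed (use am km in auto)
    finally show ?thesis .
  qed
  show ?thesis
  proof (rule tendsto_sandwich[OF _ _ tendsto_const klim])
    show "\<forall>\<^sub>F n in sequentially. 0 \<le> (\<Sum>h\<in>F n. (\<integral>x. indicator A x * w (\<psi> h x) \<partial>M)\<^sup>2) / card (F n)"
      by (intro always_eventually allI divide_nonneg_nonneg sum_nonneg) auto
    show "\<forall>\<^sub>F n in sequentially. (\<Sum>h\<in>F n. (\<integral>x. indicator A x * w (\<psi> h x) \<partial>M)\<^sup>2) / card (F n)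
        \<le> L1_dist MM (D.avg n f) k"
      using Fsq eventually_sequentially by blast
  qed
qed

end

section \<open>The invariant pseudometric of almost periodic functions\<close>

text \<open>Ergodicity is stated for sets invariant up to null sets, since the limits supplied by
  \<open>mean_ergodic\<close> are only almost everywhere invariant.\<close>

locale ergodic_folner_action = folner_action G M \<psi> F
  for G :: "('g, 'm) monoid_scheme" (structure) and M :: "'a measure"
    and \<psi> :: "'g \<Rightarrow> 'a \<Rightarrow> 'a" and F :: "nat \<Rightarrow> 'g set" +
  assumes ergodic: "\<And>E. E \<in> sets M \<Longrightarrow> (\<And>g. g \<in> carrier G \<Longrightarrow> AE x in M. \<psi> g x \<in> E \<longleftrightarrow> x \<in> E)
      \<Longrightarrow> prob E = 0 \<or> prob E = 1"
begin

text \<open>One level suffices: the superlevel set at the mean is null or full, so the deviation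
  from the mean has a constant sign and integral zero.\<close>

lemma ergodic_const:
  fixes u :: "'a \<Rightarrow> real"
  assumes um [measurable]: "u \<in> borel_measurable M" and B: "\<And>x. \<bar>u x\<bar> \<le> B"
    and inv: "\<And>g. g \<in> carrier G \<Longrightarrow> AE x in M. u (\<psi> g x) = u x"
  shows "AE x in M. u x = expectation u"
proof -
  define c where "c = expectation u"
  have ui: "integrable M u" by (rule integrable_bounded[OF um B])
  define E where "E = {x\<in>space M. c < u x}"
  have Em: "E \<in> sets M" unfolding E_def by measurable
  have zero: "expectation (\<lambda>x. u x - c) = 0" "expectation (\<lambda>x. c - u x) = 0"
    using ui by (simp_all add: c_def prob_space)
  have "prob E = 0 \<or> prob E = 1"
  proof (rule ergodic[OF Em])
    fix g assume g: "g \<in> carrier G"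
    show "AE x in M. \<psi> g x \<in> E \<longleftrightarrow> x \<in> E"
      using inv[OF g] AE_space
    proof eventually_elim
      case (elim x)
      then show ?case using measurable_space[OF action_measurable[OF g] elim(2)] by (simp add: E_def)
    qed
  qed
  then have "AE x in M. u x - c = 0"
  proof
    assume "prob E = 1"
    then have "AE x in M. x \<in> E" using prob_eq_1[OF Em] by simp
    then have "AE x in M. 0 \<le> u x - c" by eventually_elim (simp add: E_def)
    then show ?thesis using zero(1) ui by (subst (asm) integral_nonneg_eq_0_iff_AE) auto
  next
    assume "prob E = 0"
    then have "AE x in M. x \<notin> E" using prob_eq_0[OF Em] by simp
    then have "AE x in M. 0 \<le> c - u x" using AE_space by eventually_elim (simp add: E_def)
    then have "AE x in M. c - u x = 0"
      using zero(2) ui by (subst (asm) integral_nonneg_eq_0_iff_AE) auto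
    then show ?thesis by eventually_elim simp
  qed
  then show ?thesis unfolding c_def by eventually_elim simp
qed

text \<open>The average of the diagonal action, written out so that statements made outside its
  interpretation can refer to it.\<close>

definition davg :: "nat \<Rightarrow> ('a \<times> 'a \<Rightarrow> real) \<Rightarrow> 'a \<times> 'a \<Rightarrow> real" where
  "davg n f z = (\<Sum>h\<in>F n. f (diag_action h z)) / card (F n)"

definition variation :: "'i set \<Rightarrow> ('i \<Rightarrow> 'a \<Rightarrow> real) \<Rightarrow> 'a \<times> 'a \<Rightarrow> real" where
  "variation I f z = (\<Sum>i\<in>I. \<bar>f i (fst z) - f i (snd z)\<bar>)"

text \<open>Symmetry and the triangle inequality hold at all points, invariance only for almost
  every pair. The last clause gives every set \<open>{z. \<rho> z < \<eta>}\<close> positive product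
  measure; it stands in for the positivity of Haar measure on balls.\<close>

definition kronecker_metric :: "('a \<times> 'a \<Rightarrow> real) \<Rightarrow> ('a \<times> 'a \<Rightarrow> real) \<Rightarrow> real \<Rightarrow> bool" where
  "kronecker_metric d \<rho> B \<longleftrightarrow>
     \<rho> \<in> borel_measurable MM \<and> (\<forall>z. 0 \<le> \<rho> z \<and> \<rho> z \<le> B) \<and>
     (\<forall>x y. \<rho> (x, y) = \<rho> (y, x)) \<and> (\<forall>x y z. \<rho> (x, z) \<le> \<rho> (x, y) + \<rho> (y, z)) \<and>
     (\<lambda>n. L1_dist MM (davg n d) \<rho>) \<longlonglongrightarrow> 0 \<and>
     (\<forall>g\<in>carrier G. AE z in MM. \<rho> (diag_action g z) = \<rho> z) \<and>
     (\<forall>\<eta>>0. \<not> (AE z in MM. \<eta> \<le> \<rho> z))"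

text \<open>\<open>W\<close> is the density of a random pair: the first point is distributed by
  \<open>M\<close>, the second is drawn from the cell of the first, and so is again distributed by
  \<open>M\<close>. A cell records the rounded values of all \<open>f i\<close> along a finite set
  of group elements representing the colours. For arbitrary \<open>g\<close>, passing to its
  representative costs \<open>e\<close> at each of the two points, and points of one cell differ by
  at most \<open>e\<close>; hence the factor 3.\<close>

lemma almost_periodic_cells:
  fixes f :: "'i \<Rightarrow> 'a \<Rightarrow> real" and e :: real
  assumes I: "finite I" and fm: "\<And>i. i \<in> I \<Longrightarrow> f i \<in> borel_measurable M"
    and f01: "\<And>i x. i \<in> I \<Longrightarrow> 0 \<le> f i x \<and> f i x \<le> 1"
    and ap: "\<And>i. i \<in> I \<Longrightarrow> almost_periodic (f i)" and e: "0 < e"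
  shows "\<exists>W b. W \<in> borel_measurable MM \<and> (\<forall>z. 0 \<le> W z \<and> W z \<le> b) \<and> integral\<^sup>L MM W = 1 \<and>
     (\<forall>g\<in>carrier G. (\<integral>z. W z * variation I f (diag_action g z) \<partial>MM) \<le> 3 * card I * e)"
proof -
  interpret D: folner_action G MM diag_action F by (rule folner_action_diag)
  obtain r :: "'g \<Rightarrow> 'i \<Rightarrow> 'g set" where r: "finite (r ` carrier G)"
    "\<And>g h i. g \<in> carrier G \<Longrightarrow> h \<in> carrier G \<Longrightarrow> r g = r h \<Longrightarrow> i \<in> I \<Longrightarrow>
        L1_dist M (\<lambda>x. f i (\<psi> g x)) (\<lambda>x. f i (\<psi> h x)) < e"
    using almost_periodic_joint[OF I _ e, of f] ap by blast
  define rep where "rep c = (SOME g. g \<in> carrier G \<and> r g = c)" for c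
  have rep: "rep (r g) \<in> carrier G \<and> r (rep (r g)) = r g" if "g \<in> carrier G" for g
    unfolding rep_def by (rule someI[of _ g]) (use that in simp)
  define S where "S = rep ` r ` carrier G"
  have S: "finite S" "S \<subseteq> carrier G" using r(1) rep by (auto simp: S_def)
  define lab where "lab x = restrict (\<lambda>p. \<lfloor>f (fst p) (\<psi> (snd p) x) / e\<rfloor>) (I \<times> S)" for x
  define L where "L = lab ` space M"
  have "L \<subseteq> PiE (I \<times> S) (\<lambda>p. {0..\<lfloor>1 / e\<rfloor>})"
  proof
    fix l assume "l \<in> L"
    then obtain x where l: "l = lab x" by (auto simp: L_def)
    have "\<lfloor>f i (\<psi> s x) / e\<rfloor> \<in> {0..\<lfloor>1 / e\<rfloor>}" if "i \<in> I" for i s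
    proof -
      have "0 \<le> f i (\<psi> s x) / e" "f i (\<psi> s x) / e \<le> 1 / e"
        using f01[OF that, of "\<psi> s x"] e by (auto intro: divide_right_mono)
      then show ?thesis using floor_mono by auto
    qed
    then show "l \<in> PiE (I \<times> S) (\<lambda>p. {0..\<lfloor>1 / e\<rfloor>})" by (auto simp: l lab_def)
  qed
  then have L: "finite L"
    by (rule finite_subset) (intro finite_PiE finite_cartesian_product I S finite_atLeastAtMost_int)
  define Q where "Q l = {x\<in>space M. lab x = l}" for l
  have Qm [measurable]: "Q l \<in> sets M" for l
  proof (cases "l \<in> extensional (I \<times> S)")
    case True
    have Q: "Q l = {x\<in>space M. \<forall>p\<in>I \<times> S. \<lfloor>f (fst p) (\<psi> (snd p) x) / e\<rfloor> = l p}"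
      using True by (auto simp: Q_def lab_def extensional_def fun_eq_iff split: if_splits)
    have "{x\<in>space M. \<lfloor>f (fst p) (\<psi> (snd p) x) / e\<rfloor> = l p} \<in> sets M" if "p \<in> I \<times> S" for p
    proof -
      have "(\<lambda>x. f (fst p) (\<psi> (snd p) x)) \<in> borel_measurable M"
        using that S by (intro measurable_action_comp fm) auto
      note [measurable] = this
      show ?thesis by measurable
    qed
    then show ?thesis
      unfolding Q by (rule sets.sets_Collect_finite_All[OF _ finite_cartesian_product[OF I S(1)]])
  next
    case False
    then have "Q l = {}" by (auto simp: Q_def lab_def)
    then show ?thesis by simp
  qed
  define p where "p l = prob (Q l)" for l
  define W where "W z = (\<Sum>l\<in>L. indicator (Q l) (fst z) * indicator (Q l) (snd z) / p l)" for z
  have Wm [measurable]: "W \<in> borel_measurable MM" unfolding W_def by measurable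
  have W0: "0 \<le> W z" and Wb: "W z \<le> (\<Sum>l\<in>L. 1 / p l)" for z
    unfolding W_def p_def by (auto intro!: sum_nonneg sum_mono divide_right_mono simp: indicator_def)
  define b where "b = (\<Sum>l\<in>L. 1 / p l)"
  have Wabs: "\<bar>W z\<bar> \<le> b" for z using W0[of z] Wb[of z] by (simp add: b_def)
  have disj: "disjoint_family_on Q L" by (auto simp: disjoint_family_on_def Q_def)
  have cover: "(\<Union>l\<in>L. Q l) = space M" by (auto simp: Q_def L_def)
  have sump: "(\<Sum>l\<in>L. p l) = 1"
    using finite_measure_finite_Union[OF L _ disj] Qm by (simp add: cover p_def prob_space image_subset_iff)
  \<comment> \<open>Both marginals of \<open>W\<close> are dominated by \<open>M\<close>. A cell of
    measure zero contributes 0, since division by zero yields 0.\<close>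
  have marg: "(\<integral>z. W z * u (fst z) \<partial>MM) \<le> integral\<^sup>L M u" "(\<integral>z. W z * u (snd z) \<partial>MM) \<le> integral\<^sup>L M u"
    if um [measurable]: "u \<in> borel_measurable M" and u0: "\<And>x. 0 \<le> u x" and ub: "\<And>x. u x \<le> c" for u c
  proof -
    have uabs: "\<bar>u x\<bar> \<le> c" for x using u0[of x] ub[of x] by simp
    have ui: "integrable M u" by (rule integrable_bounded[OF um uabs])
    have c0: "0 \<le> c" using uabs[of undefined] by simp
    have iu: "integrable M (\<lambda>x. indicator (Q l) x * u x)" for l
    proof (rule integrable_bounded)
      show "\<bar>indicator (Q l) x * u x\<bar> \<le> c" for x using uabs[of x] c0 by (auto simp: indicator_def)
    qed measurable
    have t: "(\<Sum>l\<in>L. (\<integral>x. indicator (Q l) x * u x \<partial>M) * p l / p l) \<le> integral\<^sup>L M u"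
    proof -
      have "(\<Sum>l\<in>L. (\<integral>x. indicator (Q l) x * u x \<partial>M) * p l / p l) \<le> (\<Sum>l\<in>L. \<integral>x. indicator (Q l) x * u x \<partial>M)"
      proof (rule sum_mono)
        fix l
        have "0 \<le> (\<integral>x. indicator (Q l) x * u x \<partial>M)" using u0 by (intro integral_nonneg_AE) auto
        then show "(\<integral>x. indicator (Q l) x * u x \<partial>M) * p l / p l \<le> (\<integral>x. indicator (Q l) x * u x \<partial>M)"
          by (cases "p l = 0") auto
      qed
      also have "\<dots> = (\<integral>x. (\<Sum>l\<in>L. indicator (Q l) x) * u x \<partial>M)"
        using iu by (simp add: Bochner_Integration.integral_sum sum_distrib_right)
      also have "\<dots> = integral\<^sup>L M u"
      proof (rule Bochner_Integration.integral_cong[OF refl])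
        fix x assume "x \<in> space M"
        then have "(\<Sum>l\<in>L. indicator (Q l) x) = (1::real)"
          using L disj cover by (subst indicator_UN_disjoint[symmetric]) auto
        then show "(\<Sum>l\<in>L. indicator (Q l) x) * u x = u x" by simp
      qed
      finally show ?thesis .
    qed
    have Wu: "\<bar>W z * u (fst z)\<bar> \<le> b * c" "\<bar>W z * u (snd z)\<bar> \<le> b * c" for z
      unfolding abs_mult using Wabs[of z] uabs c0 order_trans[OF abs_ge_zero Wabs] by (auto intro!: mult_mono)
    have m1: "(\<lambda>z. W z * u (fst z)) \<in> borel_measurable MM" "(\<lambda>z. W z * u (snd z)) \<in> borel_measurable MM"
      by measurable
    have "(\<integral>z. W z * u (fst z) \<partial>MM) = (\<integral>x. (\<Sum>l\<in>L. (indicator (Q l) x * u x) * p l / p l) \<partial>M)"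
      unfolding integral_pair(2)[OF m1(1) Wu(1)]
    proof (rule Bochner_Integration.integral_cong[OF refl])
      fix x
      have "(\<integral>y. W (x, y) * u (fst (x, y)) \<partial>M)
          = (\<integral>y. (\<Sum>l\<in>L. (indicator (Q l) x * u x) * indicator (Q l) y / p l) \<partial>M)"
        by (intro Bochner_Integration.integral_cong refl) (simp add: W_def sum_distrib_left sum_distrib_right mult_ac)
      also have "\<dots> = (\<Sum>l\<in>L. (indicator (Q l) x * u x) * p l / p l)"
        by (subst Bochner_Integration.integral_sum) (auto simp: p_def intro!: integrable_divide integrable_mult_right integrable_indicator_event)
      finally show "(\<integral>y. W (x, y) * u (fst (x, y)) \<partial>M) = (\<Sum>l\<in>L. (indicator (Q l) x * u x) * p l / p l)" .
    qed
    also have "\<dots> = (\<Sum>l\<in>L. (\<integral>x. indicator (Q l) x * u x \<partial>M) * p l / p l)"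
      by (subst Bochner_Integration.integral_sum, intro integrable_divide integrable_mult_left iu)
        (simp only: integral_divide_zero integral_mult_left_zero)
    finally show "(\<integral>z. W z * u (fst z) \<partial>MM) \<le> integral\<^sup>L M u" using t by simp
    have "(\<integral>z. W z * u (snd z) \<partial>MM) = (\<integral>x. (\<Sum>l\<in>L. indicator (Q l) x * (\<integral>y. indicator (Q l) y * u y \<partial>M) / p l) \<partial>M)"
      unfolding integral_pair(2)[OF m1(2) Wu(2)]
    proof (rule Bochner_Integration.integral_cong[OF refl])
      fix x
      have "(\<integral>y. W (x, y) * u (snd (x, y)) \<partial>M)
          = (\<integral>y. (\<Sum>l\<in>L. indicator (Q l) x * (indicator (Q l) y * u y) / p l) \<partial>M)"
        by (intro Bochner_Integration.integral_cong refl) (simp add: W_def sum_distrib_left sum_distrib_right mult_ac)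
      also have "\<dots> = (\<Sum>l\<in>L. indicator (Q l) x * (\<integral>y. indicator (Q l) y * u y \<partial>M) / p l)"
        using iu by (subst Bochner_Integration.integral_sum) (auto intro!: integrable_divide integrable_mult_right)
      finally show "(\<integral>y. W (x, y) * u (snd (x, y)) \<partial>M)
          = (\<Sum>l\<in>L. indicator (Q l) x * (\<integral>y. indicator (Q l) y * u y \<partial>M) / p l)" .
    qed
    also have "\<dots> = (\<Sum>l\<in>L. p l * (\<integral>y. indicator (Q l) y * u y \<partial>M) / p l)"
      by (subst Bochner_Integration.integral_sum) (auto simp: p_def intro!: integrable_divide integrable_mult_left integrable_indicator_event)
    finally show "(\<integral>z. W z * u (snd z) \<partial>MM) \<le> integral\<^sup>L M u" using t by (simp add: mult.commute)
  qed
  have Wi: "integrable MM W" by (rule integral_pair(1)[OF Wm Wabs])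
  have total: "integral\<^sup>L MM W = 1"
  proof -
    have "integral\<^sup>L MM W = (\<integral>x. (\<Sum>l\<in>L. indicator (Q l) x * p l / p l) \<partial>M)"
      unfolding integral_pair(2)[OF Wm Wabs]
    proof (rule Bochner_Integration.integral_cong[OF refl])
      fix x
      show "(\<integral>y. W (x, y) \<partial>M) = (\<Sum>l\<in>L. indicator (Q l) x * p l / p l)"
        unfolding W_def fst_conv snd_conv
        by (subst Bochner_Integration.integral_sum) (auto simp: p_def intro!: integrable_divide integrable_mult_right integrable_indicator_event)
    qed
    also have "\<dots> = (\<Sum>l\<in>L. (\<integral>x. indicator (Q l) x \<partial>M) * p l / p l)"
      by (subst Bochner_Integration.integral_sum, intro integrable_divide integrable_mult_left integrable_indicator_event Qm)
        (simp only: integral_divide_zero integral_mult_left_zero)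
    also have "\<dots> = (\<Sum>l\<in>L. p l * p l / p l)" by (simp add: p_def)
    also have "\<dots> = (\<Sum>l\<in>L. p l)" by (intro sum.cong) auto
    finally show ?thesis using sump by simp
  qed
  have bound: "(\<integral>z. W z * variation I f (diag_action g z) \<partial>MM) \<le> 3 * card I * e" if g: "g \<in> carrier G" for g
  proof -
    define s where "s = rep (r g)"
    have s: "s \<in> S" "s \<in> carrier G" "r g = r s" using g rep[OF g] by (auto simp: s_def S_def)
    define u where "u i x = \<bar>f i (\<psi> g x) - f i (\<psi> s x)\<bar>" for i x
    have um: "u i \<in> borel_measurable M" if "i \<in> I" for i
      unfolding u_def using measurable_action_comp[OF fm[OF that]] g s(2) by auto
    have u01: "0 \<le> u i x" "u i x \<le> 1" if "i \<in> I" for i x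
      using f01[OF that, of "\<psi> g x"] f01[OF that, of "\<psi> s x"] by (auto simp: u_def)
    have ue: "integral\<^sup>L M (u i) \<le> e" if "i \<in> I" for i
      using r(2)[OF g s(2,3) that] by (simp add: L1_dist_def u_def[abs_def])
    have pt: "W z * variation I f (diag_action g z)
        \<le> (\<Sum>i\<in>I. W z * u i (fst z) + W z * u i (snd z) + W z * e)" for z
    proof (cases "lab (fst z) = lab (snd z)")
      case True
      have "variation I f (diag_action g z) \<le> (\<Sum>i\<in>I. u i (fst z) + u i (snd z) + e)"
        unfolding variation_def diag_action_def fst_conv snd_conv
      proof (rule sum_mono)
        fix i assume i: "i \<in> I"
        have "lab (fst z) (i, s) = lab (snd z) (i, s)" using True by simp
        then have "\<lfloor>f i (\<psi> s (fst z)) / e\<rfloor> = \<lfloor>f i (\<psi> s (snd z)) / e\<rfloor>"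
          using i s by (simp add: lab_def)
        then have "\<bar>f i (\<psi> s (fst z)) / e - f i (\<psi> s (snd z)) / e\<bar> \<le> 1" by linarith
        then have "\<bar>(f i (\<psi> s (fst z)) - f i (\<psi> s (snd z))) / e\<bar> \<le> 1" by (simp add: diff_divide_distrib)
        then have "\<bar>f i (\<psi> s (fst z)) - f i (\<psi> s (snd z))\<bar> \<le> e" using e by (simp add: abs_divide)
        then show "\<bar>f i (\<psi> g (fst z)) - f i (\<psi> g (snd z))\<bar> \<le> u i (fst z) + u i (snd z) + e"
          unfolding u_def by linarith
      qed
      then have "W z * variation I f (diag_action g z) \<le> W z * (\<Sum>i\<in>I. u i (fst z) + u i (snd z) + e)"
        by (intro mult_left_mono W0)
      then show ?thesis by (simp add: sum_distrib_left distrib_left)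
    next
      case False
      then have "W z = 0" unfolding W_def by (intro sum.neutral) (auto simp: Q_def indicator_def)
      then show ?thesis by simp
    qed
    have i: "integrable MM (\<lambda>z. W z * u i (fst z))" "integrable MM (\<lambda>z. W z * u i (snd z))" if "i \<in> I" for i
    proof -
      note [measurable] = um[OF that]
      have b0: "0 \<le> b" by (rule order_trans[OF abs_ge_zero Wabs[of undefined]])
      have "\<bar>W z * u i x\<bar> \<le> b * 1" for z x
        unfolding abs_mult by (intro mult_mono Wabs) (use u01[OF that, of x] b0 in auto)
      then show "integrable MM (\<lambda>z. W z * u i (fst z))" "integrable MM (\<lambda>z. W z * u i (snd z))"
        by (auto intro!: D.integrable_bounded[of _ "b * 1"])
    qed
    have iv: "integrable MM (\<lambda>z. W z * variation I f (diag_action g z))"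
    proof (rule D.integrable_bounded)
      have "(\<lambda>z. f i (\<psi> g (fst z)) - f i (\<psi> g (snd z))) \<in> borel_measurable MM" if "i \<in> I" for i
      proof -
        note [measurable] = measurable_action_comp[OF fm[OF that] g]
        show ?thesis by measurable
      qed
      then show "(\<lambda>z. W z * variation I f (diag_action g z)) \<in> borel_measurable MM"
        unfolding variation_def diag_action_def by auto
      have b0: "0 \<le> b" by (rule order_trans[OF abs_ge_zero Wabs[of undefined]])
      have "\<bar>variation I f z\<bar> \<le> card I" for z
      proof -
        have "variation I f z \<le> (\<Sum>i\<in>I. 1)" unfolding variation_def
        proof (rule sum_mono)
          fix i assume "i \<in> I"
          from f01[OF this, of "fst z"] f01[OF this, of "snd z"]
          show "\<bar>f i (fst z) - f i (snd z)\<bar> \<le> 1" by auto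
        qed
        moreover have "0 \<le> variation I f z" unfolding variation_def by (intro sum_nonneg) auto
        ultimately show ?thesis by simp
      qed
      then show "\<bar>W z * variation I f (diag_action g z)\<bar> \<le> b * card I" for z
        unfolding abs_mult by (intro mult_mono Wabs b0) auto
    qed
    have "(\<integral>z. W z * variation I f (diag_action g z) \<partial>MM)
        \<le> (\<integral>z. (\<Sum>i\<in>I. W z * u i (fst z) + W z * u i (snd z) + W z * e) \<partial>MM)"
      by (rule integral_mono) (use pt i iv Wi in \<open>auto intro!: Bochner_Integration.integrable_sum\<close>)
    also have "\<dots> = (\<Sum>i\<in>I. (\<integral>z. W z * u i (fst z) \<partial>MM) + (\<integral>z. W z * u i (snd z) \<partial>MM) + integral\<^sup>L MM W * e)"
      using i Wi by (subst Bochner_Integration.integral_sum) auto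
    also have "\<dots> \<le> (\<Sum>i\<in>I. e + e + 1 * e)"
      unfolding total
    proof (rule sum_mono)
      fix i assume i: "i \<in> I"
      show "(\<integral>z. W z * u i (fst z) \<partial>MM) + (\<integral>z. W z * u i (snd z) \<partial>MM) + 1 * e \<le> e + e + 1 * e"
        using marg[OF um[OF i] u01[OF i]] ue[OF i] by linarith
    qed
    finally show ?thesis by simp
  qed
  show ?thesis
    by (intro exI[of _ W] exI[of _ b] conjI allI ballI Wm W0 total bound) (simp_all add: Wb b_def)
qed

section \<open>Construction and homogeneity of the pseudometric\<close>

lemma variation_measurable:
  assumes "\<And>i. i \<in> I \<Longrightarrow> f i \<in> borel_measurable M"
  shows "variation I f \<in> borel_measurable MM"
proof -
  have "(\<lambda>z. f i (fst z) - f i (snd z)) \<in> borel_measurable MM" if "i \<in> I" for i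
  proof -
    note [measurable] = assms[OF that]
    show ?thesis by measurable
  qed
  then show ?thesis unfolding variation_def[abs_def] by auto
qed

lemma variation_nonneg: "0 \<le> variation I f z"
  unfolding variation_def by (intro sum_nonneg) auto

lemma variation_le:
  assumes "\<And>i x. i \<in> I \<Longrightarrow> 0 \<le> f i x \<and> f i x \<le> 1"
  shows "variation I f z \<le> card I"
proof -
  have "variation I f z \<le> (\<Sum>i\<in>I. 1)" unfolding variation_def
  proof (rule sum_mono)
    fix i assume "i \<in> I"
    from assms[OF this, of "fst z"] assms[OF this, of "snd z"]
    show "\<bar>f i (fst z) - f i (snd z)\<bar> \<le> 1" by auto
  qed
  then show ?thesis by simp
qed

lemma variation_commute: "variation I f (x, y) = variation I f (y, x)"
  by (simp add: variation_def abs_minus_commute)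

lemma variation_triangle: "variation I f (x, z) \<le> variation I f (x, y) + variation I f (y, z)"
  unfolding variation_def sum.distrib[symmetric] by (intro sum_mono) auto

text \<open>The clause that needs more than the ergodic limit is positivity: if \<rho> were at least
  \<eta> almost everywhere, its integral against the probability density \<open>W\<close> would be
  at least \<eta>, whereas all averages of the variation, and so their limit, have integral at most
  \<open>3 * card I * e\<close>.\<close>

lemma kronecker_metric_exists:
  fixes f :: "'i \<Rightarrow> 'a \<Rightarrow> real"
  assumes I: "finite I" and fm: "\<And>i. i \<in> I \<Longrightarrow> f i \<in> borel_measurable M"
    and f01: "\<And>i x. i \<in> I \<Longrightarrow> 0 \<le> f i x \<and> f i x \<le> 1"
    and ap: "\<And>i. i \<in> I \<Longrightarrow> almost_periodic (f i)"
  shows "\<exists>\<rho>. kronecker_metric (variation I f) \<rho> (card I)"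
proof -
  interpret D: folner_action G MM diag_action F by (rule folner_action_diag)
  define d where "d = variation I f"
  have dm [measurable]: "d \<in> borel_measurable MM" unfolding d_def by (rule variation_measurable[OF fm])
  have d0: "0 \<le> d z" for z unfolding d_def by (rule variation_nonneg)
  have dle: "d z \<le> card I" for z unfolding d_def using f01 by (rule variation_le)
  have dB: "\<bar>d z\<bar> \<le> card I" for z using d0[of z] dle[of z] by simp
  have avg_eq: "D.avg n q = davg n q" for n q by (simp add: D.avg_def davg_def fun_eq_iff)
  obtain r \<rho> where R: "(\<forall>j. 1 \<le> r j) \<and> (\<forall>z. \<rho> z = real_limsup (\<lambda>j. D.avg (r j) d z)) \<and>
    \<rho> \<in> borel_measurable MM \<and> (\<forall>z. \<bar>\<rho> z\<bar> \<le> real (card I)) \<and>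
    (\<lambda>n. L1_dist MM (D.avg n d) \<rho>) \<longlonglongrightarrow> 0 \<and>
    (\<forall>g\<in>carrier G. AE z in MM. \<rho> (diag_action g z) = \<rho> z)"
    using D.mean_ergodic[OF dm dB] by (elim exE) (rule that)
  have \<rho>: "\<And>z. \<rho> z = real_limsup (\<lambda>j. D.avg (r j) d z)"
    and \<rho>m [measurable]: "\<rho> \<in> borel_measurable MM" and \<rho>B: "\<And>z. \<bar>\<rho> z\<bar> \<le> card I"
    and lim: "(\<lambda>n. L1_dist MM (D.avg n d) \<rho>) \<longlonglongrightarrow> 0"
    and inv: "\<And>g. g \<in> carrier G \<Longrightarrow> AE z in MM. \<rho> (diag_action g z) = \<rho> z"
    using R by blast+
  have aB: "\<bar>D.avg n d z\<bar> \<le> card I" for n z by (rule D.abs_avg_le[OF dB])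
  have \<rho>0: "0 \<le> \<rho> z" for z
    unfolding \<rho> by (rule real_limsup_ge[OF aB]) (rule D.avg_nonneg[OF d0])
  have sym: "\<rho> (x, y) = \<rho> (y, x)" for x y
  proof -
    have "D.avg n d (x, y) = D.avg n d (y, x)" for n
      unfolding D.avg_def diag_action_def d_def fst_conv snd_conv by (simp only: variation_commute)
    then show ?thesis unfolding \<rho> by simp
  qed
  have tri: "\<rho> (x, z) \<le> \<rho> (x, y) + \<rho> (y, z)" for x y z
    unfolding \<rho>
  proof (rule real_limsup_triangle[OF aB aB aB])
    show "D.avg (r j) d (x, z) \<le> D.avg (r j) d (x, y) + D.avg (r j) d (y, z)" for j
      unfolding D.avg_def diag_action_def d_def fst_conv snd_conv add_divide_distrib[symmetric] sum.distrib[symmetric]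
      by (intro divide_right_mono sum_mono variation_triangle) simp
  qed
  have small: "\<not> (AE z in MM. \<eta> \<le> \<rho> z)" if \<eta>: "0 < \<eta>" for \<eta>
  proof
    assume ae: "AE z in MM. \<eta> \<le> \<rho> z"
    \<comment> \<open>Makes \<open>3 * card I * e\<close> strictly smaller than \<eta>, also for
      empty \<open>I\<close>.\<close>
    define e where "e = \<eta> / (3 * card I + 1)"
    have e: "0 < e" using \<eta> by (simp add: e_def add_nonneg_pos)
    have "\<exists>W b. W \<in> borel_measurable MM \<and> (\<forall>z. 0 \<le> W z \<and> W z \<le> b) \<and> integral\<^sup>L MM W = 1 \<and>
       (\<forall>g\<in>carrier G. (\<integral>z. W z * d (diag_action g z) \<partial>MM) \<le> 3 * card I * e)"
      unfolding d_def by (rule almost_periodic_cells[OF I]) (use fm f01 ap e in auto)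
    then obtain W b where R: "W \<in> borel_measurable MM \<and> (\<forall>z. 0 \<le> W z \<and> W z \<le> b) \<and> integral\<^sup>L MM W = 1 \<and>
       (\<forall>g\<in>carrier G. (\<integral>z. W z * d (diag_action g z) \<partial>MM) \<le> 3 * card I * e)"
      by (elim exE) (rule that)
    have Wm [measurable]: "W \<in> borel_measurable MM" and W: "\<And>z. 0 \<le> W z" "\<And>z. W z \<le> b"
      and tot: "integral\<^sup>L MM W = 1"
      and Wg: "\<And>g. g \<in> carrier G \<Longrightarrow> (\<integral>z. W z * d (diag_action g z) \<partial>MM) \<le> 3 * card I * e"
      using R by blast+
    have b0: "0 \<le> b" using W[of undefined] by linarith
    have Wabs: "\<bar>W z\<bar> \<le> b" for z using W[of z] by simp
    have Wi: "integrable MM W" by (rule D.integrable_bounded[OF Wm Wabs])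
    have prod_int: "integrable MM (\<lambda>z. W z * q z)" if "q \<in> borel_measurable MM" "\<And>z. \<bar>q z\<bar> \<le> card I" for q :: "'a \<times> 'a \<Rightarrow> real"
    proof (rule D.integrable_bounded)
      show "(\<lambda>z. W z * q z) \<in> borel_measurable MM" using that(1) Wm by (rule borel_measurable_times[rotated])
      show "\<bar>W z * q z\<bar> \<le> b * card I" for z unfolding abs_mult by (intro mult_mono Wabs that(2) b0) auto
    qed
    have Wn: "(\<integral>z. W z * D.avg n d z \<partial>MM) \<le> 3 * card I * e" if n: "1 \<le> n" for n
    proof -
      have hc: "h \<in> carrier G" if "h \<in> F n" for h using that folner_carrier[OF n] by auto
      have i: "integrable MM (\<lambda>z. W z * d (diag_action h z))" if "h \<in> F n" for h
        using D.measurable_action_comp[OF dm hc[OF that]] dB by (intro prod_int) auto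
      have "(\<integral>z. W z * D.avg n d z \<partial>MM) = (\<integral>z. (\<Sum>h\<in>F n. W z * d (diag_action h z)) / card (F n) \<partial>MM)"
        by (intro Bochner_Integration.integral_cong refl) (simp add: D.avg_def sum_distrib_left)
      also have "\<dots> = (\<Sum>h\<in>F n. (\<integral>z. W z * d (diag_action h z) \<partial>MM)) / card (F n)"
        using i by (simp add: Bochner_Integration.integral_sum)
      also have "\<dots> \<le> (\<Sum>h\<in>F n. 3 * card I * e) / card (F n)"
        using Wg[OF hc] by (intro divide_right_mono sum_mono) auto
      also have "\<dots> = 3 * card I * e" using folner_card_pos[OF n] by simp
      finally show ?thesis .
    qed
    have up: "(\<integral>z. W z * \<rho> z \<partial>MM) \<le> 3 * card I * e + b * L1_dist MM (D.avg n d) \<rho>" if n: "1 \<le> n" for n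
    proof -
      have am: "D.avg n d \<in> borel_measurable MM" using n by simp
      have ai: "integrable MM (D.avg n d)" using am aB by (rule D.integrable_bounded)
      have \<rho>i: "integrable MM \<rho>" using \<rho>m \<rho>B by (rule D.integrable_bounded)
      have "(\<integral>z. W z * \<rho> z \<partial>MM) \<le> (\<integral>z. W z * D.avg n d z + b * \<bar>D.avg n d z - \<rho> z\<bar> \<partial>MM)"
      proof (rule integral_mono)
        show "W z * \<rho> z \<le> W z * D.avg n d z + b * \<bar>D.avg n d z - \<rho> z\<bar>" for z
        proof -
          have "W z * (\<rho> z - D.avg n d z) \<le> W z * \<bar>D.avg n d z - \<rho> z\<bar>"
            by (intro mult_left_mono W) auto
          also have "\<dots> \<le> b * \<bar>D.avg n d z - \<rho> z\<bar>"
            by (intro mult_right_mono W) auto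
          finally show ?thesis by (simp add: right_diff_distrib)
        qed
      qed (use prod_int[OF \<rho>m \<rho>B] prod_int[OF am aB] ai \<rho>i in auto)
      also have "\<dots> = (\<integral>z. W z * D.avg n d z \<partial>MM) + b * L1_dist MM (D.avg n d) \<rho>"
        using prod_int[OF am aB] ai \<rho>i by (simp add: L1_dist_def)
      finally show ?thesis using Wn[OF n] by simp
    qed
    have "(\<lambda>n. 3 * card I * e + b * L1_dist MM (D.avg n d) \<rho>) \<longlonglongrightarrow> 3 * card I * e + b * 0"
      by (intro tendsto_intros lim)
    from LIMSEQ_le_const[OF this] have "(\<integral>z. W z * \<rho> z \<partial>MM) \<le> 3 * card I * e"
      using up by auto
    also have "\<dots> = \<eta> * (3 * card I / (3 * card I + 1))" by (simp add: e_def)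
    also have "\<dots> < \<eta> * 1" using \<eta> by (intro mult_strict_left_mono) (auto simp: divide_less_eq)
    also have "\<dots> = (\<integral>z. W z * \<eta> \<partial>MM)" using tot Wi by simp
    also have "\<dots> \<le> (\<integral>z. W z * \<rho> z \<partial>MM)"
    proof (rule integral_mono_AE)
      show "AE z in MM. W z * \<eta> \<le> W z * \<rho> z"
        using ae by eventually_elim (intro mult_left_mono W)
    qed (use prod_int[OF \<rho>m \<rho>B] Wi in auto)
    finally show False by simp
  qed
  have "\<rho> z \<le> card I" for z using \<rho>B[of z] by simp
  then have "kronecker_metric d \<rho> (card I)"
    unfolding kronecker_metric_def
    by (intro conjI allI ballI impI \<rho>m \<rho>0 tri lim[unfolded avg_eq] inv small) (assumption | rule sym)+
  then show ?thesis unfolding d_def by blast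
qed

text \<open>The mean of the bump around \<open>x\<close> is an invariant function of
  \<open>x\<close>, hence constant by ergodicity; this is the homogeneity that Haar measure would
  provide. A bump is preferred to the indicator of a ball because it is Lipschitz with respect to
  \<rho>.\<close>

lemma kronecker_metric_bump:
  assumes km: "kronecker_metric d \<rho> B" and \<zeta>: "0 < \<zeta>"
  shows "\<exists>N>0. N = (\<integral>z. max 0 (\<zeta> - \<rho> z) \<partial>MM) \<and> (AE x in M. (\<integral>y. max 0 (\<zeta> - \<rho> (x, y)) \<partial>M) = N)"
proof -
  interpret D: folner_action G MM diag_action F by (rule folner_action_diag)
  have \<rho>m [measurable]: "\<rho> \<in> borel_measurable MM" and \<rho>0: "\<And>z. 0 \<le> \<rho> z"
    and inv: "\<And>g. g \<in> carrier G \<Longrightarrow> AE z in MM. \<rho> (diag_action g z) = \<rho> z"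
    and small: "\<not> (AE z in MM. \<zeta> \<le> \<rho> z)"
    using km \<zeta> by (auto simp: kronecker_metric_def)
  define k where "k z = max 0 (\<zeta> - \<rho> z)" for z
  have kmeas [measurable]: "k \<in> borel_measurable MM" unfolding k_def by measurable
  have kB: "\<bar>k z\<bar> \<le> \<zeta>" for z using \<rho>0[of z] \<zeta> by (auto simp: k_def)
  have ki: "integrable MM k" by (rule D.integrable_bounded[OF kmeas kB])
  define u where "u x = (\<integral>y. k (x, y) \<partial>M)" for x
  have um [measurable]: "u \<in> borel_measurable M" and uB: "\<bar>u x\<bar> \<le> \<zeta>" for x
    using integral_pair(3,4)[OF kmeas kB] by (auto simp: u_def[abs_def])
  define N where "N = integral\<^sup>L MM k"
  have "AE x in M. u x = expectation u"
  proof (rule ergodic_const[OF um uB])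
    fix g assume g: "g \<in> carrier G"
    have "AE z in MM. k (diag_action g z) = k z"
      using inv[OF g] by eventually_elim (simp add: k_def)
    from kernel_equivariant[OF kmeas this _ g, of "\<lambda>_. 1"]
    show "AE x in M. u (\<psi> g x) = u x" by (simp add: u_def)
  qed
  moreover have "expectation u = N"
    using integral_pair(2)[OF kmeas kB] by (simp add: N_def u_def[abs_def])
  moreover have "0 < N"
  proof (rule ccontr)
    assume "\<not> 0 < N"
    moreover have "0 \<le> N" unfolding N_def by (rule integral_nonneg_AE) (simp add: k_def)
    ultimately have "integral\<^sup>L MM k = 0" by (simp add: N_def)
    then have "AE z in MM. k z = 0"
      by (subst (asm) integral_nonneg_eq_0_iff_AE[OF ki]) (auto simp: k_def)
    then have "AE z in MM. \<zeta> \<le> \<rho> z" by eventually_elim (simp add: k_def max_def split: if_splits)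
    then show False using small by simp
  qed
  ultimately show ?thesis unfolding N_def u_def k_def by auto
qed

text \<open>By Fubini the bumps around points of \<open>D\<close> have positive total mass, so the
  centres that see a positive part of \<open>D\<close> do not form a null set and one of them has
  the prescribed almost sure property \<open>P\<close>. The centre itself may lie outside
  \<open>D\<close>.\<close>

lemma kronecker_metric_small_sets:
  assumes km: "kronecker_metric d \<rho> B" and \<zeta>: "0 < \<zeta>"
    and D [measurable]: "D \<in> sets M" and pos: "0 < prob D" and P: "AE x in M. P x"
  shows "\<exists>x0\<in>space M. P x0 \<and> {x\<in>D. \<rho> (x0, x) < \<zeta>} \<in> sets M \<and> 0 < prob {x\<in>D. \<rho> (x0, x) < \<zeta>}"
proof -
  interpret P: pair_prob_space M M by (rule pair_prob_space)
  have \<rho>m [measurable]: "\<rho> \<in> borel_measurable MM" and \<rho>0: "\<And>z. 0 \<le> \<rho> z"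
    and sym: "\<And>x y. \<rho> (x, y) = \<rho> (y, x)"
    using km \<zeta> by (auto simp: kronecker_metric_def)
  obtain N where N: "0 < N" "AE x in M. (\<integral>y. max 0 (\<zeta> - \<rho> (x, y)) \<partial>M) = N"
    using kronecker_metric_bump[OF km \<zeta>] by blast
  define k where "k z = indicator D (fst z) * max 0 (\<zeta> - \<rho> z)" for z
  have kmeas [measurable]: "k \<in> borel_measurable MM" unfolding k_def by measurable
  have kB: "\<bar>k z\<bar> \<le> \<zeta>" for z using \<rho>0[of z] \<zeta> by (auto simp: k_def indicator_def)
  have ki: "integrable MM k" by (rule integral_pair(1)[OF kmeas kB])
  have "integral\<^sup>L MM k = (\<integral>x. indicator D x * (\<integral>y. max 0 (\<zeta> - \<rho> (x, y)) \<partial>M) \<partial>M)"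
    unfolding integral_pair(2)[OF kmeas kB] by (simp add: k_def)
  also have "\<dots> = (\<integral>x. indicator D x * N \<partial>M)"
  proof (rule integral_cong_AE)
    show "AE x in M. indicator D x * (\<integral>y. max 0 (\<zeta> - \<rho> (x, y)) \<partial>M) = indicator D x * N"
      using N(2) by eventually_elim simp
  qed measurable
  also have "\<dots> = prob D * N" by simp
  finally have kpos: "0 < integral\<^sup>L MM k" using pos N(1) by simp
  have "integral\<^sup>L MM k = (\<integral>y. (\<integral>x. k (x, y) \<partial>M) \<partial>M)"
    using P.integral_snd[of "\<lambda>x y. k (x, y)"] ki by simp
  then have ne: "\<not> (AE y in M. (\<integral>x. k (x, y) \<partial>M) = 0)"
    using kpos integral_eq_zero_AE[of "\<lambda>y. \<integral>x. k (x, y) \<partial>M" M] by auto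
  have "\<exists>x0\<in>space M. P x0 \<and> (\<integral>x. k (x, x0) \<partial>M) \<noteq> 0"
  proof (rule ccontr)
    assume neg: "\<not> ?thesis"
    have "AE y in M. (\<integral>x. k (x, y) \<partial>M) = 0"
      using P AE_space by eventually_elim (use neg in blast)
    then show False using ne by simp
  qed
  then obtain x0 where x0: "x0 \<in> space M" "P x0" and kx: "(\<integral>x. k (x, x0) \<partial>M) \<noteq> 0" by blast
  define S where "S = {x\<in>D. \<rho> (x0, x) < \<zeta>}"
  note [measurable] = measurable_Pair_section[OF \<rho>m x0(1)]
  have "S = {x\<in>space M. x \<in> D \<and> \<rho> (x0, x) < \<zeta>}"
    using sets.sets_into_space[OF D] by (auto simp: S_def)
  then have Sm: "S \<in> sets M" by simp
  have "0 < prob S"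
  proof (rule ccontr)
    assume "\<not> 0 < prob S"
    then have "prob S = 0" using measure_nonneg[of M S] by simp
    then have "AE x in M. x \<notin> S" using prob_eq_0[OF Sm] by simp
    then have "AE x in M. k (x, x0) = 0"
      by eventually_elim (auto simp: S_def k_def indicator_def sym[of _ x0] max_def)
    then have "(\<integral>x. k (x, x0) \<partial>M) = 0" by (rule integral_eq_zero_AE)
    then show False using kx by simp
  qed
  then show ?thesis using x0 Sm unfolding S_def by blast
qed

end

section \<open>A set on which orbits stay close in the mean\<close>

context ergodic_folner_action begin

text \<open>The bump kernel is invariant, so under its integral \<open>d\<close> may be replaced by
  its averages and, in the limit, by \<rho>, which is below \<eta> wherever the bump is
  nonzero.\<close>

lemma kronecker_metric_integral_bump:
  assumes km: "kronecker_metric d \<rho> B" and dm [measurable]: "d \<in> borel_measurable MM"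
    and d0: "\<And>z. 0 \<le> d z" and dB: "\<And>z. d z \<le> B" and \<eta>: "0 < \<eta>"
  shows "(\<integral>z. max 0 (\<eta> - \<rho> z) * d z \<partial>MM) \<le> \<eta> * (\<integral>z. max 0 (\<eta> - \<rho> z) \<partial>MM)"
proof -
  interpret D: folner_action G MM diag_action F by (rule folner_action_diag)
  have avg_eq: "D.avg n q = davg n q" for n q by (simp add: D.avg_def davg_def fun_eq_iff)
  have \<rho>m [measurable]: "\<rho> \<in> borel_measurable MM" and \<rho>0: "\<And>z. 0 \<le> \<rho> z" and \<rho>B: "\<And>z. \<rho> z \<le> B"
    and inv: "\<And>g. g \<in> carrier G \<Longrightarrow> AE z in MM. \<rho> (diag_action g z) = \<rho> z"
    and lim: "(\<lambda>n. L1_dist MM (davg n d) \<rho>) \<longlonglongrightarrow> 0"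
    using km unfolding kronecker_metric_def by blast+
  define k where "k z = max 0 (\<eta> - \<rho> z)" for z
  have kmeas [measurable]: "k \<in> borel_measurable MM" unfolding k_def by measurable
  have k0: "0 \<le> k z" and k\<eta>: "k z \<le> \<eta>" for z using \<rho>0[of z] \<eta> by (auto simp: k_def)
  have kabs: "\<bar>k z\<bar> \<le> \<eta>" for z using k0[of z] k\<eta>[of z] by simp
  have ki: "integrable MM k" by (rule D.integrable_bounded[OF kmeas kabs])
  have dabs: "\<bar>d z\<bar> \<le> B" and \<rho>abs: "\<bar>\<rho> z\<bar> \<le> B" for z using d0[of z] dB[of z] \<rho>0[of z] \<rho>B[of z] by auto
  have prod_int: "integrable MM (\<lambda>z. k z * q z)" if "q \<in> borel_measurable MM" "\<And>z. \<bar>q z\<bar> \<le> B" for q :: "'a \<times> 'a \<Rightarrow> real"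
  proof (rule D.integrable_bounded)
    show "(\<lambda>z. k z * q z) \<in> borel_measurable MM" using that(1) kmeas by (rule borel_measurable_times[rotated])
    show "\<bar>k z * q z\<bar> \<le> \<eta> * B" for z unfolding abs_mult by (intro mult_mono kabs that(2)) (use \<eta> in auto)
  qed
  have shift: "(\<integral>z. k z * d (diag_action h z) \<partial>MM) = (\<integral>z. k z * d z \<partial>MM)" if h: "h \<in> carrier G" for h
  proof -
    note [measurable] = D.measurable_action_comp[OF dm h] D.measurable_action_comp[OF kmeas h]
    have "(\<integral>z. k z * d (diag_action h z) \<partial>MM) = (\<integral>z. k (diag_action h z) * d (diag_action h z) \<partial>MM)"
    proof (rule integral_cong_AE)
      show "AE z in MM. k z * d (diag_action h z) = k (diag_action h z) * d (diag_action h z)"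
        using inv[OF h] by eventually_elim (simp add: k_def)
    qed measurable
    also have "\<dots> = (\<integral>z. k z * d z \<partial>MM)"
      by (rule D.integral_action_comp[OF h, where f="\<lambda>z. k z * d z"]) measurable
    finally show ?thesis .
  qed
  have up: "(\<integral>z. k z * d z \<partial>MM) \<le> \<eta> * integral\<^sup>L MM k + \<eta> * L1_dist MM (davg n d) \<rho>" if n: "1 \<le> n" for n
  proof -
    have hc: "h \<in> carrier G" if "h \<in> F n" for h using that folner_carrier[OF n] by auto
    have am: "davg n d \<in> borel_measurable MM" using n avg_eq D.borel_measurable_avg[OF n dm] by simp
    have aB: "\<bar>davg n d z\<bar> \<le> B" for z using D.abs_avg_le[of d B n z, OF dabs] by (simp add: avg_eq)
    have i: "integrable MM (\<lambda>z. k z * d (diag_action h z))" if "h \<in> F n" for h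
      using D.measurable_action_comp[OF dm hc[OF that]] dabs by (intro prod_int) auto
    have "(\<integral>z. k z * davg n d z \<partial>MM) = (\<integral>z. (\<Sum>h\<in>F n. k z * d (diag_action h z)) / card (F n) \<partial>MM)"
      by (intro Bochner_Integration.integral_cong refl) (simp add: davg_def sum_distrib_left)
    also have "\<dots> = (\<Sum>h\<in>F n. (\<integral>z. k z * d (diag_action h z) \<partial>MM)) / card (F n)"
      using i by (simp add: Bochner_Integration.integral_sum)
    also have "\<dots> = (\<integral>z. k z * d z \<partial>MM)"
      using shift[OF hc] folner_card_pos[OF n] by simp
    finally have eq: "(\<integral>z. k z * d z \<partial>MM) = (\<integral>z. k z * davg n d z \<partial>MM)" by simp
    have ai: "integrable MM (davg n d)" using am aB by (rule D.integrable_bounded)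
    have \<rho>i: "integrable MM \<rho>" using \<rho>m \<rho>abs by (rule D.integrable_bounded)
    have "(\<integral>z. k z * davg n d z \<partial>MM) \<le> (\<integral>z. \<eta> * k z + \<eta> * \<bar>davg n d z - \<rho> z\<bar> \<partial>MM)"
    proof (rule integral_mono)
      show "k z * davg n d z \<le> \<eta> * k z + \<eta> * \<bar>davg n d z - \<rho> z\<bar>" for z
      proof -
        have "k z * (davg n d z - \<rho> z) \<le> k z * \<bar>davg n d z - \<rho> z\<bar>" by (intro mult_left_mono k0) auto
        also have "\<dots> \<le> \<eta> * \<bar>davg n d z - \<rho> z\<bar>" by (intro mult_right_mono k\<eta>) auto
        finally have "k z * davg n d z \<le> k z * \<rho> z + \<eta> * \<bar>davg n d z - \<rho> z\<bar>"
          by (simp add: right_diff_distrib)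
        moreover have "k z * \<rho> z \<le> k z * \<eta>"
          by (cases "\<rho> z \<le> \<eta>") (auto simp: k_def intro: mult_left_mono)
        ultimately show ?thesis by (simp add: mult.commute)
      qed
    qed (use prod_int[OF am aB] ai \<rho>i ki in auto)
    also have "\<dots> = \<eta> * integral\<^sup>L MM k + \<eta> * L1_dist MM (davg n d) \<rho>"
      using ai \<rho>i ki by (simp add: L1_dist_def)
    finally show ?thesis using eq by simp
  qed
  have "(\<lambda>n. \<eta> * integral\<^sup>L MM k + \<eta> * L1_dist MM (davg n d) \<rho>) \<longlonglongrightarrow> \<eta> * integral\<^sup>L MM k + \<eta> * 0"
    by (intro tendsto_intros lim)
  from LIMSEQ_le_const[OF this] have "(\<integral>z. k z * d z \<partial>MM) \<le> \<eta> * integral\<^sup>L MM k"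
    using up by auto
  then show ?thesis by (simp add: k_def[abs_def])
qed

text \<open>Let \<open>\<theta>(x)\<close> be the mean value of \<open>d(x, -)\<close> on the bump of radius \<open>\<eta>\<close> around \<open>x\<close>. The
  triangle inequality gives \<open>d(u,v) \<le> \<theta>(u) + \<theta>(v) + const * \<rho>(u,v)\<close>; along orbits \<open>\<rho>\<close> is constant
  and the averages of \<open>\<theta>\<close> are controlled for all \<open>n\<close> at once by the maximal inequality.\<close>

lemma mean_equicontinuous_set:
  assumes temp: "tempered G F"
    and km: "kronecker_metric d \<rho> B" and dm [measurable]: "d \<in> borel_measurable MM"
    and d0: "\<And>z. 0 \<le> d z" and dB: "\<And>z. d z \<le> B"
    and dsym: "\<And>x y. d (x, y) = d (y, x)" and dtri: "\<And>x y z. d (x, z) \<le> d (x, y) + d (y, z)"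
    and \<delta>: "0 < \<delta>"
  shows "\<exists>A\<in>sets M. 0 < prob A \<and> (\<forall>x\<in>A. \<forall>x'\<in>A. \<forall>n\<ge>1. davg n d (x, x') \<le> \<delta>)"
proof -
  obtain C where C: "0 < C" "\<And>n. 1 \<le> n \<Longrightarrow>
      real (card (\<Union>k\<in>{1..<n}. (set_inv (F k)) <#> F n)) \<le> C * real (card (F n))"
    using temp unfolding tempered_def by auto
  have \<rho>m [measurable]: "\<rho> \<in> borel_measurable MM" and \<rho>0: "\<And>z. 0 \<le> \<rho> z"
    and \<rho>sym: "\<And>x y. \<rho> (x, y) = \<rho> (y, x)" and \<rho>tri: "\<And>x y z. \<rho> (x, z) \<le> \<rho> (x, y) + \<rho> (y, z)"
    and inv: "\<And>g. g \<in> carrier G \<Longrightarrow> AE z in MM. \<rho> (diag_action g z) = \<rho> z"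
    using km unfolding kronecker_metric_def by blast+
  have B0: "0 \<le> B" using d0[of undefined] dB[of undefined] by linarith
  \<comment> \<open>With this radius the maximal inequality at level \<open>\<delta> / 4\<close>
    bounds the bad set by \<open>(2 + 2 * C) * \<eta> / (\<delta> / 4) = 1 / 2\<close>.\<close>
  define \<eta> where "\<eta> = \<delta> / (16 * (1 + C))"
  have \<eta>: "0 < \<eta>" using \<delta> C(1) by (simp add: \<eta>_def)
  define k where "k z = max 0 (\<eta> - \<rho> z)" for z
  have kmeas [measurable]: "k \<in> borel_measurable MM" unfolding k_def by measurable
  have k0: "0 \<le> k z" and k\<eta>: "k z \<le> \<eta>" for z using \<rho>0[of z] \<eta> by (auto simp: k_def)
  have kabs: "\<bar>k z\<bar> \<le> \<eta>" for z using k0[of z] k\<eta>[of z] by simp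
  have ksym: "k (x, y) = k (y, x)" for x y by (simp add: k_def \<rho>sym[of x y])
  have klip: "\<bar>k (u, w) - k (v, w)\<bar> \<le> \<rho> (u, v)" for u v w
    using \<rho>tri[of u w v] \<rho>tri[of v w u] \<rho>0[of "(u, v)"] by (auto simp: k_def \<rho>sym[of v u])
  obtain N where N: "0 < N" "N = integral\<^sup>L MM k" and Nae: "AE x in M. (\<integral>y. k (x, y) \<partial>M) = N"
    using kronecker_metric_bump[OF km \<eta>] unfolding k_def[symmetric] by blast
  define \<theta> where "\<theta> x = (\<integral>y. k (x, y) * d (x, y) \<partial>M) / N" for x
  have kdm: "(\<lambda>z. k z * d z) \<in> borel_measurable MM" by measurable
  have kdB: "\<bar>k z * d z\<bar> \<le> \<eta> * B" for z
    unfolding abs_mult using d0[of z] dB[of z] \<eta> by (intro mult_mono kabs) auto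
  have \<theta>m [measurable]: "\<theta> \<in> borel_measurable M"
    using integral_pair(3)[OF kdm kdB] unfolding \<theta>_def[abs_def] by (intro borel_measurable_divide) auto
  have \<theta>0: "0 \<le> \<theta> x" for x
    unfolding \<theta>_def using N(1) k0 d0 by (intro divide_nonneg_nonneg integral_nonneg_AE) auto
  have \<theta>le: "\<theta> x \<le> \<eta> * B / N" for x
    using integral_pair(4)[OF kdm kdB, of x] N(1) unfolding \<theta>_def by (intro divide_right_mono) auto
  have int\<theta>: "integral\<^sup>L M \<theta> \<le> \<eta>"
  proof -
    have "integral\<^sup>L M \<theta> = (\<integral>z. k z * d z \<partial>MM) / N"
      using integral_pair(2)[OF kdm kdB] by (simp add: \<theta>_def[abs_def])
    also have "\<dots> \<le> \<eta> * N / N"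
      using kronecker_metric_integral_bump[OF km dm d0 dB \<eta>] N
      by (intro divide_right_mono) (auto simp: k_def[abs_def])
    finally show ?thesis using N(1) by simp
  qed
  define Bad where "Bad = {x\<in>space M. \<exists>n\<ge>1. \<delta> / 4 < avg n \<theta> x}"
  have Badm [measurable]: "Bad \<in> sets M"
  proof -
    have "Bad = (\<Union>n\<in>{1..}. {x\<in>space M. \<delta> / 4 < avg n \<theta> x})" by (auto simp: Bad_def)
    moreover have "{x\<in>space M. \<delta> / 4 < avg n \<theta> x} \<in> sets M" if "1 \<le> n" for n
    proof -
      note [measurable] = borel_measurable_avg[OF that \<theta>m]
      show ?thesis by measurable
    qed
    ultimately show ?thesis by auto
  qed
  have "\<delta> / 4 * prob Bad \<le> (2 + 2 * C) * integral\<^sup>L M \<theta>"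
    unfolding Bad_def
    by (rule maximal_inequality[OF less_imp_le[OF C(1)] C(2) _ \<theta>m \<theta>0 \<theta>le]) (use \<delta> in auto)
  also have "\<dots> \<le> (2 + 2 * C) * \<eta>" using int\<theta> C(1) by (intro mult_left_mono) auto
  also have "\<dots> = \<delta> / 8" using C(1) by (simp add: \<eta>_def field_simps)
  finally have "prob Bad \<le> 1 / 2" using \<delta> by (simp add: field_simps)
  then have good: "0 < prob (space M - Bad)" using prob_compl[OF Badm] by simp
  \<comment> \<open>The triangle inequality through \<open>w\<close> is integrated against the bump
    around \<open>u\<close>. In the term with \<open>d (v, w)\<close> the bump is moved to
    \<open>v\<close>, at a cost of at most \<open>\<rho> (u, v) * B\<close>, because bumps are
    1-Lipschitz.\<close>
  have key: "d (u, v) \<le> \<theta> u + \<theta> v + B / N * \<rho> (u, v)"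
    if u: "u \<in> space M" "(\<integral>y. k (u, y) \<partial>M) = N" and v: "v \<in> space M" for u v
  proof -
    note [measurable] = measurable_Pair_section[OF kmeas u(1)] measurable_Pair_section[OF kmeas v]
      measurable_Pair_section[OF dm u(1)] measurable_Pair_section[OF dm v]
    have i1: "integrable M (\<lambda>w. k (u, w))" by (rule integrable_bounded[of _ \<eta>]) (use kabs in auto)
    have kdB': "\<bar>k (x, w) * d (y, w)\<bar> \<le> \<eta> * B" for x y w
      unfolding abs_mult using d0[of "(y, w)"] dB[of "(y, w)"] \<eta> by (intro mult_mono kabs) auto
    have i2: "integrable M (\<lambda>w. k (u, w) * d (u, w))" "integrable M (\<lambda>w. k (v, w) * d (v, w))"
      by (rule integrable_bounded[OF _ kdB']; measurable)+
    have "N * d (u, v) = (\<integral>w. k (u, w) * d (u, v) \<partial>M)" using u(2) i1 by simp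
    also have "\<dots> \<le> (\<integral>w. k (u, w) * d (u, w) + k (v, w) * d (v, w) + \<rho> (u, v) * B \<partial>M)"
    proof (rule integral_mono)
      fix w
      have "k (u, w) * d (u, v) \<le> k (u, w) * (d (u, w) + d (v, w))"
        using dtri[of u v w] dsym[of w v] by (intro mult_left_mono k0) auto
      also have "\<dots> = k (u, w) * d (u, w) + k (v, w) * d (v, w) + (k (u, w) - k (v, w)) * d (v, w)"
        by (simp add: algebra_simps)
      also have "(k (u, w) - k (v, w)) * d (v, w) \<le> \<rho> (u, v) * B"
        using klip[of u w v] \<rho>0 by (intro mult_mono d0 dB) (auto simp: abs_le_iff)
      finally show "k (u, w) * d (u, v) \<le> k (u, w) * d (u, w) + k (v, w) * d (v, w) + \<rho> (u, v) * B" by simp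
    qed (use i1 i2 in auto)
    also have "\<dots> = N * \<theta> u + N * \<theta> v + \<rho> (u, v) * B"
      using i2 N(1) by (simp add: \<theta>_def prob_space)
    finally show ?thesis using N(1) by (simp add: field_simps)
  qed
  \<comment> \<open>Two points within \<zeta> of a common centre are at distance at most
    \<open>2 * \<zeta>\<close>, and \<open>B / N * (2 * \<zeta>)\<close> is at most
    \<open>\<delta> / 2\<close>; the two averages of \<theta> contribute \<open>\<delta> / 4\<close>
    each.\<close>
  define \<zeta> where "\<zeta> = N * \<delta> / (4 * (B + 1))"
  have \<zeta>: "0 < \<zeta>" using N(1) \<delta> B0 by (simp add: \<zeta>_def)
  \<comment> \<open>Invariance of \<rho> is known only for almost every pair, so it cannot be
    applied to two arbitrary points of the final set. A centre for which it holds with almost every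
    second point and all elements of the countable group lets them be compared through that
    centre.\<close>
  have "AE x0 in M. \<forall>g\<in>carrier G. AE x in M. \<rho> (\<psi> g x0, \<psi> g x) = \<rho> (x0, x)"
    using AE_pair_fst[OF inv] by (subst AE_ball_countable[OF countable_carrier]) (simp add: diag_action_def)
  from kronecker_metric_small_sets[OF km \<zeta> _ good this] obtain x0
    where x0: "x0 \<in> space M" "\<forall>g\<in>carrier G. AE x in M. \<rho> (\<psi> g x0, \<psi> g x) = \<rho> (x0, x)"
      and S: "{x \<in> space M - Bad. \<rho> (x0, x) < \<zeta>} \<in> sets M" "0 < prob {x \<in> space M - Bad. \<rho> (x0, x) < \<zeta>}"
    by auto
  have "AE x in M. \<forall>g\<in>carrier G. (\<integral>y. k (\<psi> g x, y) \<partial>M) = N \<and> \<rho> (\<psi> g x0, \<psi> g x) = \<rho> (x0, x)"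
    unfolding AE_ball_countable[OF countable_carrier]
  proof
    fix g assume g: "g \<in> carrier G"
    show "AE x in M. (\<integral>y. k (\<psi> g x, y) \<partial>M) = N \<and> \<rho> (\<psi> g x0, \<psi> g x) = \<rho> (x0, x)"
      using AE_action_comp[OF g Nae] bspec[OF x0(2) g] by eventually_elim simp
  qed
  then obtain Z where Z: "Z \<in> null_sets M"
    "{x\<in>space M. \<not> (\<forall>g\<in>carrier G. (\<integral>y. k (\<psi> g x, y) \<partial>M) = N \<and> \<rho> (\<psi> g x0, \<psi> g x) = \<rho> (x0, x))} \<subseteq> Z"
    unfolding eventually_ae_filter by blast
  define A where "A = {x \<in> space M - Bad. \<rho> (x0, x) < \<zeta>} - Z"
  have Am: "A \<in> sets M" unfolding A_def using S(1) Z(1) by auto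
  have "prob A = prob {x \<in> space M - Bad. \<rho> (x0, x) < \<zeta>}"
    unfolding A_def by (rule measure_Diff_null_set[OF S(1) Z(1)])
  then have Apos: "0 < prob A" using S(2) by simp
  have "davg n d (x, x') \<le> \<delta>" if x: "x \<in> A" and x': "x' \<in> A" and n: "1 \<le> n" for x x' n
  proof -
    have hc: "h \<in> carrier G" if "h \<in> F n" for h using that folner_carrier[OF n] by auto
    have A: "y \<in> space M" "\<rho> (x0, y) < \<zeta>" "avg n \<theta> y \<le> \<delta> / 4"
      "\<And>g. g \<in> carrier G \<Longrightarrow> (\<integral>w. k (\<psi> g y, w) \<partial>M) = N"
      "\<And>g. g \<in> carrier G \<Longrightarrow> \<rho> (\<psi> g x0, \<psi> g y) = \<rho> (x0, y)" if "y \<in> A" for y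
      using that n Z(2) unfolding A_def Bad_def by (blast, blast, force, blast, blast)
    have pt: "d (\<psi> h x, \<psi> h x') \<le> \<theta> (\<psi> h x) + \<theta> (\<psi> h x') + \<delta> / 2" if h: "h \<in> F n" for h
    proof -
      note h' = hc[OF h]
      have sp: "\<psi> h y \<in> space M" if "y \<in> A" for y
        using measurable_space[OF action_measurable[OF h'] A(1)[OF that]] .
      have "\<rho> (\<psi> h x, \<psi> h x') \<le> \<rho> (x0, x) + \<rho> (x0, x')"
        using \<rho>tri[of "\<psi> h x" "\<psi> h x'" "\<psi> h x0"] A(5)[OF x h'] A(5)[OF x' h']
        by (simp add: \<rho>sym[of "\<psi> h x" "\<psi> h x0"])
      also have "\<dots> \<le> 2 * \<zeta>" using A(2)[OF x] A(2)[OF x'] by simp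
      finally have "B / N * \<rho> (\<psi> h x, \<psi> h x') \<le> B / N * (2 * \<zeta>)"
        using B0 N(1) by (intro mult_left_mono) auto
      also have "\<dots> = \<delta> / 2 * (B / (B + 1))" using N(1) B0 by (simp add: \<zeta>_def divide_simps)
      also have "\<dots> \<le> \<delta> / 2 * 1" using B0 \<delta> by (intro mult_left_mono) auto
      finally show ?thesis
        using key[OF sp[OF x] A(4)[OF x h'] sp[OF x']] by linarith
    qed
    have "davg n d (x, x') \<le> (\<Sum>h\<in>F n. \<theta> (\<psi> h x) + \<theta> (\<psi> h x') + \<delta> / 2) / card (F n)"
      unfolding davg_def diag_action_def fst_conv snd_conv
      by (intro divide_right_mono sum_mono pt) auto
    also have "\<dots> = avg n \<theta> x + avg n \<theta> x' + \<delta> / 2"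
      using folner_card_pos[OF n] by (simp add: avg_def sum.distrib add_divide_distrib)
    also have "\<dots> \<le> \<delta>" using A(3)[OF x] A(3)[OF x'] by simp
    finally show ?thesis .
  qed
  then show ?thesis using Am Apos by (intro bexI[of _ A]) auto
qed

end

section \<open>Sets visiting several neighbourhoods simultaneously\<close>

context ergodic_folner_action begin

lemma kronecker_conditional_expectation:
  assumes Um [measurable]: "U \<in> sets M"
  shows "\<exists>h::'a \<Rightarrow> real. h \<in> borel_measurable kronecker_algebra \<and> (\<forall>x. 0 \<le> h x \<and> h x \<le> 1) \<and>
    (\<forall>u b. u \<in> borel_measurable kronecker_algebra \<longrightarrow> (\<forall>x. \<bar>u x\<bar> \<le> b) \<longrightarrow>
       (\<integral>x. (indicator U x - h x) * u x \<partial>M) = 0)"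
proof -
  interpret S: finite_measure_subalgebra M kronecker_algebra
    by unfold_locales (rule subalgebra_kronecker)
  define c where "c = real_cond_exp M kronecker_algebra (indicator U)"
  have cm: "c \<in> borel_measurable kronecker_algebra" unfolding c_def by measurable
  \<comment> \<open>The conditional expectation respects the bounds 0 and 1 only almost everywhere;
    truncation enforces them at every point and keeps Kronecker measurability.\<close>
  define h where "h x = max 0 (min 1 (c x))" for x
  have hm: "h \<in> borel_measurable kronecker_algebra" unfolding h_def using cm by measurable
  have hM [measurable]: "h \<in> borel_measurable M" and cM [measurable]: "c \<in> borel_measurable M"
    using measurable_from_subalg[OF subalgebra_kronecker] hm cm by auto
  have i: "integrable M (indicator U :: 'a \<Rightarrow> real)" by (rule integrable_indicator_event[OF Um])
  have "AE x in M. 0 \<le> c x" "AE x in M. c x \<le> 1"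
    unfolding c_def using i by (intro S.real_cond_exp_ge_c S.real_cond_exp_le_c; auto simp: indicator_def)+
  then have hc: "AE x in M. h x = c x" by eventually_elim (simp add: h_def)
  have "(\<integral>x. (indicator U x - h x) * u x \<partial>M) = 0"
    if um: "u \<in> borel_measurable kronecker_algebra" and ub: "\<And>x. \<bar>u x\<bar> \<le> b" for u b
  proof -
    have uM [measurable]: "u \<in> borel_measurable M"
      by (rule measurable_from_subalg[OF subalgebra_kronecker um])
    have b0: "0 \<le> b" by (rule order_trans[OF abs_ge_zero ub[of undefined]])
    have iu: "integrable M (\<lambda>x. u x * indicator U x)"
    proof (rule integrable_bounded)
      show "\<bar>u x * indicator U x\<bar> \<le> b" for x using ub[of x] b0 by (auto simp: indicator_def)
    qed measurable
    have ih: "integrable M (\<lambda>x. u x * h x)"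
    proof (rule integrable_bounded)
      show "\<bar>u x * h x\<bar> \<le> b * 1" for x
        unfolding abs_mult by (intro mult_mono ub b0) (auto simp: h_def)
    qed measurable
    have "(\<integral>x. u x * h x \<partial>M) = (\<integral>x. u x * c x \<partial>M)"
    proof (rule integral_cong_AE)
      show "AE x in M. u x * h x = u x * c x" using hc by eventually_elim simp
    qed measurable
    also have "\<dots> = (\<integral>x. u x * indicator U x \<partial>M)"
      unfolding c_def by (rule S.real_cond_exp_intg(2)[OF iu um]) measurable
    finally have "(\<integral>x. u x * indicator U x - u x * h x \<partial>M) = 0" using iu ih by simp
    then show ?thesis by (simp add: algebra_simps)
  qed
  moreover have "0 \<le> h x \<and> h x \<le> 1" for x by (simp add: h_def)
  ultimately show ?thesis using hm by (intro exI[of _ h]) auto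
qed

text \<open>Cauchy-Schwarz over \<open>F n\<close>; it converts the quadratic form of
  \<open>weakly_mixing\<close> into the linear form needed for differences of products.\<close>

lemma avg_abs_tendsto_zero:
  assumes "(\<lambda>n. (\<Sum>h\<in>F n. (c h)\<^sup>2) / card (F n)) \<longlonglongrightarrow> (0 :: real)"
  shows "(\<lambda>n. (\<Sum>h\<in>F n. \<bar>c h\<bar>) / card (F n)) \<longlonglongrightarrow> 0"
proof (rule tendsto_sandwich[OF _ _ tendsto_const])
  show "\<forall>\<^sub>F n in sequentially. 0 \<le> (\<Sum>h\<in>F n. \<bar>c h\<bar>) / card (F n)"
    by (intro always_eventually allI divide_nonneg_nonneg sum_nonneg) auto
  have "(\<Sum>h\<in>F n. \<bar>c h\<bar>) / card (F n) \<le> sqrt ((\<Sum>h\<in>F n. (c h)\<^sup>2) / card (F n))" for n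
  proof (rule real_le_rsqrt)
    have "((\<Sum>h\<in>F n. \<bar>c h\<bar>) / card (F n))\<^sup>2 \<le> (\<Sum>h\<in>F n. \<bar>c h\<bar>\<^sup>2) * card (F n) / (real (card (F n)))\<^sup>2"
      unfolding power_divide by (intro divide_right_mono sum_squared_le_sum_of_squares) auto
    then show "((\<Sum>h\<in>F n. \<bar>c h\<bar>) / card (F n))\<^sup>2 \<le> (\<Sum>h\<in>F n. (c h)\<^sup>2) / card (F n)"
      by (cases "card (F n) = 0") (simp_all add: power2_eq_square)
  qed
  then show "\<forall>\<^sub>F n in sequentially. (\<Sum>h\<in>F n. \<bar>c h\<bar>) / card (F n) \<le> sqrt ((\<Sum>h\<in>F n. (c h)\<^sup>2) / card (F n))"
    by simp
  show "(\<lambda>n. sqrt ((\<Sum>h\<in>F n. (c h)\<^sup>2) / card (F n))) \<longlonglongrightarrow> 0"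
    using tendsto_real_sqrt[OF assms] by simp
qed

lemma abs_set_integral_le_one:
  assumes m: "m = prob A" "0 < m" and Am [measurable]: "A \<in> sets M"
    and q [measurable]: "q \<in> borel_measurable M" and q01: "\<And>x. 0 \<le> q x \<and> q x \<le> 1"
  shows "0 \<le> (\<integral>x. indicator A x * q x \<partial>M) / m" "(\<integral>x. indicator A x * q x \<partial>M) / m \<le> 1"
    "integrable M (\<lambda>x. indicator A x * q x :: real)"
proof -
  show i: "integrable M (\<lambda>x. indicator A x * q x)"
  proof (rule integrable_bounded)
    show "\<bar>indicator A x * q x\<bar> \<le> 1" for x using q01[of x] by (auto simp: indicator_def)
  qed measurable
  show "0 \<le> (\<integral>x. indicator A x * q x \<partial>M) / m"
    using m(2) q01 by (intro divide_nonneg_nonneg integral_nonneg_AE) auto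
  have "(\<integral>x. indicator A x * q x \<partial>M) \<le> (\<integral>x. indicator A x \<partial>M)"
  proof (rule integral_mono[OF i integrable_indicator_event[OF Am]])
    show "indicator A x * q x \<le> indicator A x" for x using q01[of x] by (simp add: indicator_def)
  qed
  then show "(\<integral>x. indicator A x * q x \<partial>M) / m \<le> 1" using m by simp
qed

text \<open>On a set \<open>A'\<close> of small diameter the projections \<open>h i\<close> to the Kronecker algebra are nearly constant
  along orbits, so averages of products of integrals over \<open>A'\<close> are close to averages of integrals of the
  product of the \<open>h i\<close>; the orthogonal parts do not contribute by \<open>weakly_mixing\<close>.\<close>

lemma correlated_visits:
  fixes h :: "'i \<Rightarrow> 'a \<Rightarrow> real" and U :: "'i \<Rightarrow> 'a set"
  assumes I: "finite I" and Um: "\<And>i. i \<in> I \<Longrightarrow> U i \<in> sets M"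
    and hm: "\<And>i. i \<in> I \<Longrightarrow> h i \<in> borel_measurable kronecker_algebra"
    and h01: "\<And>i x. i \<in> I \<Longrightarrow> 0 \<le> h i x \<and> h i x \<le> 1"
    and orth: "\<And>i u b. i \<in> I \<Longrightarrow> u \<in> borel_measurable kronecker_algebra \<Longrightarrow> (\<And>x. \<bar>u x\<bar> \<le> b) \<Longrightarrow>
       (\<integral>x. (indicator (U i) x - h i x) * u x \<partial>M) = 0"
    and l: "l = (\<integral>x. (\<Prod>i\<in>I. h i x) \<partial>M)" "0 < l"
    and A: "A \<in> sets M" "0 < prob A"
  shows "\<exists>A'\<in>sets M. A' \<subseteq> A \<and> 0 < prob A' \<and> (\<forall>\<^sub>F n in sequentially.
      l / 2 < (\<Sum>g\<in>F n. \<Prod>i\<in>I. (\<integral>x. indicator A' x * indicator (U i) (\<psi> g x) \<partial>M) / prob A') / card (F n))"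
proof -
  interpret D: folner_action G MM diag_action F by (rule folner_action_diag)
  have avg_eq: "D.avg n q = davg n q" for n q by (simp add: D.avg_def davg_def fun_eq_iff)
  have hM: "h i \<in> borel_measurable M" if "i \<in> I" for i
    by (rule measurable_from_subalg[OF subalgebra_kronecker hm[OF that]])
  have ap: "almost_periodic (h i)" if "i \<in> I" for i
    using hm[OF that] h01[OF that] by (intro kronecker_measurable_almost_periodic) auto
  define d where "d = variation I h"
  have dm [measurable]: "d \<in> borel_measurable MM" unfolding d_def by (rule variation_measurable[OF hM])
  have d0: "0 \<le> d z" and dB: "d z \<le> card I" for z
    unfolding d_def using h01 by (simp_all add: variation_nonneg variation_le)
  have dabs: "\<bar>d z\<bar> \<le> card I" for z using d0[of z] dB[of z] by simp
  have "\<exists>\<rho>. kronecker_metric d \<rho> (card I)"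
    unfolding d_def using ap h01 hM by (intro kronecker_metric_exists[OF I]) auto
  then obtain \<rho> where km: "kronecker_metric d \<rho> (card I)" by blast
  have \<rho>m [measurable]: "\<rho> \<in> borel_measurable MM" and \<rho>0: "\<And>z. 0 \<le> \<rho> z" and \<rho>B: "\<And>z. \<rho> z \<le> card I"
    and \<rho>sym: "\<And>x y. \<rho> (x, y) = \<rho> (y, x)" and \<rho>tri: "\<And>x y z. \<rho> (x, z) \<le> \<rho> (x, y) + \<rho> (y, z)"
    and dlim: "(\<lambda>n. L1_dist MM (davg n d) \<rho>) \<longlonglongrightarrow> 0"
    using km unfolding kronecker_metric_def by blast+
  \<comment> \<open>Two points within \<open>l / 8\<close> of the centre are at distance at most
    \<open>l / 4\<close>, which leaves \<open>3 * l / 4\<close> in the limit, above the required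
    \<open>l / 2\<close>.\<close>
  have "0 < l / 8" using l by simp
  from kronecker_metric_small_sets[OF km this A, of "\<lambda>_. True"] obtain x0 where x0: "x0 \<in> space M"
    and S: "{x\<in>A. \<rho> (x0, x) < l / 8} \<in> sets M" "0 < prob {x\<in>A. \<rho> (x0, x) < l / 8}" by auto
  define A' where "A' = {x\<in>A. \<rho> (x0, x) < l / 8}"
  have A'm [measurable]: "A' \<in> sets M" and A'pos: "0 < prob A'" and A'A: "A' \<subseteq> A"
    using S by (auto simp: A'_def)
  define m where "m = prob A'"
  have m: "0 < m" using A'pos by (simp add: m_def)
  \<comment> \<open>\<open>a\<close> and \<open>b\<close> are the means over \<open>A'\<close> of
    the translated projection and of the translated indicator; \<open>c\<close> is the unnormalized
    contribution of the orthogonal part, so that \<open>b i g - a i g = c i g / m\<close>.\<close>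
  define a where "a i g = (\<integral>x. indicator A' x * h i (\<psi> g x) \<partial>M) / m" for i g
  define b where "b i g = (\<integral>x. indicator A' x * indicator (U i) (\<psi> g x) \<partial>M) / m" for i g
  define c where "c i g = (\<integral>x. indicator A' x * (indicator (U i) (\<psi> g x) - h i (\<psi> g x)) \<partial>M)" for i g
  have hg: "(\<lambda>x. h i (\<psi> g x)) \<in> borel_measurable M" and Ug: "(\<lambda>x. indicator (U i) (\<psi> g x) :: real) \<in> borel_measurable M"
    if "i \<in> I" "g \<in> carrier G" for i g
    using measurable_action_comp[OF hM[OF that(1)] that(2)]
      measurable_action_comp[OF borel_measurable_indicator[OF Um[OF that(1)]] that(2)] by auto
  have a01: "0 \<le> a i g" "a i g \<le> 1" "integrable M (\<lambda>x. indicator A' x * h i (\<psi> g x))"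
    if "i \<in> I" "g \<in> carrier G" for i g
    using abs_set_integral_le_one[OF m_def m A'm hg[OF that]] h01[OF that(1)] by (auto simp: a_def)
  have b01: "0 \<le> b i g" "b i g \<le> 1" "integrable M (\<lambda>x. indicator A' x * indicator (U i) (\<psi> g x) :: real)"
    if "i \<in> I" "g \<in> carrier G" for i g
    using abs_set_integral_le_one[OF m_def m A'm Ug[OF that]] by (auto simp: b_def indicator_def)
  have bac: "b i g - a i g = c i g / m" if "i \<in> I" "g \<in> carrier G" for i g
    using a01(3)[OF that] b01(3)[OF that]
    by (simp add: a_def b_def c_def right_diff_distrib diff_divide_distrib)
  define E1 where "E1 n = (\<Sum>i\<in>I. (\<Sum>g\<in>F n. \<bar>c i g\<bar>) / card (F n))" for n
  have "(\<lambda>n. (\<Sum>g\<in>F n. \<bar>c i g\<bar>) / card (F n)) \<longlonglongrightarrow> 0" if i: "i \<in> I" for i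
  proof (rule avg_abs_tendsto_zero)
    have "(\<lambda>x. indicator (U i) x - h i x) \<in> borel_measurable M"
      using Um[OF i] hM[OF i] by measurable
    then show "(\<lambda>n. (\<Sum>g\<in>F n. (c i g)\<^sup>2) / card (F n)) \<longlonglongrightarrow> 0"
      unfolding c_def
    proof (rule weakly_mixing[where B = 1])
      show "\<bar>indicator (U i) x - h i x\<bar> \<le> 1" for x using h01[OF i, of x] by (auto simp: indicator_def)
    qed (use orth[OF i] in auto)
  qed
  then have E1: "E1 \<longlonglongrightarrow> (\<Sum>i\<in>I. 0)" unfolding E1_def by (intro tendsto_sum)
  define H where "H x = (\<Prod>i\<in>I. h i x)" for x
  have Hm [measurable]: "H \<in> borel_measurable M" unfolding H_def using hM by measurable
  have H01: "0 \<le> H x \<and> H x \<le> 1" for x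
    unfolding H_def using h01 by (auto intro: prod_nonneg prod_le_1)
  have HB: "\<bar>H x\<bar> \<le> 1" for x using H01[of x] by simp
  obtain r p where R: "(\<forall>j. 1 \<le> r j) \<and> (\<forall>x. p x = real_limsup (\<lambda>j. avg (r j) H x)) \<and>
    p \<in> borel_measurable M \<and> (\<forall>x. \<bar>p x\<bar> \<le> 1) \<and> (\<lambda>n. L1_dist M (avg n H) p) \<longlonglongrightarrow> 0 \<and>
    (\<forall>g\<in>carrier G. AE x in M. p (\<psi> g x) = p x)"
    using mean_ergodic[OF Hm HB] by (elim exE) (rule that)
  have pm [measurable]: "p \<in> borel_measurable M" and pB: "\<And>x. \<bar>p x\<bar> \<le> 1"
    and plim: "(\<lambda>n. L1_dist M (avg n H) p) \<longlonglongrightarrow> 0"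
    and pinv: "\<And>g. g \<in> carrier G \<Longrightarrow> AE x in M. p (\<psi> g x) = p x"
    using R by blast+
  have Hi: "integrable M H" and pi: "integrable M p"
    using integrable_bounded[OF Hm HB] integrable_bounded[OF pm pB] by auto
  have avgHi: "integrable M (avg n H)" if "1 \<le> n" for n
    using borel_measurable_avg[OF that Hm] abs_avg_le[OF HB] by (rule integrable_bounded)
  \<comment> \<open>Averaging preserves the integral, so the limit has mean \<open>l\<close>;
    ergodicity then makes it the constant \<open>l\<close>.\<close>
  have pl: "expectation p = l"
  proof -
    have "\<bar>l - expectation p\<bar> \<le> L1_dist M (avg n H) p" if n: "1 \<le> n" for n
    proof -
      have "l - expectation p = (\<integral>x. avg n H x - p x \<partial>M)"
        using integral_avg[OF n Hi] avgHi[OF n] pi by (simp add: l(1) H_def[abs_def])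
      then show ?thesis using integral_abs_bound[of M "\<lambda>x. avg n H x - p x"] by (simp add: L1_dist_def)
    qed
    then have "\<bar>l - expectation p\<bar> \<le> 0" by (intro LIMSEQ_le_const[OF plim]) auto
    then show ?thesis by simp
  qed
  have pAE: "AE x in M. p x = l" using ergodic_const[OF pm pB pinv] pl by simp
  have HA: "m * l - L1_dist M (avg n H) p \<le> (\<integral>x. indicator A' x * avg n H x \<partial>M)" if n: "1 \<le> n" for n
  proof -
    have i1: "integrable M (\<lambda>x. indicator A' x * avg n H x)" "integrable M (\<lambda>x. indicator A' x * p x)"
      using integrable_real_mult_indicator[OF A'm avgHi[OF n]] integrable_real_mult_indicator[OF A'm pi]
      by (simp_all add: mult.commute)
    have "m * l = (\<integral>x. indicator A' x * l \<partial>M)" by (simp add: m_def)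
    also have "\<dots> = (\<integral>x. indicator A' x * p x \<partial>M)"
    proof (rule integral_cong_AE)
      show "AE x in M. indicator A' x * l = indicator A' x * p x" using pAE by eventually_elim simp
    qed measurable
    also have "\<dots> \<le> (\<integral>x. indicator A' x * avg n H x + \<bar>avg n H x - p x\<bar> \<partial>M)"
      using i1 avgHi[OF n] pi by (intro integral_mono) (auto simp: indicator_def)
    also have "\<dots> = (\<integral>x. indicator A' x * avg n H x \<partial>M) + L1_dist M (avg n H) p"
      using i1 avgHi[OF n] pi by (simp add: L1_dist_def)
    finally show ?thesis by simp
  qed
  \<comment> \<open>Integrals against \<open>J\<close> measure how far apart the orbits of two
    points of \<open>A'\<close> are on average.\<close>
  define J :: "'a \<times> 'a \<Rightarrow> real" where "J z = indicator A' (fst z) * indicator A' (snd z)" for z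
  have Jm [measurable]: "J \<in> borel_measurable MM" unfolding J_def by measurable
  have J01: "0 \<le> J z" "J z \<le> 1" for z by (auto simp: J_def indicator_def)
  have Jint: "integrable MM (\<lambda>z. J z * q z)" if "q \<in> borel_measurable MM" "\<And>z. \<bar>q z\<bar> \<le> card I" for q :: "'a \<times> 'a \<Rightarrow> real"
  proof (rule D.integrable_bounded)
    show "(\<lambda>z. J z * q z) \<in> borel_measurable MM" using Jm that(1) by (rule borel_measurable_times)
    show "\<bar>J z * q z\<bar> \<le> 1 * real (card I)" for z
      unfolding abs_mult using J01[of z] by (intro mult_mono that(2)) auto
  qed
  have dAm: "davg n d \<in> borel_measurable MM" if "1 \<le> n" for n
    using D.borel_measurable_avg[OF that dm] by (simp add: avg_eq)
  have dAB: "\<bar>davg n d z\<bar> \<le> card I" for n z using D.abs_avg_le[of d "card I" n z, OF dabs] by (simp add: avg_eq)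
  have \<rho>abs: "\<bar>\<rho> z\<bar> \<le> card I" for z using \<rho>0[of z] \<rho>B[of z] by simp
  have JJ: "integral\<^sup>L MM J = m * m"
  proof -
    have "integral\<^sup>L MM J = (\<integral>x. (\<integral>y. J (x, y) \<partial>M) \<partial>M)"
      by (rule integral_pair(2)[OF Jm, of 1]) (use J01 in auto)
    then show ?thesis by (simp add: J_def m_def)
  qed
  have Ji: "integrable MM J" by (rule D.integrable_bounded[OF Jm, of 1]) (use J01 in auto)
  have dA: "(\<integral>z. J z * davg n d z \<partial>MM) \<le> l / 4 * (m * m) + L1_dist MM (davg n d) \<rho>" if n: "1 \<le> n" for n
  proof -
    have ai: "integrable MM (davg n d)" using dAm[OF n] dAB by (rule D.integrable_bounded)
    have \<rho>i: "integrable MM \<rho>" using \<rho>m \<rho>abs by (rule D.integrable_bounded)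
    have "(\<integral>z. J z * davg n d z \<partial>MM) \<le> (\<integral>z. l / 4 * J z + \<bar>davg n d z - \<rho> z\<bar> \<partial>MM)"
    proof (rule integral_mono)
      fix z
      show "J z * davg n d z \<le> l / 4 * J z + \<bar>davg n d z - \<rho> z\<bar>"
      proof (cases "fst z \<in> A' \<and> snd z \<in> A'")
        case True
        then have "\<rho> (x0, fst z) < l / 8" "\<rho> (x0, snd z) < l / 8" by (auto simp: A'_def)
        then have "\<rho> z \<le> l / 4" using \<rho>tri[of "fst z" "snd z" x0] \<rho>sym[of "fst z" x0] by simp
        then show ?thesis using True by (simp add: J_def)
      qed (auto simp: J_def indicator_def)
    qed (use Jint[OF dAm[OF n] dAB] ai \<rho>i Ji in auto)
    also have "\<dots> = l / 4 * (m * m) + L1_dist MM (davg n d) \<rho>"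
      using ai \<rho>i Ji JJ by (simp add: L1_dist_def)
    finally show ?thesis .
  qed
  \<comment> \<open>All factors lie in the unit interval, so the product of the \<open>h i\<close>
    at a translated point differs from the product of their means over \<open>A'\<close> by at most
    the sum of the single differences. Averaging over the point gives the integral of
    \<open>d\<close> over pairs in \<open>A'\<close>.\<close>
  have pointwise: "(\<integral>x. indicator A' x * H (\<psi> g x) \<partial>M) / m - (\<Prod>i\<in>I. a i g)
      \<le> (\<integral>z. J z * d (diag_action g z) \<partial>MM) / (m * m)" if g: "g \<in> carrier G" for g
  proof -
    note dgm [measurable] = D.measurable_action_comp[OF dm g]
    define q where "q x = (\<integral>y. indicator A' y * d (\<psi> g x, \<psi> g y) \<partial>M) / m" for x
    have qz: "\<bar>indicator A' (snd z) * d (diag_action g z)\<bar> \<le> card I" for z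
      using dabs[of "diag_action g z"] by (auto simp: indicator_def)
    have qzm: "(\<lambda>z. indicator A' (snd z) * d (diag_action g z)) \<in> borel_measurable MM" by measurable
    have qm [measurable]: "q \<in> borel_measurable M"
      using integral_pair(3)[OF qzm qz] unfolding q_def[abs_def] by (simp add: diag_action_def)
    have qB: "\<bar>q x\<bar> \<le> card I / m" for x
      using integral_pair(4)[OF qzm qz, of x] m by (simp add: q_def diag_action_def abs_divide divide_right_mono)
    have est: "H (\<psi> g x) - (\<Prod>i\<in>I. a i g) \<le> q x" if x: "x \<in> space M" for x
    proof -
      have "H (\<psi> g x) - (\<Prod>i\<in>I. a i g) \<le> norm ((\<Prod>i\<in>I. h i (\<psi> g x)) - (\<Prod>i\<in>I. a i g))"
        by (simp add: H_def)
      also have "\<dots> \<le> (\<Sum>i\<in>I. norm (h i (\<psi> g x) - a i g))"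
        using h01 a01(1,2)[OF _ g] by (intro norm_prod_diff) auto
      also have "\<dots> \<le> (\<Sum>i\<in>I. (\<integral>y. indicator A' y * \<bar>h i (\<psi> g x) - h i (\<psi> g y)\<bar> \<partial>M) / m)"
      proof (rule sum_mono)
        fix i assume i: "i \<in> I"
        have "m * (h i (\<psi> g x) - a i g) = (\<integral>y. indicator A' y * h i (\<psi> g x) - indicator A' y * h i (\<psi> g y) \<partial>M)"
          using a01(3)[OF i g] m integrable_indicator_event[OF A'm]
          by (simp add: a_def m_def[symmetric] right_diff_distrib)
        then have "m * \<bar>h i (\<psi> g x) - a i g\<bar> = \<bar>\<integral>y. indicator A' y * h i (\<psi> g x) - indicator A' y * h i (\<psi> g y) \<partial>M\<bar>"
          using m by (metis abs_mult abs_of_pos)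
        also have "\<dots> \<le> (\<integral>y. \<bar>indicator A' y * h i (\<psi> g x) - indicator A' y * h i (\<psi> g y)\<bar> \<partial>M)"
          by (rule integral_abs_bound)
        also have "\<dots> = (\<integral>y. indicator A' y * \<bar>h i (\<psi> g x) - h i (\<psi> g y)\<bar> \<partial>M)"
          by (intro Bochner_Integration.integral_cong refl) (simp add: indicator_def)
        finally show "norm (h i (\<psi> g x) - a i g) \<le> (\<integral>y. indicator A' y * \<bar>h i (\<psi> g x) - h i (\<psi> g y)\<bar> \<partial>M) / m"
          using m by (simp add: field_simps)
      qed
      also have "\<dots> = q x"
      proof -
        have "integrable M (\<lambda>y. indicator A' y * \<bar>h i (\<psi> g x) - h i (\<psi> g y)\<bar>)" if i: "i \<in> I" for i
        proof (rule integrable_bounded)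
          show "(\<lambda>y. indicator A' y * \<bar>h i (\<psi> g x) - h i (\<psi> g y)\<bar>) \<in> borel_measurable M"
            using hg[OF i g] by measurable
          show "\<bar>indicator A' y * \<bar>h i (\<psi> g x) - h i (\<psi> g y)\<bar>\<bar> \<le> 1" for y
            using h01[OF i, of "\<psi> g x"] h01[OF i, of "\<psi> g y"] by (auto simp: indicator_def abs_le_iff)
        qed
        then show ?thesis
          unfolding q_def d_def variation_def sum_divide_distrib[symmetric] fst_conv snd_conv sum_distrib_left
          by (subst Bochner_Integration.integral_sum) auto
      qed
      finally show ?thesis .
    qed
    have iH: "integrable M (\<lambda>x. indicator A' x * H (\<psi> g x))"
      by (rule abs_set_integral_le_one(3)[OF m_def m A'm measurable_action_comp[OF Hm g]]) (rule H01)
    have iq: "integrable M (\<lambda>x. indicator A' x * q x)"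
      using integrable_real_mult_indicator[OF A'm integrable_bounded[OF qm qB]] by (simp add: mult.commute)
    have "(\<integral>x. indicator A' x * H (\<psi> g x) \<partial>M) - m * (\<Prod>i\<in>I. a i g)
        = (\<integral>x. indicator A' x * H (\<psi> g x) - indicator A' x * (\<Prod>i\<in>I. a i g) \<partial>M)"
      using iH integrable_indicator_event[OF A'm] by (simp add: m_def)
    also have "\<dots> \<le> (\<integral>x. indicator A' x * q x \<partial>M)"
    proof (rule integral_mono)
      show "indicator A' x * H (\<psi> g x) - indicator A' x * (\<Prod>i\<in>I. a i g) \<le> indicator A' x * q x"
        if "x \<in> space M" for x
        using est[OF that] by (simp add: indicator_def)
    qed (use iH iq integrable_indicator_event[OF A'm] in auto)
    also have "\<dots> = (\<integral>z. J z * d (diag_action g z) \<partial>MM) / m"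
    proof -
      have Jd: "\<bar>J z * d (diag_action g z)\<bar> \<le> card I" for z
        using dabs[of "diag_action g z"] by (auto simp: J_def indicator_def)
      have "(\<integral>z. J z * d (diag_action g z) \<partial>MM) = (\<integral>x. (\<integral>y. J (x, y) * d (diag_action g (x, y)) \<partial>M) \<partial>M)"
        by (rule integral_pair(2)[OF _ Jd]) measurable
      also have "\<dots> = (\<integral>x. m * (indicator A' x * q x) \<partial>M)"
        using m by (simp add: J_def diag_action_def q_def mult.assoc)
      finally show ?thesis using m by simp
    qed
    finally have "((\<integral>x. indicator A' x * H (\<psi> g x) \<partial>M) - m * (\<Prod>i\<in>I. a i g)) / m
        \<le> (\<integral>z. J z * d (diag_action g z) \<partial>MM) / m / m"
      using m by (intro divide_right_mono) auto
    then show ?thesis using m by (simp add: diff_divide_distrib)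
  qed
  define T where "T n = (\<Sum>g\<in>F n. \<Prod>i\<in>I. b i g) / card (F n)" for n
  \<comment> \<open>The subtracted terms come from the convergence of the averages of
    \<open>H\<close>, from that of the averages of \<open>d\<close>, and from weak mixing; each
    tends to 0 for the fixed set \<open>A'\<close>.\<close>
  have lower: "3 * l / 4 - L1_dist M (avg n H) p / m - L1_dist MM (davg n d) \<rho> / (m * m) - E1 n / m \<le> T n"
    if n: "1 \<le> n" for n
  proof -
    have gc: "g \<in> carrier G" if "g \<in> F n" for g using that folner_carrier[OF n] by auto
    have cpos: "0 < card (F n)" by (rule folner_card_pos[OF n])
    have ba: "(\<Prod>i\<in>I. a i g) - (\<Sum>i\<in>I. \<bar>c i g\<bar>) / m \<le> (\<Prod>i\<in>I. b i g)" if g: "g \<in> F n" for g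
    proof -
      have "norm ((\<Prod>i\<in>I. b i g) - (\<Prod>i\<in>I. a i g)) \<le> (\<Sum>i\<in>I. norm (b i g - a i g))"
        using a01(1,2)[OF _ gc[OF g]] b01(1,2)[OF _ gc[OF g]] by (intro norm_prod_diff) auto
      also have "\<dots> = (\<Sum>i\<in>I. \<bar>c i g\<bar>) / m"
        using bac[OF _ gc[OF g]] m by (simp add: sum_divide_distrib abs_divide)
      finally show ?thesis by (simp add: abs_le_iff)
    qed
    have iH: "integrable M (\<lambda>x. indicator A' x * H (\<psi> g x))" if "g \<in> F n" for g
      by (rule abs_set_integral_le_one(3)[OF m_def m A'm measurable_action_comp[OF Hm gc[OF that]]]) (rule H01)
    have id: "integrable MM (\<lambda>z. J z * d (diag_action g z))" if "g \<in> F n" for g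
      using D.measurable_action_comp[OF dm gc[OF that]] dabs by (intro Jint) auto
    have s1: "(\<Sum>g\<in>F n. (\<integral>x. indicator A' x * H (\<psi> g x) \<partial>M)) / card (F n) = (\<integral>x. indicator A' x * avg n H x \<partial>M)"
    proof -
      have "(\<integral>x. indicator A' x * avg n H x \<partial>M) = (\<integral>x. (\<Sum>g\<in>F n. indicator A' x * H (\<psi> g x)) / card (F n) \<partial>M)"
        by (intro Bochner_Integration.integral_cong refl) (simp add: avg_def sum_distrib_left)
      then show ?thesis using iH by (simp add: Bochner_Integration.integral_sum)
    qed
    have s2: "(\<Sum>g\<in>F n. (\<integral>z. J z * d (diag_action g z) \<partial>MM)) / card (F n) = (\<integral>z. J z * davg n d z \<partial>MM)"
    proof -
      have "(\<integral>z. J z * davg n d z \<partial>MM) = (\<integral>z. (\<Sum>g\<in>F n. J z * d (diag_action g z)) / card (F n) \<partial>MM)"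
        by (intro Bochner_Integration.integral_cong refl) (simp add: davg_def sum_distrib_left)
      then show ?thesis using id by (simp add: Bochner_Integration.integral_sum)
    qed
    have s3: "(\<Sum>g\<in>F n. \<Sum>i\<in>I. \<bar>c i g\<bar>) / card (F n) = E1 n"
      unfolding E1_def sum_divide_distrib by (rule sum.swap)
    have "(\<Sum>g\<in>F n. (\<integral>x. indicator A' x * H (\<psi> g x) \<partial>M) / m - (\<integral>z. J z * d (diag_action g z) \<partial>MM) / (m * m)
          - (\<Sum>i\<in>I. \<bar>c i g\<bar>) / m) / card (F n) \<le> T n"
      unfolding T_def
    proof (intro divide_right_mono sum_mono)
      fix g assume g: "g \<in> F n"
      show "(\<integral>x. indicator A' x * H (\<psi> g x) \<partial>M) / m - (\<integral>z. J z * d (diag_action g z) \<partial>MM) / (m * m)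
          - (\<Sum>i\<in>I. \<bar>c i g\<bar>) / m \<le> (\<Prod>i\<in>I. b i g)"
        using pointwise[OF gc[OF g]] ba[OF g] by linarith
    qed auto
    also have "(\<Sum>g\<in>F n. (\<integral>x. indicator A' x * H (\<psi> g x) \<partial>M) / m - (\<integral>z. J z * d (diag_action g z) \<partial>MM) / (m * m)
          - (\<Sum>i\<in>I. \<bar>c i g\<bar>) / m) / card (F n)
        = (\<Sum>g\<in>F n. (\<integral>x. indicator A' x * H (\<psi> g x) \<partial>M)) / card (F n) / m
          - (\<Sum>g\<in>F n. (\<integral>z. J z * d (diag_action g z) \<partial>MM)) / card (F n) / (m * m)
          - (\<Sum>g\<in>F n. \<Sum>i\<in>I. \<bar>c i g\<bar>) / card (F n) / m"
      by (simp add: sum_subtractf diff_divide_distrib sum_divide_distrib[symmetric] mult.commute)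
    finally have main: "(\<integral>x. indicator A' x * avg n H x \<partial>M) / m - (\<integral>z. J z * davg n d z \<partial>MM) / (m * m) - E1 n / m \<le> T n"
      unfolding s1 s2 s3 .
    have "l - L1_dist M (avg n H) p / m = (m * l - L1_dist M (avg n H) p) / m"
      using m by (simp add: field_simps)
    also have "\<dots> \<le> (\<integral>x. indicator A' x * avg n H x \<partial>M) / m"
      using HA[OF n] m by (intro divide_right_mono) auto
    finally have 1: "l - L1_dist M (avg n H) p / m \<le> (\<integral>x. indicator A' x * avg n H x \<partial>M) / m" .
    have "(\<integral>z. J z * davg n d z \<partial>MM) / (m * m) \<le> (l / 4 * (m * m) + L1_dist MM (davg n d) \<rho>) / (m * m)"
      using dA[OF n] m by (intro divide_right_mono) auto
    also have "\<dots> = l / 4 + L1_dist MM (davg n d) \<rho> / (m * m)"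
      using m by (simp add: add_divide_distrib)
    finally show ?thesis using 1 main by linarith
  qed
  have "(\<lambda>n. 3 * l / 4 - L1_dist M (avg n H) p / m - L1_dist MM (davg n d) \<rho> / (m * m) - E1 n / m)
      \<longlonglongrightarrow> 3 * l / 4 - 0 / m - 0 / (m * m) - 0 / m"
    using E1 m by (intro tendsto_intros plim dlim) auto
  then have "\<forall>\<^sub>F n in sequentially. l / 2 < 3 * l / 4 - L1_dist M (avg n H) p / m - L1_dist MM (davg n d) \<rho> / (m * m) - E1 n / m"
    by (rule order_tendstoD(1)) (use l(2) in simp)
  then have "\<forall>\<^sub>F n in sequentially. l / 2 < T n"
    using eventually_ge_at_top[of 1] by eventually_elim (use lower in fastforce)
  then show ?thesis using A'm A'A A'pos unfolding T_def b_def m_def by (intro bexI[of _ A']) auto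
qed

text \<open>Probabilistic method: the \<open>y i\<close> are drawn independently from
  \<open>A\<close>, so a simultaneous visit at \<open>g\<close> has the product of the single
  probabilities. The expected visit frequency is eventually above \<open>c\<close>, and the reverse
  Fatou lemma excludes that all choices have limit superior at most \<open>c / 2\<close>.\<close>

lemma exists_frequent_visits:
  fixes U :: "'i \<Rightarrow> 'a set" and c :: real
  assumes I: "finite I" and Um: "\<And>i. i \<in> I \<Longrightarrow> U i \<in> sets M"
    and A [measurable]: "A \<in> sets M" and pos: "0 < prob A" and c: "0 < c"
    and ev: "\<forall>\<^sub>F n in sequentially.
      c < (\<Sum>g\<in>F n. \<Prod>i\<in>I. (\<integral>x. indicator A x * indicator (U i) (\<psi> g x) \<partial>M) / prob A) / card (F n)"
  shows "\<exists>y. (\<forall>i\<in>I. y i \<in> A) \<and>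
    ereal (c / 2) < limsup (\<lambda>n. ereal (real (card {g\<in>F n. \<forall>i\<in>I. \<psi> g (y i) \<in> U i}) / real (card (F n))))"
proof (rule ccontr)
  define hit where "hit n y = real (card {g\<in>F n. \<forall>i\<in>I. \<psi> g (y i) \<in> U i}) / real (card (F n))" for n y
  assume "\<not> ?thesis"
  then have neg: "limsup (\<lambda>n. ereal (hit n y)) \<le> ereal (c / 2)" if "\<forall>i\<in>I. y i \<in> A" for y
    using that by (auto simp: hit_def not_less)
  have ne: "emeasure M A \<noteq> 0" "emeasure M A \<noteq> \<infinity>" using pos by (auto simp: emeasure_eq_measure)
  define \<nu> where "\<nu> = uniform_measure M A"
  have \<nu>: "prob_space \<nu>" unfolding \<nu>_def by (rule prob_space_uniform_measure) (use ne in auto)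
  interpret N: product_prob_space "\<lambda>_. \<nu>" I
    by (intro product_prob_space.intro product_sigma_finite.intro product_prob_space_axioms.intro
        prob_space_imp_sigma_finite \<nu>)
  interpret N: finite_product_prob_space "\<lambda>_. \<nu>" I
    by standard (rule I)
  let ?P = "PiM I (\<lambda>_. \<nu>)"
  have sets\<nu>: "sets \<nu> = sets M" and space\<nu>: "space \<nu> = space M" by (simp_all add: \<nu>_def)
  have AEA: "AE y in ?P. \<forall>i\<in>I. y i \<in> A"
  proof (rule AE_finite_allI[OF I])
    fix i assume i: "i \<in> I"
    show "AE y in ?P. y i \<in> A"
    proof (rule AE_PiM_component[OF \<nu> i])
      show "AE x in \<nu>. x \<in> A" unfolding \<nu>_def by (rule AE_uniform_measureI) (use A in auto)
    qed
  qed
  define V where "V g = PiE I (\<lambda>i. \<psi> g -` U i \<inter> space M)" for g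
  have pre: "\<psi> g -` U i \<inter> space M \<in> sets M" if "g \<in> carrier G" "i \<in> I" for g i
    using measurable_sets[OF action_measurable[OF that(1)] Um[OF that(2)]] .
  have Vm: "V g \<in> sets ?P" if "g \<in> carrier G" for g
    unfolding V_def using pre[OF that] sets\<nu> by (intro sets_PiM_I_finite I) auto
  have Vprob: "measure ?P (V g) = (\<Prod>i\<in>I. (\<integral>x. indicator A x * indicator (U i) (\<psi> g x) \<partial>M) / prob A)"
    if g: "g \<in> carrier G" for g
  proof -
    have "measure ?P (V g) = (\<Prod>i\<in>I. measure \<nu> (\<psi> g -` U i \<inter> space M))"
      unfolding V_def using pre[OF g] sets\<nu> by (intro N.prob_times) auto
    also have "\<dots> = (\<Prod>i\<in>I. (\<integral>x. indicator A x * indicator (U i) (\<psi> g x) \<partial>M) / prob A)"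
    proof (rule prod.cong[OF refl])
      fix i assume i: "i \<in> I"
      have "measure \<nu> (\<psi> g -` U i \<inter> space M) = prob (A \<inter> (\<psi> g -` U i \<inter> space M)) / prob A"
        unfolding \<nu>_def using ne pre[OF g i] by (intro measure_uniform_measure) auto
      also have "prob (A \<inter> (\<psi> g -` U i \<inter> space M)) = (\<integral>x. indicator (A \<inter> (\<psi> g -` U i \<inter> space M)) x \<partial>M)"
        using pre[OF g i] by simp
      also have "\<dots> = (\<integral>x. indicator A x * indicator (U i) (\<psi> g x) \<partial>M)"
        by (intro Bochner_Integration.integral_cong) (auto simp: indicator_def)
      finally show "measure \<nu> (\<psi> g -` U i \<inter> space M)
          = (\<integral>x. indicator A x * indicator (U i) (\<psi> g x) \<partial>M) / prob A" .
    qed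
    finally show ?thesis .
  qed
  have hit_eq: "hit n y = (\<Sum>g\<in>F n. indicator (V g) y) / card (F n)"
    if n: "1 \<le> n" and y: "y \<in> space ?P" for n y
  proof -
    have "indicator (V g) y = (if \<forall>i\<in>I. \<psi> g (y i) \<in> U i then 1 else 0 :: real)" for g
      using y by (auto simp: V_def space_PiM space\<nu> indicator_def PiE_iff)
    then show ?thesis
      using folner_finite[OF n] by (simp add: hit_def sum.If_cases Int_def)
  qed
  have hit0: "0 \<le> hit n y" and hit1: "hit n y \<le> 1" for n y
  proof -
    show "0 \<le> hit n y" by (simp add: hit_def)
    show "hit n y \<le> 1"
    proof (cases "finite (F n)")
      case True
      then have "card {g\<in>F n. \<forall>i\<in>I. \<psi> g (y i) \<in> U i} \<le> card (F n)" by (intro card_mono) auto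
      then show ?thesis by (simp add: hit_def divide_le_eq)
    qed (simp add: hit_def)
  qed
  \<comment> \<open>The visit frequency at index \<open>Suc n\<close>, written with measurable
    boxes; the shift avoids \<open>F 0\<close>.\<close>
  define h where "h n y = (\<Sum>g\<in>F (Suc n). indicator (V g) y) / card (F (Suc n))" for n y
  have hm [measurable]: "h n \<in> borel_measurable ?P" for n
  proof -
    have "V g \<in> sets ?P" if "g \<in> F (Suc n)" for g using that folner_carrier[of "Suc n"] Vm by auto
    then show ?thesis unfolding h_def by (intro borel_measurable_divide borel_measurable_sum) auto
  qed
  have hb: "0 \<le> h n y" "y \<in> space ?P \<Longrightarrow> h n y \<le> 1" for n y
    using hit_eq[of "Suc n" y] hit1[of "Suc n" y] by (auto simp: h_def intro!: sum_nonneg divide_nonneg_nonneg)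
  have hint: "integrable ?P (h n)" for n
    by (rule N.integrable_const_bound[of _ 1]) (use hb in \<open>auto intro!: AE_I2\<close>)
  have h_int: "(\<integral>y. h n y \<partial>?P) = (\<Sum>g\<in>F (Suc n). \<Prod>i\<in>I. (\<integral>x. indicator A x * indicator (U i) (\<psi> g x) \<partial>M) / prob A) / card (F (Suc n))" for n
  proof -
    have gc: "g \<in> carrier G" if "g \<in> F (Suc n)" for g using that folner_carrier[of "Suc n"] by auto
    have i: "integrable ?P (indicator (V g) :: _ \<Rightarrow> real)" if "g \<in> F (Suc n)" for g
      using Vm[OF gc[OF that]] by (intro N.integrable_const_bound[of _ 1]) (auto simp: indicator_def)
    have "(\<integral>y. h n y \<partial>?P) = (\<Sum>g\<in>F (Suc n). measure ?P (V g)) / card (F (Suc n))"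
      unfolding h_def using i Vm[OF gc] by (simp add: Bochner_Integration.integral_sum)
    also have "\<dots> = (\<Sum>g\<in>F (Suc n). \<Prod>i\<in>I. (\<integral>x. indicator A x * indicator (U i) (\<psi> g x) \<partial>M) / prob A) / card (F (Suc n))"
      using Vprob[OF gc] by simp
    finally show ?thesis .
  qed
  \<comment> \<open>Reverse Fatou with dominating function 1. The value \<open>3 * c / 4\<close>
    lies strictly between the assumed bound \<open>c / 2\<close> and the eventual lower bound
    \<open>c\<close> of the means.\<close>
  have "limsup (\<lambda>n. \<integral>\<^sup>+y. ennreal (h n y) \<partial>?P) \<le> (\<integral>\<^sup>+y. limsup (\<lambda>n. ennreal (h n y)) \<partial>?P)"
    by (rule nn_integral_limsup[where w="\<lambda>_. 1"]) (use hb N.emeasure_space_1 in \<open>auto intro!: AE_I2\<close>)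
  also have "\<dots> \<le> (\<integral>\<^sup>+y. ennreal (3 * c / 4) \<partial>?P)"
  proof (rule nn_integral_mono_AE)
    show "AE y in ?P. limsup (\<lambda>n. ennreal (h n y)) \<le> ennreal (3 * c / 4)"
      using AEA AE_space
    proof eventually_elim
      case (elim y)
      have "limsup (\<lambda>n. ereal (hit n y)) < ereal (3 * c / 4)"
        using neg[OF elim(1)] c by (auto intro: le_less_trans)
      then have "\<forall>\<^sub>F n in sequentially. ereal (hit n y) < ereal (3 * c / 4)"
        by (rule Limsup_lessD)
      then have "\<forall>\<^sub>F n in sequentially. ereal (hit (Suc n) y) < ereal (3 * c / 4)"
        by (rule eventually_sequentially_Suc[THEN iffD2])
      then have "\<forall>\<^sub>F n in sequentially. ennreal (h n y) \<le> ennreal (3 * c / 4)"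
        by eventually_elim (use hit_eq[OF _ elim(2)] in \<open>auto simp: h_def intro!: ennreal_leI\<close>)
      then show ?case by (rule Limsup_bounded)
    qed
  qed
  also have "\<dots> = ennreal (3 * c / 4)" using N.emeasure_space_1 by simp
  finally have up: "limsup (\<lambda>n. \<integral>\<^sup>+y. ennreal (h n y) \<partial>?P) \<le> ennreal (3 * c / 4)" .
  have "\<forall>\<^sub>F n in sequentially. c < (\<Sum>g\<in>F (Suc n). \<Prod>i\<in>I. (\<integral>x. indicator A x * indicator (U i) (\<psi> g x) \<partial>M) / prob A) / card (F (Suc n))"
    by (rule eventually_sequentially_Suc[THEN iffD2]) (rule ev)
  then have "\<forall>\<^sub>F n in sequentially. ennreal c \<le> (\<integral>\<^sup>+y. ennreal (h n y) \<partial>?P)"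
  proof eventually_elim
    case (elim n)
    have "(\<integral>\<^sup>+y. ennreal (h n y) \<partial>?P) = ennreal (\<integral>y. h n y \<partial>?P)"
      by (rule nn_integral_eq_integral[OF hint]) (use hb in auto)
    then show ?case using elim by (simp add: h_int ennreal_leI)
  qed
  then have "ennreal c \<le> limsup (\<lambda>n. \<integral>\<^sup>+y. ennreal (h n y) \<partial>?P)"
    by (intro le_Limsup) auto
  with up have "ennreal c \<le> ennreal (3 * c / 4)" by (rule order_trans[rotated])
  then show False using c by (simp add: ennreal_le_iff)
qed

text \<open>If the product has integral zero, almost every point is a zero of some
  \<open>h i\<close>. Testing orthogonality with the indicator of the zero set \<open>A i\<close>
  shows that \<open>U i\<close> meets it in a null set; removing this null set stays among the
  Kronecker events and makes the atoms miss \<open>U i\<close> exactly, which is what a statement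
  about closures requires.\<close>

lemma kronecker_partition:
  fixes h :: "nat \<Rightarrow> 'a \<Rightarrow> real"
  assumes Um: "\<And>i. i \<in> {1..K} \<Longrightarrow> U i \<in> sets M"
    and hm: "\<And>i. i \<in> {1..K} \<Longrightarrow> h i \<in> borel_measurable kronecker_algebra"
    and h01: "\<And>i x. i \<in> {1..K} \<Longrightarrow> 0 \<le> h i x \<and> h i x \<le> 1"
    and orth: "\<And>i u b. i \<in> {1..K} \<Longrightarrow> u \<in> borel_measurable kronecker_algebra \<Longrightarrow> (\<And>x. \<bar>u x\<bar> \<le> b) \<Longrightarrow>
       (\<integral>x. (indicator (U i) x - h i x) * u x \<partial>M) = 0"
    and zero: "(\<integral>x. (\<Prod>i=1..K. h i x) \<partial>M) = 0"
  shows "\<exists>\<alpha>. finite \<alpha> \<and> \<alpha> \<subseteq> kronecker_events \<and> disjoint \<alpha> \<and> prob (\<Union>\<alpha>) = 1 \<and>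
     (\<forall>B\<in>\<alpha>. \<exists>k\<in>{1..K}. B \<inter> U k = {})"
proof -
  interpret S: sigma_algebra "space M" kronecker_events by (rule sigma_algebra_kronecker)
  define A where "A i = {x\<in>space M. h i x = 0}" for i
  have Ak: "A i \<in> kronecker_events" if "i \<in> {1..K}" for i
  proof -
    note [measurable] = hm[OF that]
    have "{x\<in>space kronecker_algebra. h i x = 0} \<in> sets kronecker_algebra" by measurable
    then show ?thesis by (simp add: A_def sets_kronecker)
  qed
  have Am: "A i \<in> sets M" if "i \<in> {1..K}" for i using Ak[OF that] by (auto simp: kronecker_events_def)
  have hM: "h i \<in> borel_measurable M" if "i \<in> {1..K}" for i
    by (rule measurable_from_subalg[OF subalgebra_kronecker hm[OF that]])
  have null: "AE x in M. x \<in> A i \<longleftrightarrow> x \<in> A i - U i" if i: "i \<in> {1..K}" for i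
  proof -
    have ai: "A i \<in> sets kronecker_algebra" using Ak[OF i] by (simp add: sets_kronecker)
    have "(\<integral>x. (indicator (U i) x - h i x) * indicator (A i) x \<partial>M) = 0"
      by (rule orth[OF i, of _ 1]) (use ai in \<open>auto simp: indicator_def\<close>)
    also have "(\<integral>x. (indicator (U i) x - h i x) * indicator (A i) x \<partial>M) = (\<integral>x. indicator (A i \<inter> U i) x \<partial>M)"
      by (intro Bochner_Integration.integral_cong) (auto simp: A_def indicator_def)
    finally have "prob (A i \<inter> U i) = 0" using Am[OF i] Um[OF i] by simp
    then have "AE x in M. x \<notin> A i \<inter> U i" using prob_eq_0[of "A i \<inter> U i"] Am[OF i] Um[OF i] by auto
    then show ?thesis by eventually_elim auto
  qed
  \<comment> \<open>Empty outside \<open>{1..K}\<close>, in particular at 0, so that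
    \<open>disjointed\<close> may run over all natural numbers.\<close>
  define V where "V i = (if i \<in> {1..K} then A i - U i else {})" for i
  have Vk: "V i \<in> kronecker_events" for i
  proof (cases "i \<in> {1..K}")
    case True
    then have "A i - U i \<in> kronecker_events"
      using Um Am by (intro kronecker_AE_cong[OF Ak[OF True] _ null[OF True]]) auto
    then show ?thesis using True by (simp add: V_def)
  next
    case False
    then have "V i = {}" unfolding V_def by (rule if_not_P)
    then show ?thesis by simp
  qed
  define \<alpha> where "\<alpha> = disjointed V ` {1..K}"
  have dk: "disjointed V i \<in> kronecker_events" for i
    unfolding disjointed_def using Vk by (intro S.Diff S.finite_UN) auto
  have "disjoint \<alpha>"
    unfolding \<alpha>_def by (rule disjoint_family_on_disjoint_image)
      (use disjoint_family_disjointed[of V] in \<open>auto simp: disjoint_family_on_def\<close>)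
  moreover have U: "\<Union>\<alpha> = (\<Union>i\<in>{1..K}. V i)"
  proof
    show "\<Union>\<alpha> \<subseteq> (\<Union>i\<in>{1..K}. V i)" unfolding \<alpha>_def using disjointed_subset[of V] by blast
    show "(\<Union>i\<in>{1..K}. V i) \<subseteq> \<Union>\<alpha>"
    proof
      fix x assume "x \<in> (\<Union>i\<in>{1..K}. V i)"
      then have "x \<in> (\<Union>i. disjointed V i)" unfolding UN_disjointed_eq by auto
      then obtain i where i: "x \<in> disjointed V i" by blast
      then have "x \<in> V i" using disjointed_subset[of V i] by auto
      then have "i \<in> {1..K}" by (auto simp: V_def split: if_splits)
      then show "x \<in> \<Union>\<alpha>" using i by (auto simp: \<alpha>_def)
    qed
  qed
  moreover have "prob (\<Union>\<alpha>) = 1"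
  proof -
    have Vm: "V i \<in> sets M" for i using Vk by (auto simp: kronecker_events_def)
    have "integrable M (\<lambda>x. \<Prod>i=1..K. h i x)"
    proof (rule integrable_bounded)
      show "(\<lambda>x. \<Prod>i=1..K. h i x) \<in> borel_measurable M" using hM by measurable
      have "0 \<le> (\<Prod>i=1..K. h i x)" "(\<Prod>i=1..K. h i x) \<le> 1" for x
        using h01 by (auto intro!: prod_nonneg prod_le_1)
      then show "\<bar>\<Prod>i=1..K. h i x\<bar> \<le> 1" for x by simp
    qed
    then have "AE x in M. (\<Prod>i=1..K. h i x) = 0"
      using zero h01 by (subst (asm) integral_nonneg_eq_0_iff_AE) (auto intro!: prod_nonneg)
    moreover have "AE x in M. \<forall>i\<in>{1..K}. x \<in> A i \<longleftrightarrow> x \<in> A i - U i"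
      by (rule AE_finite_allI[OF _ null]) auto
    ultimately have "AE x in M. x \<in> \<Union>\<alpha>"
      using AE_space
    proof eventually_elim
      case (elim x)
      then obtain i where i: "i \<in> {1..K}" "h i x = 0" by auto
      then have "x \<in> V i" using elim by (auto simp: A_def V_def)
      then show ?case using i unfolding U by blast
    qed
    moreover have "\<Union>\<alpha> \<in> sets M" unfolding U using Vm by auto
    ultimately show ?thesis by (simp add: prob_eq_1)
  qed
  moreover have "\<exists>k\<in>{1..K}. B \<inter> U k = {}" if B: "B \<in> \<alpha>" for B
  proof -
    have "\<exists>i\<in>{1..K}. B = disjointed V i" using B by (auto simp: \<alpha>_def)
    then obtain i where i: "i \<in> {1..K}" "B = disjointed V i" by blast
    have "B \<subseteq> A i - U i" using disjointed_subset[of V i] i by (auto simp: V_def)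
    then show ?thesis using i by blast
  qed
  moreover have "finite \<alpha>" "\<alpha> \<subseteq> kronecker_events" using dk by (auto simp: \<alpha>_def)
  ultimately show ?thesis by (intro exI[of _ \<alpha>] conjI ballI)
qed

end

section \<open>Entropy of partitions\<close>

definition refinement :: "'x set set \<Rightarrow> 'x set set \<Rightarrow> 'x set set" where
  "refinement \<alpha> \<beta> = (\<lambda>(a, b). a \<inter> b) ` (\<alpha> \<times> \<beta>)"

lemma refinement_commute: "refinement \<alpha> \<beta> = refinement \<beta> \<alpha>"
  unfolding refinement_def by (auto simp: Int_commute intro: rev_image_eqI)

lemma refinement_assoc: "refinement (refinement \<alpha> \<beta>) \<gamma> = refinement \<alpha> (refinement \<beta> \<gamma>)"
proof
  show "refinement (refinement \<alpha> \<beta>) \<gamma> \<subseteq> refinement \<alpha> (refinement \<beta> \<gamma>)"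
  proof
    fix x assume "x \<in> refinement (refinement \<alpha> \<beta>) \<gamma>"
    then obtain a b c where "a \<in> \<alpha>" "b \<in> \<beta>" "c \<in> \<gamma>" "x = a \<inter> b \<inter> c" by (auto simp: refinement_def)
    then have "(a, b \<inter> c) \<in> \<alpha> \<times> refinement \<beta> \<gamma>" "x = a \<inter> (b \<inter> c)" by (auto simp: refinement_def)
    then show "x \<in> refinement \<alpha> (refinement \<beta> \<gamma>)" unfolding refinement_def[of \<alpha>] by (auto intro: rev_image_eqI)
  qed
  show "refinement \<alpha> (refinement \<beta> \<gamma>) \<subseteq> refinement (refinement \<alpha> \<beta>) \<gamma>"
  proof
    fix x assume "x \<in> refinement \<alpha> (refinement \<beta> \<gamma>)"
    then obtain a b c where "a \<in> \<alpha>" "b \<in> \<beta>" "c \<in> \<gamma>" "x = a \<inter> (b \<inter> c)" by (auto simp: refinement_def)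
    then have "(a \<inter> b, c) \<in> refinement \<alpha> \<beta> \<times> \<gamma>" "x = (a \<inter> b) \<inter> c" by (auto simp: refinement_def)
    then show "x \<in> refinement (refinement \<alpha> \<beta>) \<gamma>" unfolding refinement_def[of _ \<gamma>] by (auto intro: rev_image_eqI)
  qed
qed

lemma join_empty: "join {} P = {UNIV}"
  by (auto simp: join_def)

lemma join_insert:
  assumes "i \<notin> I"
  shows "join (insert i I) P = refinement (join I P) (P i)"
proof
  show "join (insert i I) P \<subseteq> refinement (join I P) (P i)"
  proof
    fix x assume "x \<in> join (insert i I) P"
    then obtain B where B: "\<forall>j\<in>insert i I. B j \<in> P j" "x = (\<Inter>j\<in>insert i I. B j)" by (auto simp: join_def)
    then have "(\<Inter>j\<in>I. B j) \<in> join I P" "B i \<in> P i" "x = (\<Inter>j\<in>I. B j) \<inter> B i" by (auto simp: join_def)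
    then show "x \<in> refinement (join I P) (P i)" unfolding refinement_def by (auto intro: rev_image_eqI)
  qed
  show "refinement (join I P) (P i) \<subseteq> join (insert i I) P"
  proof
    fix x assume "x \<in> refinement (join I P) (P i)"
    then obtain B b where B: "\<forall>j\<in>I. B j \<in> P j" "b \<in> P i" "x = (\<Inter>j\<in>I. B j) \<inter> b"
      by (auto simp: refinement_def join_def)
    have "x = (\<Inter>j\<in>insert i I. (B(i := b)) j)" unfolding B(3) using assms by auto
    moreover have "\<forall>j\<in>insert i I. (B(i := b)) j \<in> P j" using B assms by auto
    ultimately show "x \<in> join (insert i I) P" unfolding join_def mem_Collect_eq by blast
  qed
qed

section \<open>Conditional entropy estimates\<close>

context prob_space begin

definition finite_partition :: "'a set set \<Rightarrow> bool" where
  "finite_partition \<alpha> \<longleftrightarrow> finite \<alpha> \<and> \<alpha> \<subseteq> sets M \<and> disjoint \<alpha> \<and> prob (\<Union>\<alpha>) = 1"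

definition entropy_of :: "'a set set \<Rightarrow> real" where
  "entropy_of \<alpha> = - (\<Sum>A\<in>\<alpha>. prob A * ln (prob A))"

lemma finite_partition_refinement:
  assumes "finite_partition \<alpha>" "finite_partition \<beta>"
  shows "finite_partition (refinement \<alpha> \<beta>)"
proof -
  have f: "finite \<alpha>" "finite \<beta>" "\<alpha> \<subseteq> sets M" "\<beta> \<subseteq> sets M" "disjoint \<alpha>" "disjoint \<beta>"
    "prob (\<Union>\<alpha>) = 1" "prob (\<Union>\<beta>) = 1"
    using assms by (auto simp: finite_partition_def)
  have m: "\<Union>\<alpha> \<in> sets M" "\<Union>\<beta> \<in> sets M" using f by auto
  have "disjoint (refinement \<alpha> \<beta>)"
    unfolding disjoint_def refinement_def using f(5,6) by (auto simp: disjoint_def)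
  moreover have "\<Union>(refinement \<alpha> \<beta>) = \<Union>\<alpha> \<inter> \<Union>\<beta>" by (auto simp: refinement_def)
  moreover have "prob (\<Union>\<alpha> \<inter> \<Union>\<beta>) = 1"
  proof -
    have "AE x in M. x \<in> \<Union>\<alpha>" "AE x in M. x \<in> \<Union>\<beta>" using f(7,8) prob_eq_1 m by auto
    then have "AE x in M. x \<in> \<Union>\<alpha> \<inter> \<Union>\<beta>" by eventually_elim auto
    then show ?thesis using m by (subst prob_eq_1) auto
  qed
  moreover have "finite (refinement \<alpha> \<beta>)" "refinement \<alpha> \<beta> \<subseteq> sets M" using f by (auto simp: refinement_def)
  ultimately show ?thesis by (simp add: finite_partition_def)
qed

lemma partition_marginal:
  assumes \<beta>: "finite_partition \<beta>" and a: "a \<in> sets M"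
  shows "(\<Sum>b\<in>\<beta>. prob (a \<inter> b)) = prob a"
proof -
  have f: "finite \<beta>" "\<beta> \<subseteq> sets M" "disjoint \<beta>" "prob (\<Union>\<beta>) = 1"
    using \<beta> by (auto simp: finite_partition_def)
  have d: "disjoint_family_on (\<lambda>b. a \<inter> b) \<beta>"
    using f(3) by (auto simp: disjoint_family_on_def disjoint_def)
  have "(\<Sum>b\<in>\<beta>. prob (a \<inter> b)) = prob (\<Union>b\<in>\<beta>. a \<inter> b)"
    by (rule finite_measure_finite_Union[symmetric]) (use f a d in auto)
  also have "\<dots> = prob a"
  proof (rule finite_measure_eq_AE)
    have "\<Union>\<beta> \<in> sets M" using f by auto
    then have "AE x in M. x \<in> \<Union>\<beta>" using f(4) by (simp only: prob_eq_1)
    then show "AE x in M. x \<in> (\<Union>b\<in>\<beta>. a \<inter> b) \<longleftrightarrow> x \<in> a" by eventually_elim auto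
  qed (use f a in auto)
  finally show ?thesis .
qed

text \<open>As a set of sets, the refinement merges pairs of atoms with equal intersection. For
  disjoint families this happens only when the intersection is empty, where \<open>f\<close>
  vanishes.\<close>

lemma sum_refinement:
  assumes "finite_partition \<alpha>" "finite_partition \<beta>" and "f {} = 0"
  shows "(\<Sum>c\<in>refinement \<alpha> \<beta>. f c) = (\<Sum>a\<in>\<alpha>. \<Sum>b\<in>\<beta>. f (a \<inter> b) :: real)"
proof -
  have f: "finite \<alpha>" "finite \<beta>" "disjoint \<alpha>" "disjoint \<beta>"
    using assms by (auto simp: finite_partition_def)
  have "(\<Sum>c\<in>refinement \<alpha> \<beta>. f c) = (\<Sum>p\<in>\<alpha> \<times> \<beta>. (f \<circ> (\<lambda>(a, b). a \<inter> b)) p)"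
    unfolding refinement_def
  proof (rule sum.reindex_nontrivial)
    fix p q assume pq: "p \<in> \<alpha> \<times> \<beta>" "q \<in> \<alpha> \<times> \<beta>" "p \<noteq> q" "(case p of (a, b) \<Rightarrow> a \<inter> b) = (case q of (a, b) \<Rightarrow> a \<inter> b)"
    obtain a b a' b' where p: "p = (a, b)" "q = (a', b')" by (cases p, cases q)
    then have eq: "a \<inter> b = a' \<inter> b'" using pq by simp
    have "a \<noteq> a' \<or> b \<noteq> b'" using pq(3) p by auto
    then have "a \<inter> a' = {} \<or> b \<inter> b' = {}"
      using pq(1,2) p disjointD[OF f(3), of a a'] disjointD[OF f(4), of b b'] by auto
    then have "a \<inter> b = {}" using eq by blast
    then show "f (case p of (a, b) \<Rightarrow> a \<inter> b) = 0" using assms(3) p by simp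
  qed (use f in auto)
  then show ?thesis by (simp add: sum.cartesian_product case_prod_unfold)
qed

text \<open>With \<open>p = prob a\<close> and \<open>q = prob (a \<inter> b)\<close> this is the
  contribution of the pair to the conditional entropy of \<beta> given \<alpha>. For
  \<open>q = 0\<close> it is 0, in agreement with the convention for \<open>0 log 0\<close>.\<close>

definition info_term :: "real \<Rightarrow> real \<Rightarrow> real" where
  "info_term p q = q * ln (p / q)"

lemma info_term_nonneg: "0 \<le> q \<Longrightarrow> q \<le> p \<Longrightarrow> 0 \<le> info_term p q"
  by (cases "q = 0") (auto simp: info_term_def intro!: mult_nonneg_nonneg ln_ge_zero)

lemma info_term_ge_ln2: "0 \<le> q \<Longrightarrow> q \<le> p / 2 \<Longrightarrow> q * ln 2 \<le> info_term p q"
  by (cases "q = 0") (auto simp: info_term_def field_simps intro!: mult_left_mono)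

lemma info_term_le_diff:
  assumes "0 \<le> q" "q \<le> p"
  shows "info_term p q \<le> p - q"
proof (cases "q = 0")
  case False
  then have q: "0 < q" using assms by simp
  then have "ln (p / q) \<le> p / q - 1" using assms by (intro ln_le_minus_one) auto
  then have "q * ln (p / q) \<le> q * (p / q - 1)" using q by (intro mult_left_mono) auto
  also have "\<dots> = p - q" using q by (simp add: field_simps)
  finally show ?thesis by (simp add: info_term_def)
qed (use assms in \<open>simp add: info_term_def\<close>)

text \<open>The inequality \<open>ln x \<le> x - 1\<close>, applied after scaling by
  \<open>exp (- t)\<close>. The free parameter \<open>t\<close> makes the bound linear in
  \<open>q\<close>, so that it can be summed without concavity arguments.\<close>

lemma info_term_le_exp:
  assumes "0 \<le> q" "q \<le> p"
  shows "info_term p q \<le> q * t + p * exp (- t)"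
proof (cases "q = 0")
  case False
  then have q: "0 < q" "0 < p" using assms by auto
  have "ln (p * exp (- t) / q) \<le> p * exp (- t) / q - 1" using q by (intro ln_le_minus_one) auto
  moreover have "ln (p * exp (- t) / q) = ln (p / q) - t"
    using q by (simp add: ln_div ln_mult)
  ultimately have "ln (p / q) \<le> t + p * exp (- t) / q" by linarith
  then have "q * ln (p / q) \<le> q * (t + p * exp (- t) / q)" using q by (intro mult_left_mono) auto
  also have "\<dots> = q * t + p * exp (- t)" using q by (simp add: field_simps)
  finally show ?thesis by (simp add: info_term_def)
qed (use assms in \<open>simp add: info_term_def\<close>)

text \<open>The chain rule: the double sum is the entropy of \<beta> conditioned on
  \<alpha>.\<close>

lemma entropy_refinement:
  assumes \<alpha>: "finite_partition \<alpha>" and \<beta>: "finite_partition \<beta>"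
  shows "entropy_of (refinement \<alpha> \<beta>) = entropy_of \<alpha> + (\<Sum>a\<in>\<alpha>. \<Sum>b\<in>\<beta>. info_term (prob a) (prob (a \<inter> b)))"
proof -
  have am: "a \<in> sets M" if "a \<in> \<alpha>" for a using \<alpha> that by (auto simp: finite_partition_def)
  have bm: "b \<in> sets M" if "b \<in> \<beta>" for b using \<beta> that by (auto simp: finite_partition_def)
  have "entropy_of (refinement \<alpha> \<beta>) = - (\<Sum>a\<in>\<alpha>. \<Sum>b\<in>\<beta>. prob (a \<inter> b) * ln (prob (a \<inter> b)))"
    unfolding entropy_of_def by (subst sum_refinement[OF \<alpha> \<beta>]) auto
  moreover have "entropy_of \<alpha> = - (\<Sum>a\<in>\<alpha>. \<Sum>b\<in>\<beta>. prob (a \<inter> b) * ln (prob a))"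
    unfolding entropy_of_def
    by (simp add: sum_distrib_right[symmetric] partition_marginal[OF \<beta> am])
  moreover have "info_term (prob a) (prob (a \<inter> b)) = prob (a \<inter> b) * ln (prob a) - prob (a \<inter> b) * ln (prob (a \<inter> b))"
    if "a \<in> \<alpha>" "b \<in> \<beta>" for a b
  proof (cases "prob (a \<inter> b) = 0")
    case False
    then have "0 < prob (a \<inter> b)" by (simp add: zero_less_measure_iff)
    moreover have "prob (a \<inter> b) \<le> prob a" using am[OF that(1)] by (intro finite_measure_mono) auto
    ultimately show ?thesis by (simp add: info_term_def ln_div right_diff_distrib)
  qed (simp add: info_term_def)
  ultimately show ?thesis by (simp add: sum_subtractf)
qed

lemma entropy_le_refinement:
  assumes \<alpha>: "finite_partition \<alpha>" and \<beta>: "finite_partition \<beta>"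
  shows "entropy_of \<alpha> \<le> entropy_of (refinement \<alpha> \<beta>)"
proof -
  have "0 \<le> info_term (prob a) (prob (a \<inter> b))" if "a \<in> \<alpha>" for a b
    using \<alpha> that by (intro info_term_nonneg finite_measure_mono) (auto simp: finite_partition_def)
  then have "0 \<le> (\<Sum>a\<in>\<alpha>. \<Sum>b\<in>\<beta>. info_term (prob a) (prob (a \<inter> b)))" by (intro sum_nonneg) auto
  then show ?thesis using entropy_refinement[OF \<alpha> \<beta>] by simp
qed

text \<open>A bound of Fano type: \<open>c a\<close> guesses the atom of \<beta> from the atom
  \<open>a\<close>, and \<open>e\<close> bounds the probability of a wrong guess. In each
  \<open>a\<close> the guessed atom contributes at most the probability of error, and the others are
  estimated by \<open>info_term_le_exp\<close>.\<close>

lemma entropy_refinement_upper: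
  assumes \<alpha>: "finite_partition \<alpha>" and \<beta>: "finite_partition \<beta>"
    and c: "\<And>a. a \<in> \<alpha> \<Longrightarrow> c a \<in> \<beta>" and e: "(\<Sum>a\<in>\<alpha>. prob (a - c a)) \<le> e" and t: "0 \<le> t"
  shows "entropy_of (refinement \<alpha> \<beta>) \<le> entropy_of \<alpha> + e * (1 + t) + card \<beta> * exp (- t)"
proof -
  have am: "a \<in> sets M" if "a \<in> \<alpha>" for a using \<alpha> that by (auto simp: finite_partition_def)
  have bm: "b \<in> sets M" if "b \<in> \<beta>" for b using \<beta> that by (auto simp: finite_partition_def)
  have fb: "finite \<beta>" using \<beta> by (simp add: finite_partition_def)
  have row: "(\<Sum>b\<in>\<beta>. info_term (prob a) (prob (a \<inter> b))) \<le> prob (a - c a) * (1 + t) + card \<beta> * (prob a * exp (- t))"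
    if a: "a \<in> \<alpha>" for a
  proof -
    have le: "prob (a \<inter> b) \<le> prob a" for b using am[OF a] by (intro finite_measure_mono) auto
    have diff: "prob a - prob (a \<inter> c a) = prob (a - c a)"
      using finite_measure_Diff'[OF am[OF a] bm[OF c[OF a]]] by simp
    have "(\<Sum>b\<in>\<beta> - {c a}. prob (a \<inter> b)) = prob (a - c a)"
      using partition_marginal[OF \<beta> am[OF a]] fb c[OF a] diff by (simp add: sum_diff1)
    note rest = this
    have "(\<Sum>b\<in>\<beta>. info_term (prob a) (prob (a \<inter> b)))
        = info_term (prob a) (prob (a \<inter> c a)) + (\<Sum>b\<in>\<beta> - {c a}. info_term (prob a) (prob (a \<inter> b)))"
      using fb c[OF a] by (simp add: sum.remove)
    also have "\<dots> \<le> (prob a - prob (a \<inter> c a)) + (\<Sum>b\<in>\<beta> - {c a}. prob (a \<inter> b) * t + prob a * exp (- t))"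
      using le by (intro add_mono sum_mono info_term_le_diff info_term_le_exp) auto
    also have "\<dots> = prob (a - c a) + prob (a - c a) * t + card (\<beta> - {c a}) * (prob a * exp (- t))"
      unfolding diff sum.distrib sum_distrib_right[symmetric] rest by simp
    also have "\<dots> \<le> prob (a - c a) + prob (a - c a) * t + card \<beta> * (prob a * exp (- t))"
      using fb by (intro add_left_mono mult_right_mono) (auto intro: card_mono)
    finally show ?thesis by (simp add: algebra_simps)
  qed
  have one: "(\<Sum>a\<in>\<alpha>. prob a) = 1"
  proof -
    have "(\<Sum>a\<in>\<alpha>. prob (space M \<inter> a)) = 1" using partition_marginal[OF \<alpha>, of "space M"] by (simp add: prob_space)
    moreover have "space M \<inter> a = a" if "a \<in> \<alpha>" for a using sets.sets_into_space[OF am[OF that]] by auto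
    ultimately show ?thesis by simp
  qed
  have "(\<Sum>a\<in>\<alpha>. \<Sum>b\<in>\<beta>. info_term (prob a) (prob (a \<inter> b)))
      \<le> (\<Sum>a\<in>\<alpha>. prob (a - c a) * (1 + t) + card \<beta> * (prob a * exp (- t)))"
    by (rule sum_mono[OF row])
  also have "\<dots> = (\<Sum>a\<in>\<alpha>. prob (a - c a)) * (1 + t) + card \<beta> * (1 * exp (- t))"
    unfolding one[symmetric] by (simp add: sum.distrib sum_distrib_right sum_distrib_left)
  also have "\<dots> \<le> e * (1 + t) + card \<beta> * exp (- t)"
    using mult_right_mono[OF e, of "1 + t"] t by simp
  finally show ?thesis using entropy_refinement[OF \<alpha> \<beta>] by simp
qed

text \<open>In each atom \<open>a\<close> either \<open>B\<close> occupies at most half, and its own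
  term suffices, or every other atom of \<beta> occupies at most half, and their terms together
  suffice.\<close>

lemma entropy_refinement_lower:
  assumes \<alpha>: "finite_partition \<alpha>" and \<beta>: "finite_partition \<beta>" and B: "B \<in> \<beta>"
  shows "entropy_of \<alpha> + ln 2 * (\<Sum>a\<in>\<alpha>. min (prob (a \<inter> B)) (prob (a - B))) \<le> entropy_of (refinement \<alpha> \<beta>)"
proof -
  have am: "a \<in> sets M" if "a \<in> \<alpha>" for a using \<alpha> that by (auto simp: finite_partition_def)
  have bm: "b \<in> sets M" if "b \<in> \<beta>" for b using \<beta> that by (auto simp: finite_partition_def)
  have fb: "finite \<beta>" using \<beta> by (simp add: finite_partition_def)
  have row: "ln 2 * min (prob (a \<inter> B)) (prob (a - B)) \<le> (\<Sum>b\<in>\<beta>. info_term (prob a) (prob (a \<inter> b)))"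
    if a: "a \<in> \<alpha>" for a
  proof -
    have le: "prob (a \<inter> b) \<le> prob a" for b using am[OF a] by (intro finite_measure_mono) auto
    have diff: "prob a - prob (a \<inter> B) = prob (a - B)"
      using finite_measure_Diff'[OF am[OF a] bm[OF B]] by simp
    have rest: "(\<Sum>b\<in>\<beta> - {B}. prob (a \<inter> b)) = prob (a - B)"
      using partition_marginal[OF \<beta> am[OF a]] fb B diff by (simp add: sum_diff1)
    have split: "(\<Sum>b\<in>\<beta>. info_term (prob a) (prob (a \<inter> b)))
        = info_term (prob a) (prob (a \<inter> B)) + (\<Sum>b\<in>\<beta> - {B}. info_term (prob a) (prob (a \<inter> b)))"
      using fb B by (simp add: sum.remove)
    have nn: "0 \<le> info_term (prob a) (prob (a \<inter> b))" for b by (intro info_term_nonneg le) auto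
    have ln2: "0 \<le> ln (2::real)" by simp
    show ?thesis
    proof (cases "prob (a \<inter> B) \<le> prob a / 2")
      case True
      have "ln 2 * min (prob (a \<inter> B)) (prob (a - B)) \<le> prob (a \<inter> B) * ln 2"
        using ln2 by (subst mult.commute) (intro mult_right_mono, auto)
      also have "\<dots> \<le> info_term (prob a) (prob (a \<inter> B))" using True by (intro info_term_ge_ln2) auto
      also have "\<dots> \<le> (\<Sum>b\<in>\<beta>. info_term (prob a) (prob (a \<inter> b)))"
        unfolding split using nn by (simp add: sum_nonneg)
      finally show ?thesis .
    next
      case False
      have small: "prob (a \<inter> b) \<le> prob a / 2" if "b \<in> \<beta> - {B}" for b
      proof -
        have "prob (a \<inter> b) \<le> (\<Sum>b\<in>\<beta> - {B}. prob (a \<inter> b))" using that fb by (intro member_le_sum) auto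
        then show ?thesis using False diff unfolding rest by simp
      qed
      have "ln 2 * min (prob (a \<inter> B)) (prob (a - B)) \<le> prob (a - B) * ln 2"
        using ln2 by (subst mult.commute) (intro mult_right_mono, auto)
      also have "\<dots> = (\<Sum>b\<in>\<beta> - {B}. prob (a \<inter> b) * ln 2)"
        unfolding rest[symmetric] by (simp add: sum_distrib_right)
      also have "\<dots> \<le> (\<Sum>b\<in>\<beta> - {B}. info_term (prob a) (prob (a \<inter> b)))"
        using small by (intro sum_mono info_term_ge_ln2) auto
      also have "\<dots> \<le> (\<Sum>b\<in>\<beta>. info_term (prob a) (prob (a \<inter> b)))"
        unfolding split using nn by simp
      finally show ?thesis .
    qed
  qed
  have "ln 2 * (\<Sum>a\<in>\<alpha>. min (prob (a \<inter> B)) (prob (a - B)))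
      \<le> (\<Sum>a\<in>\<alpha>. \<Sum>b\<in>\<beta>. info_term (prob a) (prob (a \<inter> b)))"
    unfolding sum_distrib_left by (rule sum_mono[OF row])
  then show ?thesis using entropy_refinement[OF \<alpha> \<beta>] by simp
qed

end

section \<open>Entropy of joins of translated partitions\<close>

context folner_action begin

definition pull_partition :: "'g \<Rightarrow> 'a set set \<Rightarrow> 'a set set" where
  "pull_partition g \<alpha> = (\<lambda>A. \<psi> g -` A) ` \<alpha>"

lemma prob_vimage:
  assumes sp: "space M = UNIV" and g: "g \<in> carrier G" and A: "A \<in> sets M"
  shows "\<psi> g -` A \<in> sets M" "prob (\<psi> g -` A) = prob A"
proof -
  show "\<psi> g -` A \<in> sets M" using measurable_sets[OF action_measurable[OF g] A] sp by simp
  have "prob A = measure (distr M M (\<psi> g)) A" using action_distr[OF g] by simp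
  also have "\<dots> = prob (\<psi> g -` A)" using measure_distr[OF action_measurable[OF g] A] sp by simp
  finally show "prob (\<psi> g -` A) = prob A" by simp
qed

lemma finite_partition_pull:
  assumes sp: "space M = UNIV" and \<alpha>: "finite_partition \<alpha>" and g: "g \<in> carrier G"
  shows "finite_partition (pull_partition g \<alpha>)"
proof -
  have f: "finite \<alpha>" "\<alpha> \<subseteq> sets M" "disjoint \<alpha>" "prob (\<Union>\<alpha>) = 1" "\<Union>\<alpha> \<in> sets M"
    using \<alpha> by (auto simp: finite_partition_def)
  have "\<Union>(pull_partition g \<alpha>) = \<psi> g -` \<Union>\<alpha>" by (auto simp: pull_partition_def)
  then have "prob (\<Union>(pull_partition g \<alpha>)) = 1" using prob_vimage(2)[OF sp g f(5)] f(4) by simp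
  moreover have "disjoint (pull_partition g \<alpha>)"
    using f(3) unfolding disjoint_def pull_partition_def by blast
  moreover have "pull_partition g \<alpha> \<subseteq> sets M"
    using prob_vimage(1)[OF sp g] f(2) by (auto simp: pull_partition_def)
  ultimately show ?thesis using f(1) by (simp add: finite_partition_def pull_partition_def)
qed

lemma finite_partition_UNIV: "space M = UNIV \<Longrightarrow> finite_partition {UNIV}"
  using prob_space sets.top[of M] by (simp add: finite_partition_def disjoint_def)

lemma finite_partition_join:
  assumes sp: "space M = UNIV" and \<alpha>: "finite_partition \<alpha>" and S: "finite S"
    and s: "\<And>i. i \<in> S \<Longrightarrow> s i \<in> carrier G"
  shows "finite_partition (join S (\<lambda>i. pull_partition (s i) \<alpha>))"
  using S s
proof (induction S rule: finite_induct)
  case empty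
  then show ?case by (simp add: join_empty finite_partition_UNIV[OF sp])
next
  case (insert i S)
  then show ?case unfolding join_insert[OF insert(2)]
    by (intro finite_partition_refinement finite_partition_pull[OF sp \<alpha>]) auto
qed

lemma L1_dist_indicator_translates:
  assumes sp: "space M = UNIV" and g: "g \<in> carrier G" and h: "h \<in> carrier G" and A: "A \<in> sets M"
  shows "L1_dist M (\<lambda>x. indicator A (\<psi> g x)) (\<lambda>x. indicator A (\<psi> h x)) = prob (sym_diff (\<psi> g -` A) (\<psi> h -` A))"
proof -
  have "(\<lambda>x. indicator A (\<psi> k x) :: real) = indicator (\<psi> k -` A)" for k by (auto simp: indicator_def)
  then show ?thesis using L1_dist_indicator[of "\<psi> g -` A" "\<psi> h -` A"] prob_vimage(1)[OF sp _ A] g h by simp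
qed

text \<open>A finite join \<open>R\<close> of translates by representatives of the colours already
  predicts every translate of \<alpha> up to a small error. Including \<open>R\<close> costs the
  constant \<open>D\<close> once; afterwards each new translate costs at most \<omega>.\<close>

lemma kronecker_partition_entropy:
  fixes \<omega> :: real
  assumes sp: "space M = UNIV" and \<alpha>: "finite_partition \<alpha>" and kr: "\<alpha> \<subseteq> kronecker_events"
    and s: "\<And>i. 1 \<le> i \<Longrightarrow> s i \<in> carrier G" and \<omega>: "0 < \<omega>"
  shows "\<exists>D. \<forall>n. entropy_of (join {1..n::nat} (\<lambda>i. pull_partition (s i) \<alpha>)) \<le> D + n * \<omega>"
proof -
  have fa: "finite \<alpha>" "\<And>A. A \<in> \<alpha> \<Longrightarrow> A \<in> sets M" "disjoint \<alpha>" using \<alpha> by (auto simp: finite_partition_def)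
  define L where "L = card \<alpha>"
  have "\<alpha> \<noteq> {}" using \<alpha> by (auto simp: finite_partition_def)
  then have L: "0 < real L" using fa by (simp add: L_def card_gt_0_iff)
  \<comment> \<open>\<open>t\<close> and, below, \<open>e\<close> split \<omega> in the Fano bound:
    \<open>L * exp (- t)\<close> and \<open>e * (1 + t)\<close> are each at most
    \<open>\<omega> / 2\<close>.\<close>
  define t where "t = max 0 (ln (2 * L / \<omega>))"
  have t: "0 \<le> t" by (simp add: t_def)
  have "exp (- t) \<le> exp (- ln (2 * L / \<omega>))" by (simp add: t_def)
  also have "\<dots> = \<omega> / (2 * L)" using L \<omega> by (simp add: exp_minus)
  finally have expt: "L * exp (- t) \<le> \<omega> / 2" using L by (simp add: field_simps)
  define e where "e = \<omega> / (2 * (1 + t))"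
  have e: "0 < e" using \<omega> t by (simp add: e_def)
  have eL: "0 < e / L" using e L by simp
  have ap: "almost_periodic (indicator A)" if "A \<in> \<alpha>" for A using kr that by (auto simp: kronecker_events_def)
  obtain r :: "'g \<Rightarrow> 'a set \<Rightarrow> 'g set" where r: "finite (r ` carrier G)"
    "\<And>g h A. g \<in> carrier G \<Longrightarrow> h \<in> carrier G \<Longrightarrow> r g = r h \<Longrightarrow> A \<in> \<alpha> \<Longrightarrow>
        L1_dist M (\<lambda>x. indicator A (\<psi> g x)) (\<lambda>x. indicator A (\<psi> h x)) < e / L"
    using almost_periodic_joint[OF fa(1) _ eL, of indicator] ap by blast
  define rep where "rep c = (SOME g. g \<in> carrier G \<and> r g = c)" for c
  have rep: "rep (r g) \<in> carrier G \<and> r (rep (r g)) = r g" if "g \<in> carrier G" for g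
    unfolding rep_def by (rule someI[of _ g]) (use that in simp)
  define S where "S = rep ` r ` carrier G"
  have S: "finite S" "\<And>g. g \<in> S \<Longrightarrow> g \<in> carrier G" using r(1) rep by (auto simp: S_def)
  define R where "R = join S (\<lambda>g. pull_partition g \<alpha>)"
  have R: "finite_partition R"
    unfolding R_def using finite_partition_join[OF sp \<alpha> S(1), of "\<lambda>g. g"] S(2) by simp
  define \<beta> where "\<beta> n = join {1..n} (\<lambda>i. pull_partition (s i) \<alpha>)" for n
  have \<beta>: "finite_partition (\<beta> n)" for n
    unfolding \<beta>_def using finite_partition_join[OF sp \<alpha>, of "{1..n}" s] s by simp
  have \<beta>Suc: "\<beta> (Suc n) = refinement (\<beta> n) (pull_partition (s (Suc n)) \<alpha>)" for n
    unfolding \<beta>_def using join_insert[of "Suc n" "{1..n}"] by (simp add: atLeastAtMostSuc_conv)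
  have step: "entropy_of (refinement R (\<beta> (Suc n))) \<le> entropy_of (refinement R (\<beta> n)) + \<omega>" for n
  proof -
    define g where "g = s (Suc n)"
    have g: "g \<in> carrier G" using s[of "Suc n"] by (simp add: g_def)
    define g0 where "g0 = rep (r g)"
    have g0: "g0 \<in> S" "g0 \<in> carrier G" "r g0 = r g" using g rep[OF g] by (auto simp: g0_def S_def)
    define T where "T = refinement R (\<beta> n)"
    have T: "finite_partition T" unfolding T_def by (intro finite_partition_refinement R \<beta>)
    have Tm: "\<And>a. a \<in> T \<Longrightarrow> a \<in> sets M" "finite T" "disjoint T" using T by (auto simp: finite_partition_def)
    have "\<exists>A\<in>\<alpha>. a \<subseteq> \<psi> g0 -` A" if a: "a \<in> T" for a
    proof -
      have "\<exists>b\<in>R. a \<subseteq> b" using a by (auto simp: T_def refinement_def)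
      then obtain b where b: "b \<in> R" "a \<subseteq> b" by blast
      then obtain B where "\<forall>k\<in>S. B k \<in> pull_partition k \<alpha>" "b = (\<Inter>k\<in>S. B k)" by (auto simp: R_def join_def)
      then have "B g0 \<in> pull_partition g0 \<alpha>" "a \<subseteq> B g0" using g0(1) b(2) by auto
      then show ?thesis by (auto simp: pull_partition_def)
    qed
    then have "\<forall>a\<in>T. \<exists>A. A \<in> \<alpha> \<and> a \<subseteq> \<psi> g0 -` A" by blast
    from bchoice[OF this] obtain l where l: "\<forall>a\<in>T. l a \<in> \<alpha> \<and> a \<subseteq> \<psi> g0 -` l a" by (rule exE)
    \<comment> \<open>\<open>l a\<close> is an atom of \<alpha> whose preimage under the
      representative \<open>g0\<close> contains \<open>a\<close>; the guess for \<open>g\<close> is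
      the preimage of the same atom under \<open>g\<close>.\<close>
    define c where "c a = \<psi> g -` l a" for a
    have vm: "\<psi> k -` A \<in> sets M" if "k \<in> carrier G" "A \<in> \<alpha>" for k A
      using prob_vimage(1)[OF sp that(1) fa(2)[OF that(2)]] .
    have cm: "c a \<in> sets M" if "a \<in> T" for a unfolding c_def using vm[OF g] l that by auto
    have "(\<Sum>a\<in>T. prob (a - c a)) = prob (\<Union>a\<in>T. a - c a)"
      by (rule finite_measure_finite_Union[symmetric])
        (use Tm cm in \<open>auto simp: disjoint_family_on_def disjoint_def\<close>)
    also have "\<dots> \<le> prob (\<Union>A\<in>\<alpha>. sym_diff (\<psi> g0 -` A) (\<psi> g -` A))"
    proof (rule finite_measure_mono)
      show "(\<Union>a\<in>T. a - c a) \<subseteq> (\<Union>A\<in>\<alpha>. sym_diff (\<psi> g0 -` A) (\<psi> g -` A))"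
        using l by (fastforce simp: c_def)
      show "(\<Union>A\<in>\<alpha>. sym_diff (\<psi> g0 -` A) (\<psi> g -` A)) \<in> sets M"
        using vm[OF g] vm[OF g0(2)] fa(1) by (intro sets.finite_UN) auto
    qed
    also have "\<dots> \<le> (\<Sum>A\<in>\<alpha>. prob (sym_diff (\<psi> g0 -` A) (\<psi> g -` A)))"
      using vm[OF g] vm[OF g0(2)] by (intro finite_measure_subadditive_finite fa(1)) auto
    also have "\<dots> \<le> (\<Sum>A\<in>\<alpha>. e / L)"
    proof (rule sum_mono)
      fix A assume A: "A \<in> \<alpha>"
      show "prob (sym_diff (\<psi> g0 -` A) (\<psi> g -` A)) \<le> e / L"
        using r(2)[OF g0(2) g g0(3) A] L1_dist_indicator_translates[OF sp g0(2) g fa(2)[OF A]] by simp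
    qed
    also have "\<dots> = e" using L by (simp add: L_def)
    finally have sume: "(\<Sum>a\<in>T. prob (a - c a)) \<le> e" .
    have "entropy_of (refinement T (pull_partition g \<alpha>)) \<le> entropy_of T + e * (1 + t) + card (pull_partition g \<alpha>) * exp (- t)"
      by (rule entropy_refinement_upper[OF T finite_partition_pull[OF sp \<alpha> g] _ sume t])
        (use l in \<open>auto simp: c_def pull_partition_def\<close>)
    also have "\<dots> \<le> entropy_of T + e * (1 + t) + L * exp (- t)"
      using card_image_le[OF fa(1)] by (simp add: L_def pull_partition_def)
    also have "\<dots> \<le> entropy_of T + \<omega>"
    proof -
      have "e * (1 + t) = \<omega> / 2" using t by (simp add: e_def divide_simps)
      then show ?thesis using expt by linarith
    qed
    finally show ?thesis unfolding \<beta>Suc refinement_assoc[symmetric] T_def g_def .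
  qed
  have "entropy_of (refinement R (\<beta> n)) \<le> entropy_of (refinement R (\<beta> 0)) + n * \<omega>" for n
  proof (induction n)
    case (Suc n)
    then show ?case using step[of n] by (simp add: distrib_right)
  qed simp
  moreover have "entropy_of (\<beta> n) \<le> entropy_of (refinement R (\<beta> n))" for n
    using entropy_le_refinement[OF \<beta> R] refinement_commute by metis
  ultimately show ?thesis unfolding \<beta>_def[symmetric] by (meson order_trans)
qed

text \<open>Suppose that for every precision all translates of \<open>A\<close> were nearly unions
  of atoms of one finite partition. Colouring \<open>g\<close> by the atoms in which its translate
  holds the majority gives finitely many colours, and equal colours force the translates to be
  close, so \<open>A\<close> would be almost periodic.\<close>

lemma not_almost_periodic_far:
  assumes sp: "space M = UNIV" and A: "A \<in> sets M" and nap: "\<not> almost_periodic (indicator A)"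
  shows "\<exists>e>0. \<forall>\<beta>. finite_partition \<beta> \<longrightarrow>
      (\<exists>g\<in>carrier G. e \<le> (\<Sum>b\<in>\<beta>. min (prob (b \<inter> \<psi> g -` A)) (prob (b - \<psi> g -` A))))"
proof (rule ccontr)
  assume neg: "\<not> ?thesis"
  have "\<forall>e\<in>{0<..}. \<exists>\<beta>. finite_partition \<beta> \<and>
      (\<forall>g\<in>carrier G. (\<Sum>b\<in>\<beta>. min (prob (b \<inter> \<psi> g -` A)) (prob (b - \<psi> g -` A))) < e / 2)"
  proof
    fix e :: real assume "e \<in> {0<..}"
    then have "0 < e / 2" by simp
    then show "\<exists>\<beta>. finite_partition \<beta> \<and>
      (\<forall>g\<in>carrier G. (\<Sum>b\<in>\<beta>. min (prob (b \<inter> \<psi> g -` A)) (prob (b - \<psi> g -` A))) < e / 2)"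
      using neg by (meson not_le)
  qed
  from bchoice[OF this] obtain \<beta> where "\<forall>e\<in>{0<..}. finite_partition (\<beta> e) \<and>
      (\<forall>g\<in>carrier G. (\<Sum>b\<in>\<beta> e. min (prob (b \<inter> \<psi> g -` A)) (prob (b - \<psi> g -` A))) < e / 2)"
    by (rule exE)
  then have \<beta>: "finite_partition (\<beta> e)"
    and small: "\<And>g. g \<in> carrier G \<Longrightarrow> (\<Sum>b\<in>\<beta> e. min (prob (b \<inter> \<psi> g -` A)) (prob (b - \<psi> g -` A))) < e / 2"
    if "0 < e" for e using that by auto
  define r where "r e g = {b\<in>\<beta> e. prob (b - \<psi> g -` A) < prob (b \<inter> \<psi> g -` A)}" for e g
  have "almost_periodic (indicator A)"
  proof (rule almost_periodicI[of r])
    fix e :: real assume e: "0 < e"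
    have "r e ` carrier G \<subseteq> Pow (\<beta> e)" by (auto simp: r_def)
    then show "finite (r e ` carrier G)"
      using \<beta>[OF e] by (auto intro: finite_subset simp: finite_partition_def)
    fix g h assume g: "g \<in> carrier G" and h: "h \<in> carrier G" and eq: "r e g = r e h"
    have vm: "\<psi> g -` A \<in> sets M" "\<psi> h -` A \<in> sets M" using prob_vimage(1)[OF sp _ A] g h by auto
    let ?D = "sym_diff (\<psi> g -` A) (\<psi> h -` A)"
    let ?m = "\<lambda>g b. min (prob (b \<inter> \<psi> g -` A)) (prob (b - \<psi> g -` A))"
    have "prob ?D = (\<Sum>b\<in>\<beta> e. prob (?D \<inter> b))"
      by (rule partition_marginal[OF \<beta>[OF e], symmetric]) (use vm in auto)
    also have "\<dots> \<le> (\<Sum>b\<in>\<beta> e. ?m g b + ?m h b)"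
    proof (rule sum_mono)
      fix b assume b: "b \<in> \<beta> e"
      have bm: "b \<in> sets M" using b \<beta>[OF e] by (auto simp: finite_partition_def)
      have iff: "b \<in> r e g \<longleftrightarrow> b \<in> r e h" using eq by simp
      show "prob (?D \<inter> b) \<le> ?m g b + ?m h b"
      proof (cases "b \<in> r e g")
        case True
        then have "?m g b = prob (b - \<psi> g -` A)" "?m h b = prob (b - \<psi> h -` A)"
          using iff by (auto simp: r_def)
        moreover have "prob (?D \<inter> b) \<le> prob ((b - \<psi> g -` A) \<union> (b - \<psi> h -` A))"
          by (rule finite_measure_mono) (use vm bm in auto)
        moreover have "\<dots> \<le> prob (b - \<psi> g -` A) + prob (b - \<psi> h -` A)"
          by (rule measure_Un_le) (use vm bm in auto)
        ultimately show ?thesis by linarith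
      next
        case False
        then have "?m g b = prob (b \<inter> \<psi> g -` A)" "?m h b = prob (b \<inter> \<psi> h -` A)"
          using iff b by (auto simp: r_def)
        moreover have "prob (?D \<inter> b) \<le> prob ((b \<inter> \<psi> g -` A) \<union> (b \<inter> \<psi> h -` A))"
          by (rule finite_measure_mono) (use vm bm in auto)
        moreover have "\<dots> \<le> prob (b \<inter> \<psi> g -` A) + prob (b \<inter> \<psi> h -` A)"
          by (rule measure_Un_le) (use vm bm in auto)
        ultimately show ?thesis by linarith
      qed
    qed
    also have "\<dots> < e" using small[OF e g] small[OF e h] by (simp add: sum.distrib)
    finally show "L1_dist M (\<lambda>x. indicator A (\<psi> g x)) (\<lambda>x. indicator A (\<psi> h x)) < e"
      unfolding L1_dist_indicator_translates[OF sp g h A] .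
  qed
  then show False using nap by simp
qed

text \<open>The sequence is built greedily: \<open>pick\<close> looks only at the current join, and
  \<open>entropy_refinement_lower\<close> turns its distance from the new translate into a gain of
  at least \<open>ln 2 * e\<close>.\<close>

lemma positive_sequence_entropy:
  assumes sp: "space M = UNIV" and \<alpha>: "finite_partition \<alpha>" and A: "A \<in> \<alpha>"
    and nap: "\<not> almost_periodic (indicator A)"
  shows "\<exists>(s :: nat \<Rightarrow> 'g) (c :: real). (\<forall>i. s i \<in> carrier G) \<and> 0 < c \<and>
    (\<forall>n::nat. n * c \<le> entropy_of (join {1..n} (\<lambda>i. pull_partition (s i) \<alpha>)))"
proof -
  have Am: "A \<in> sets M" using A \<alpha> by (auto simp: finite_partition_def)
  obtain e where e: "0 < e" and far: "\<And>\<beta>. finite_partition \<beta> \<Longrightarrow>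
      \<exists>g\<in>carrier G. e \<le> (\<Sum>b\<in>\<beta>. min (prob (b \<inter> \<psi> g -` A)) (prob (b - \<psi> g -` A)))"
    using not_almost_periodic_far[OF sp Am nap] by auto
  \<comment> \<open>The guard by \<open>finite_partition\<close> makes the choice a group element
    for every argument; that each \<open>B n\<close> is a partition is then a consequence and not a
    prerequisite.\<close>
  define pick where "pick \<beta> = (SOME g. g \<in> carrier G \<and>
      (finite_partition \<beta> \<longrightarrow> e \<le> (\<Sum>b\<in>\<beta>. min (prob (b \<inter> \<psi> g -` A)) (prob (b - \<psi> g -` A)))))" for \<beta>
  have pick: "pick \<beta> \<in> carrier G \<and>
      (finite_partition \<beta> \<longrightarrow> e \<le> (\<Sum>b\<in>\<beta>. min (prob (b \<inter> \<psi> (pick \<beta>) -` A)) (prob (b - \<psi> (pick \<beta>) -` A))))" for \<beta>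
    unfolding pick_def by (rule someI_ex) (use far[of \<beta>] one_closed in \<open>cases "finite_partition \<beta>"; blast\<close>)
  define B where "B = rec_nat {UNIV} (\<lambda>_ \<beta>. refinement \<beta> (pull_partition (pick \<beta>) \<alpha>))"
  have B0: "B 0 = {UNIV}" and BS: "B (Suc n) = refinement (B n) (pull_partition (pick (B n)) \<alpha>)" for n
    by (simp_all add: B_def)
  \<comment> \<open>Index shift: \<open>s (Suc n)\<close> is chosen from the join of the first
    \<open>n\<close> translates.\<close>
  define s where "s i = pick (B (i - 1))" for i
  have B: "join {1..n} (\<lambda>i. pull_partition (s i) \<alpha>) = B n" for n
  proof (induction n)
    case 0
    then show ?case by (simp add: B0 join_empty)
  next
    case (Suc n)
    have "join {1..Suc n} (\<lambda>i. pull_partition (s i) \<alpha>) = refinement (join {1..n} (\<lambda>i. pull_partition (s i) \<alpha>)) (pull_partition (s (Suc n)) \<alpha>)"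
      using join_insert[of "Suc n" "{1..n}"] by (simp add: atLeastAtMostSuc_conv)
    moreover have "s (Suc n) = pick (B n)" by (simp add: s_def)
    ultimately show ?case unfolding BS Suc by (simp only:)
  qed
  have Bp: "finite_partition (B n)" for n
    unfolding B[symmetric] by (intro finite_partition_join[OF sp \<alpha>]) (auto simp: s_def pick)
  have grow: "n * (ln 2 * e) \<le> entropy_of (B n)" for n :: nat
  proof (induction n)
    case 0
    have "prob UNIV = 1" using prob_space sp by simp
    then show ?case by (simp add: B0 entropy_of_def)
  next
    case (Suc n)
    define g where "g = pick (B n)"
    have g: "g \<in> carrier G" using pick by (simp add: g_def)
    have "e \<le> (\<Sum>b\<in>B n. min (prob (b \<inter> \<psi> g -` A)) (prob (b - \<psi> g -` A)))"
      using pick[of "B n"] Bp[of n] unfolding g_def by blast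
    then have "ln 2 * e \<le> ln 2 * (\<Sum>b\<in>B n. min (prob (b \<inter> \<psi> g -` A)) (prob (b - \<psi> g -` A)))"
      by (intro mult_left_mono) auto
    moreover have "entropy_of (B n) + ln 2 * (\<Sum>b\<in>B n. min (prob (b \<inter> \<psi> g -` A)) (prob (b - \<psi> g -` A))) \<le> entropy_of (B (Suc n))"
      unfolding BS g_def[symmetric]
      by (rule entropy_refinement_lower[OF Bp finite_partition_pull[OF sp \<alpha> g]]) (use A in \<open>auto simp: pull_partition_def\<close>)
    moreover have "real (Suc n) * (ln 2 * e) = real n * (ln 2 * e) + ln 2 * e" by (simp add: distrib_right)
    ultimately show ?case using Suc by linarith
  qed
  have "s i \<in> carrier G" for i using pick by (simp add: s_def)
  moreover have "0 < ln 2 * e" using e by simp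
  moreover have "n * (ln 2 * e) \<le> entropy_of (join {1..n} (\<lambda>i. pull_partition (s i) \<alpha>))" for n :: nat
    unfolding B by (rule grow)
  ultimately show ?thesis by (intro exI[of _ s] exI[of _ "ln 2 * e"] conjI allI)
qed

end

section \<open>Sequence entropy tuples and sensitivity tuples\<close>

text \<open>The tuples are defined over the completion, so the action is transferred there. The
  given ergodicity concerns strictly invariant Borel sets; a completed set invariant up to null sets
  is replaced by its Borel main part and then by the intersection of all preimages of that part,
  which by countability of the group changes it only by a null set.\<close>

lemma ergodic_folner_action_completion:
  fixes G :: "('g, 'm) monoid_scheme" and \<phi> :: "'g \<Rightarrow> 'x \<Rightarrow> 'x::metric_space" and M :: "'x measure"
  assumes G: "group G" "countable (carrier G)"
    and act: "acts_by_homeomorphisms G \<phi>"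
    and M: "sets M = sets borel" "prob_space M" "invariant_measure G \<phi> M" "ergodic_measure G \<phi> M"
    and F: "folner_seq G F"
  shows "ergodic_folner_action G (completion M) \<phi> F"
proof -
  interpret G: group G by fact
  interpret M: prob_space M by fact
  interpret N: prob_space "completion M" by (rule M.prob_space_completion)
  interpret group_action G UNIV \<phi> using act by (simp add: acts_by_homeomorphisms_def)
  have sp: "space M = UNIV" using sets_eq_imp_space_eq[OF M(1)] by simp
  have meas: "\<phi> g \<in> measurable M M" if "g \<in> carrier G" for g
  proof -
    have "continuous_on UNIV (\<phi> g)"
      using act that unfolding acts_by_homeomorphisms_def homeomorphism_def by blast
    then have "\<phi> g \<in> measurable borel borel" by (rule borel_measurable_continuous_onI)
    then show ?thesis by (simp add: measurable_cong_sets[OF M(1) M(1)])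
  qed
  have inv: "distr M M (\<phi> g) = M" if "g \<in> carrier G" for g
    using M(3) that by (simp add: invariant_measure_def)
  have measN: "\<phi> g \<in> measurable (completion M) (completion M)"
    and distrN: "distr (completion M) (completion M) (\<phi> g) = completion M" if g: "g \<in> carrier G" for g
  proof -
    have m: "\<phi> g \<in> measurable (completion M) M" by (rule measurable_completion[OF meas[OF g]])
    have d: "distr (completion M) M (\<phi> g) = M" using distr_completion[OF meas[OF g]] inv[OF g] by simp
    show "\<phi> g \<in> measurable (completion M) (completion M)"
      by (rule completion.measurable_completion2[OF m]) (simp add: d)
    show "distr (completion M) (completion M) (\<phi> g) = completion M"
      using completion.completion_distr_eq[OF m] by (simp add: d)
  qed
  show ?thesis
  proof (intro ergodic_folner_action.intro folner_action.intro G.is_group N.prob_space_axioms)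
    show "folner_action_axioms G (completion M) \<phi> F"
    proof
      show "\<phi> \<one>\<^bsub>G\<^esub> x = x" for x using id_eq_one by (metis UNIV_I restrict_apply)
      show "\<phi> (g \<otimes>\<^bsub>G\<^esub> h) x = \<phi> g (\<phi> h x)" if "g \<in> carrier G" "h \<in> carrier G" for g h x
        using composition_rule[of x g h] that by simp
    qed (use G F measN distrN in auto)
    show "ergodic_folner_action_axioms G (completion M) \<phi>"
    proof
      fix E assume E: "E \<in> sets (completion M)"
        and ae: "\<And>g. g \<in> carrier G \<Longrightarrow> AE x in completion M. \<phi> g x \<in> E \<longleftrightarrow> x \<in> E"
      define E0 where "E0 = main_part M E"
      have E0: "E0 \<in> sets M" unfolding E0_def using E by simp
      have E0E: "AE x in completion M. x \<in> E0 \<longleftrightarrow> x \<in> E"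
        using AE_completion[OF AE_notin_null_part[OF E]]
      proof eventually_elim
        case (elim x)
        then show ?case using main_part_null_part_Un[OF E] by (auto simp: E0_def)
      qed
      have ae0: "AE x in completion M. \<phi> g x \<in> E0 \<longleftrightarrow> x \<in> E0" if g: "g \<in> carrier G" for g
      proof -
        have "AE x in distr (completion M) (completion M) (\<phi> g). x \<in> E0 \<longleftrightarrow> x \<in> E"
          unfolding distrN[OF g] by (rule E0E)
        from AE_distrD[OF measN[OF g] this] show ?thesis
          using E0E ae[OF g] by eventually_elim auto
      qed
      define E1 where "E1 = (\<Inter>g\<in>carrier G. \<phi> g -` E0)"
      have "\<phi> g -` E0 \<in> sets M" if "g \<in> carrier G" for g
        using measurable_sets[OF meas[OF that] E0] sp by simp
      then have E1: "E1 \<in> sets M"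
        unfolding E1_def using G(2) G.one_closed by (intro sets.countable_INT') auto
      have "\<phi> h -` E1 = E1" if h: "h \<in> carrier G" for h
      proof
        show "\<phi> h -` E1 \<subseteq> E1"
        proof
          fix x assume x: "x \<in> \<phi> h -` E1"
          have "\<phi> g x \<in> E0" if g: "g \<in> carrier G" for g
          proof -
            have c: "g \<otimes>\<^bsub>G\<^esub> inv\<^bsub>G\<^esub> h \<in> carrier G" using g h by simp
            then have "\<phi> (g \<otimes>\<^bsub>G\<^esub> inv\<^bsub>G\<^esub> h) (\<phi> h x) \<in> E0" using x by (auto simp: E1_def)
            moreover have "\<phi> (g \<otimes>\<^bsub>G\<^esub> inv\<^bsub>G\<^esub> h) (\<phi> h x) = \<phi> (g \<otimes>\<^bsub>G\<^esub> inv\<^bsub>G\<^esub> h \<otimes>\<^bsub>G\<^esub> h) x"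
              using composition_rule[of x "g \<otimes>\<^bsub>G\<^esub> inv\<^bsub>G\<^esub> h" h] c h by simp
            moreover have "g \<otimes>\<^bsub>G\<^esub> inv\<^bsub>G\<^esub> h \<otimes>\<^bsub>G\<^esub> h = g" using g h by (simp add: G.m_assoc)
            ultimately show ?thesis by simp
          qed
          then show "x \<in> E1" by (simp add: E1_def)
        qed
        show "E1 \<subseteq> \<phi> h -` E1"
        proof
          fix x assume x: "x \<in> E1"
          have "\<phi> g (\<phi> h x) \<in> E0" if g: "g \<in> carrier G" for g
          proof -
            have "g \<otimes>\<^bsub>G\<^esub> h \<in> carrier G" using g h by simp
            then have "\<phi> (g \<otimes>\<^bsub>G\<^esub> h) x \<in> E0" using x by (auto simp: E1_def)
            then show ?thesis using composition_rule[of x g h] g h by simp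
          qed
          then show "x \<in> \<phi> h -` E1" by (simp add: E1_def)
        qed
      qed
      then have "measure M E1 = 0 \<or> measure M E1 = 1"
        using M(4) E1 by (auto simp: ergodic_measure_def)
      moreover have "N.prob E = N.prob E1"
      proof (rule N.finite_measure_eq_AE)
        have "AE x in completion M. \<forall>g\<in>carrier G. \<phi> g x \<in> E0 \<longleftrightarrow> x \<in> E0"
          using ae0 by (simp add: AE_ball_countable[OF G(2)])
        then show "AE x in completion M. x \<in> E \<longleftrightarrow> x \<in> E1"
          using E0E
        proof eventually_elim
          case (elim x)
          then show ?case using G.one_closed by (auto simp: E1_def)
        qed
      qed (use E E1 in auto)
      moreover have "N.prob E1 = measure M E1" using E1 by simp
      ultimately show "N.prob E = 0 \<or> N.prob E = 1" by simp
    qed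
  qed
qed

locale homeomorphism_action = ergodic_folner_action G "completion M" \<phi> F
  for G :: "('g, 'm) monoid_scheme" (structure) and M :: "'x::metric_space measure"
    and \<phi> :: "'g \<Rightarrow> 'x \<Rightarrow> 'x" and F :: "nat \<Rightarrow> 'g set" +
  assumes borel: "sets M = sets borel"
begin

lemma space_UNIV: "space (completion M) = UNIV"
  using sets_eq_imp_space_eq[OF borel] by simp

lemma open_event: "open U \<Longrightarrow> U \<in> sets (completion M)"
  using borel by (intro sets_completionI_sets) simp

lemma measurable_partitions_iff: "\<alpha> \<in> measurable_partitions M \<longleftrightarrow> finite_partition \<alpha>"
  by (simp add: measurable_partitions_def finite_partition_def)

lemma part_entropy_eq: "part_entropy M \<alpha> = entropy_of \<alpha>"
  by (simp add: part_entropy_def entropy_of_def)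

section \<open>Kronecker partitions and the vanishing of sequence entropy\<close>

lemma max_seq_entropy_kronecker:
  assumes \<alpha>: "finite_partition \<alpha>" and kr: "\<alpha> \<subseteq> kronecker_events"
  shows "max_seq_entropy G \<phi> M \<alpha> \<le> 0"
  unfolding max_seq_entropy_def
proof (rule SUP_least)
  fix s :: "nat \<Rightarrow> 'g" assume "s \<in> {s. \<forall>i\<ge>1. s i \<in> carrier G}"
  then have s: "\<And>i. 1 \<le> i \<Longrightarrow> s i \<in> carrier G" by auto
  show "seq_entropy_along \<phi> M s \<alpha> \<le> 0"
  proof (rule ereal_le_epsilon2)
    fix e :: real assume e: "0 < e"
    then have e2: "0 < e / 2" by simp
    obtain D where D: "\<And>n. entropy_of (join {1..n::nat} (\<lambda>i. pull_partition (s i) \<alpha>)) \<le> D + n * (e / 2)"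
      using kronecker_partition_entropy[of \<alpha> s, OF space_UNIV \<alpha> kr s e2] by blast
    have "(\<lambda>n. D / real n) \<longlonglongrightarrow> 0" by (rule lim_const_over_n)
    from order_tendstoD(2)[OF this e2] have "\<forall>\<^sub>F n in sequentially. D / real n < e / 2" .
    then have "\<forall>\<^sub>F n in sequentially.
      ereal (part_entropy M (join {1..n} (\<lambda>i. (\<lambda>A. \<phi> (s i) -` A) ` \<alpha>)) / real n) \<le> ereal e"
      using eventually_gt_at_top[of 0]
    proof eventually_elim
      case (elim n)
      have "part_entropy M (join {1..n} (\<lambda>i. (\<lambda>A. \<phi> (s i) -` A) ` \<alpha>)) / n \<le> (D + n * (e / 2)) / n"
        using D[of n] by (intro divide_right_mono) (simp_all add: part_entropy_eq pull_partition_def)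
      also have "\<dots> = D / n + e / 2" using elim(2) by (simp add: add_divide_distrib)
      also have "\<dots> \<le> e" using elim(1) by linarith
      finally show ?case by simp
    qed
    then have "seq_entropy_along \<phi> M s \<alpha> \<le> ereal e"
      unfolding seq_entropy_along_def by (rule Limsup_bounded)
    then show "seq_entropy_along \<phi> M s \<alpha> \<le> 0 + ereal e" by simp
  qed
qed

lemma max_seq_entropy_not_kronecker:
  assumes \<alpha>: "finite_partition \<alpha>" and nk: "\<not> \<alpha> \<subseteq> kronecker_events"
  shows "0 < max_seq_entropy G \<phi> M \<alpha>"
proof -
  obtain A where A: "A \<in> \<alpha>" "A \<notin> kronecker_events" using nk by blast
  then have "\<not> almost_periodic (indicator A)"
    using \<alpha> by (auto simp: kronecker_events_def finite_partition_def)
  from positive_sequence_entropy[OF space_UNIV \<alpha> A(1) this]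
  obtain s :: "nat \<Rightarrow> 'g" and c :: real where sc: "(\<forall>i. s i \<in> carrier G) \<and> 0 < c \<and>
      (\<forall>n::nat. n * c \<le> entropy_of (join {1..n} (\<lambda>i. pull_partition (s i) \<alpha>)))"
    by (elim exE) (rule that)
  then have s: "\<And>i. s i \<in> carrier G" and c: "0 < c"
    and ent: "\<And>n::nat. n * c \<le> entropy_of (join {1..n} (\<lambda>i. pull_partition (s i) \<alpha>))" by auto
  have "\<forall>\<^sub>F n in sequentially.
      ereal c \<le> ereal (part_entropy M (join {1..n} (\<lambda>i. (\<lambda>A. \<phi> (s i) -` A) ` \<alpha>)) / real n)"
    using eventually_gt_at_top[of 0]
  proof eventually_elim
    case (elim n)
    have "c = n * c / n" using elim by simp
    also have "\<dots> \<le> part_entropy M (join {1..n} (\<lambda>i. (\<lambda>A. \<phi> (s i) -` A) ` \<alpha>)) / n"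
      using ent[of n] by (intro divide_right_mono) (simp_all add: part_entropy_eq pull_partition_def)
    finally show ?case by simp
  qed
  then have "ereal c \<le> seq_entropy_along \<phi> M s \<alpha>"
    unfolding seq_entropy_along_def by (intro le_Limsup) auto
  also have "\<dots> \<le> max_seq_entropy G \<phi> M \<alpha>"
    unfolding max_seq_entropy_def by (rule SUP_upper) (use s in auto)
  finally show ?thesis using c by (auto intro: less_le_trans[rotated])
qed

section \<open>The cycle of inclusions\<close>

lemma mean_sensitive_subset: "mean_sensitive_tuples \<phi> M F K \<subseteq> sensitive_in_the_mean_tuples \<phi> M F K"
proof
  fix x assume x: "x \<in> mean_sensitive_tuples \<phi> M F K"
  have hit: "\<exists>n\<ge>1. hit_frequency \<phi> K y U (F n) > \<delta>"
    if "limsup (\<lambda>n. ereal (hit_frequency \<phi> K y U (F n))) > ereal \<delta>" for y U \<delta>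
  proof (rule ccontr)
    assume "\<not> ?thesis"
    \<comment> \<open>Only the index 0 escapes the negated statement, and it does not affect the
      limit superior.\<close>
    then have "\<forall>\<^sub>F n in sequentially. ereal (hit_frequency \<phi> K y U (F n)) \<le> ereal \<delta>"
      by (auto simp: eventually_sequentially not_less)
    then have "limsup (\<lambda>n. ereal (hit_frequency \<phi> K y U (F n))) \<le> ereal \<delta>" by (rule Limsup_bounded)
    then show False using that by simp
  qed
  show "x \<in> sensitive_in_the_mean_tuples \<phi> M F K"
    unfolding sensitive_in_the_mean_tuples_def
  proof (intro CollectI conjI allI impI)
    show "x \<in> tuples K - diagonal K" using x by (simp add: mean_sensitive_tuples_def)
    fix U assume "open_nbhds K x U"
    then obtain \<delta> where \<delta>: "0 < \<delta>" and s: "\<And>A. A \<in> sets (completion M) \<Longrightarrow> 0 < measure (completion M) A \<Longrightarrow>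
        \<exists>y. (\<forall>k\<in>{1..K}. y k \<in> A) \<and> limsup (\<lambda>n. ereal (hit_frequency \<phi> K y U (F n))) > ereal \<delta>"
      using x unfolding mean_sensitive_tuples_def by blast
    show "\<exists>\<delta>>0. \<forall>A\<in>sets (completion M). 0 < measure (completion M) A \<longrightarrow>
        (\<exists>n\<ge>1. \<exists>y. (\<forall>k\<in>{1..K}. y k \<in> A) \<and> \<delta> < hit_frequency \<phi> K y U (F n))"
      using \<delta> s hit by meson
  qed
qed

text \<open>A simultaneous visit separates atoms: the atom containing the translate of
  \<open>y 1\<close> is assigned to some \<open>k\<close>, and the translate of \<open>y k\<close>
  lies in \<open>U k\<close>, which avoids that atom. Summing over \<open>k\<close> bounds the visit
  frequency by \<open>K\<close> mean variations, each made at most \<open>\<delta> / K\<close> on a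
  suitable set.\<close>

lemma sensitive_in_the_mean_subset:
  assumes K: "1 \<le> K" and temp: "tempered G F"
  shows "sensitive_in_the_mean_tuples \<phi> M F K \<subseteq> seq_entropy_tuples G \<phi> M K"
proof
  fix x assume x: "x \<in> sensitive_in_the_mean_tuples \<phi> M F K"
  have "0 < max_seq_entropy G \<phi> M \<alpha>" if \<alpha>M: "\<alpha> \<in> measurable_partitions M" and adm: "admissible K x \<alpha>" for \<alpha>
  proof (rule ccontr)
    assume neg: "\<not> 0 < max_seq_entropy G \<phi> M \<alpha>"
    have \<alpha>: "finite_partition \<alpha>" using \<alpha>M by (simp add: measurable_partitions_iff)
    have kr: "\<alpha> \<subseteq> kronecker_events" using max_seq_entropy_not_kronecker[OF \<alpha>] neg by blast
    have fa: "finite \<alpha>" "\<And>A. A \<in> \<alpha> \<Longrightarrow> A \<in> sets (completion M)" "prob (\<Union>\<alpha>) = 1" "\<Union>\<alpha> \<in> sets (completion M)"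
      using \<alpha> by (auto simp: finite_partition_def)
    have "\<forall>A\<in>\<alpha>. \<exists>k. k \<in> {1..K} \<and> x k \<notin> closure A" using adm unfolding admissible_def by blast
    from bchoice[OF this] obtain \<kappa> where \<kappa>: "\<forall>A\<in>\<alpha>. \<kappa> A \<in> {1..K} \<and> x (\<kappa> A) \<notin> closure A" by (rule exE)
    \<comment> \<open>If no atom is assigned to \<open>k\<close>, the intersection is over an empty
      family and \<open>U k\<close> is the whole space.\<close>
    define U where "U k = (\<Inter>A\<in>{A\<in>\<alpha>. \<kappa> A = k}. - closure A)" for k
    have "open_nbhds K x U"
      unfolding open_nbhds_def U_def using fa(1) \<kappa> by (auto intro!: open_INT)
    then obtain \<delta> where \<delta>: "0 < \<delta>" and sens: "\<And>A. A \<in> sets (completion M) \<Longrightarrow> 0 < prob A \<Longrightarrow>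
        \<exists>n\<ge>1. \<exists>y. (\<forall>k\<in>{1..K}. y k \<in> A) \<and> \<delta> < hit_frequency \<phi> K y U (F n)"
      using x unfolding sensitive_in_the_mean_tuples_def by blast
    define f :: "'x set \<Rightarrow> 'x \<Rightarrow> real" where "f A = indicator A" for A
    have fm: "f A \<in> borel_measurable (completion M)" if "A \<in> \<alpha>" for A
      unfolding f_def using fa(2)[OF that] by simp
    have f01: "0 \<le> f A y \<and> f A y \<le> 1" for A y by (simp add: f_def indicator_def)
    have ap: "almost_periodic (f A)" if "A \<in> \<alpha>" for A
      using kr that by (auto simp: f_def kronecker_events_def)
    define d where "d = variation \<alpha> f"
    have "\<exists>\<rho>. kronecker_metric d \<rho> (card \<alpha>)"
      unfolding d_def using fm f01 ap by (intro kronecker_metric_exists fa(1)) auto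
    then obtain \<rho> where km: "kronecker_metric d \<rho> (card \<alpha>)" by blast
    have \<delta>K: "0 < \<delta> / K" using \<delta> K by simp
    have dm: "d \<in> borel_measurable MM" unfolding d_def by (rule variation_measurable[OF fm])
    have "\<exists>D\<in>sets (completion M). 0 < prob D \<and> (\<forall>y\<in>D. \<forall>y'\<in>D. \<forall>n\<ge>1. davg n d (y, y') \<le> \<delta> / K)"
    proof (rule mean_equicontinuous_set[OF temp km dm _ _ _ _ \<delta>K])
      show "0 \<le> d z" "d z \<le> card \<alpha>" for z
        unfolding d_def by (rule variation_nonneg, rule variation_le[OF f01])
      show "d (y, y') = d (y', y)" "d (y, z) \<le> d (y, y') + d (y', z)" for y y' z
        unfolding d_def by (rule variation_commute, rule variation_triangle)
    qed
    then obtain D where D: "D \<in> sets (completion M)" "0 < prob D"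
      and Dd: "\<forall>y\<in>D. \<forall>y'\<in>D. \<forall>n\<ge>1. davg n d (y, y') \<le> \<delta> / K"
      by (elim bexE conjE) (rule that)
    \<comment> \<open>\<alpha> covers the space only up to a null set. \<open>V\<close> consists of
      the points whose whole orbit stays covered; it has full measure because the group is
      countable.\<close>
    define V where "V = (\<Inter>g\<in>carrier G. \<phi> g -` \<Union>\<alpha>)"
    have "V \<in> sets (completion M)"
      unfolding V_def using prob_vimage(1)[OF space_UNIV _ fa(4)] one_closed
      by (intro sets.countable_INT' countable_carrier) auto
    moreover have AEV: "AE y in completion M. y \<in> V"
    proof -
      have "AE y in completion M. \<phi> g y \<in> \<Union>\<alpha>" if "g \<in> carrier G" for g
        using AE_action_comp[OF that] fa(3,4) by (simp only: prob_eq_1)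
      then have "AE y in completion M. \<forall>g\<in>carrier G. \<phi> g y \<in> \<Union>\<alpha>"
        by (simp only: AE_ball_countable[OF countable_carrier] ball_simps) blast
      then show ?thesis by eventually_elim (auto simp: V_def)
    qed
    ultimately have DV: "D \<inter> V \<in> sets (completion M)" using D by auto
    have "prob (D \<inter> V) = prob D"
      by (rule finite_measure_eq_AE) (use AEV D DV in \<open>auto elim: eventually_mono\<close>)
    with D(2) have "0 < prob (D \<inter> V)" by simp
    from sens[OF DV this] obtain n y where n: "1 \<le> n" and yDV: "\<forall>k\<in>{1..K}. y k \<in> D \<inter> V"
      and hit: "\<delta> < hit_frequency \<phi> K y U (F n)" by blast
    have y: "y k \<in> D \<inter> V" if "k \<in> {1..K}" for k using yDV that by blast
    have one: "(1::nat) \<in> {1..K}" using K by simp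
    have gc: "g \<in> carrier G" if "g \<in> F n" for g using that folner_carrier[OF n] by auto
    have sep: "1 \<le> (\<Sum>k=1..K. d (\<phi> g (y 1), \<phi> g (y k)))"
      if g: "g \<in> F n" and vis: "\<forall>k\<in>{1..K}. \<phi> g (y k) \<in> U k" for g
    proof -
      have "\<phi> g (y 1) \<in> \<Union>\<alpha>" using y[OF one] gc[OF g] by (auto simp: V_def)
      then obtain A where A: "A \<in> \<alpha>" "\<phi> g (y 1) \<in> A" by blast
      define k where "k = \<kappa> A"
      have k: "k \<in> {1..K}" using \<kappa> A(1) by (simp add: k_def)
      have "\<phi> g (y k) \<in> - closure A" using vis k A(1) by (auto simp: U_def k_def)
      then have nA: "\<phi> g (y k) \<notin> A" using closure_subset by auto
      have "1 = \<bar>f A (\<phi> g (y 1)) - f A (\<phi> g (y k))\<bar>" using A(2) nA by (simp add: f_def)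
      also have "\<dots> \<le> d (\<phi> g (y 1), \<phi> g (y k))"
        unfolding d_def variation_def fst_conv snd_conv using A(1) fa(1) by (intro member_le_sum) auto
      also have "\<dots> \<le> (\<Sum>k=1..K. d (\<phi> g (y 1), \<phi> g (y k)))"
        using k variation_nonneg by (intro member_le_sum) (auto simp: d_def)
      finally show ?thesis .
    qed
    have "real (card {g\<in>F n. \<forall>k\<in>{1..K}. \<phi> g (y k) \<in> U k}) = (\<Sum>g\<in>{g\<in>F n. \<forall>k\<in>{1..K}. \<phi> g (y k) \<in> U k}. 1)"
      by simp
    also have "\<dots> \<le> (\<Sum>g\<in>{g\<in>F n. \<forall>k\<in>{1..K}. \<phi> g (y k) \<in> U k}. \<Sum>k=1..K. d (\<phi> g (y 1), \<phi> g (y k)))"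
      using sep by (intro sum_mono) auto
    also have "\<dots> \<le> (\<Sum>g\<in>F n. \<Sum>k=1..K. d (\<phi> g (y 1), \<phi> g (y k)))"
      using folner_finite[OF n] by (intro sum_mono2) (auto simp: d_def intro!: sum_nonneg variation_nonneg)
    also have "\<dots> = (\<Sum>k=1..K. \<Sum>g\<in>F n. d (\<phi> g (y 1), \<phi> g (y k)))" by (rule sum.swap)
    finally have "hit_frequency \<phi> K y U (F n) \<le> (\<Sum>k=1..K. \<Sum>g\<in>F n. d (\<phi> g (y 1), \<phi> g (y k))) / card (F n)"
      unfolding hit_frequency_def by (intro divide_right_mono) auto
    also have "\<dots> = (\<Sum>k=1..K. davg n d (y 1, y k))"
      by (simp add: davg_def diag_action_def sum_divide_distrib)
    also have "\<dots> \<le> (\<Sum>k=1..K. \<delta> / K)"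
      using y[OF one] y n Dd by (intro sum_mono) auto
    also have "\<dots> = \<delta>" using K by simp
    finally show False using hit by simp
  qed
  then show "x \<in> seq_entropy_tuples G \<phi> M K"
    using x by (simp add: seq_entropy_tuples_def sensitive_in_the_mean_tuples_def)
qed

text \<open>The value of \<delta> is \<open>l / 4\<close>: one factor 1/2 is lost in
  \<open>correlated_visits\<close> and another in \<open>exists_frequent_visits\<close>. Since
  \<open>l\<close> is fixed by the neighbourhoods, the bound is uniform in \<open>A\<close>.\<close>

lemma seq_entropy_subset: "seq_entropy_tuples G \<phi> M K \<subseteq> mean_sensitive_tuples \<phi> M F K"
proof
  fix x assume x: "x \<in> seq_entropy_tuples G \<phi> M K"
  have sens: "\<exists>\<delta>::real>0. \<forall>A\<in>sets (completion M). measure (completion M) A > 0 \<longrightarrow>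
      (\<exists>y. (\<forall>k\<in>{1..K}. y k \<in> A) \<and> limsup (\<lambda>n. ereal (hit_frequency \<phi> K y U (F n))) > ereal \<delta>)"
    if U: "open_nbhds K x U" for U
  proof -
    have Uo: "open (U k)" "x k \<in> U k" if "k \<in> {1..K}" for k using U that by (auto simp: open_nbhds_def)
    have Um: "U k \<in> sets (completion M)" if "k \<in> {1..K}" for k using open_event[OF Uo(1)[OF that]] .
    have "\<forall>k\<in>{1..K}. \<exists>h::'x \<Rightarrow> real. h \<in> borel_measurable kronecker_algebra \<and> (\<forall>x. 0 \<le> h x \<and> h x \<le> 1) \<and>
      (\<forall>u b. u \<in> borel_measurable kronecker_algebra \<longrightarrow> (\<forall>x. \<bar>u x\<bar> \<le> b) \<longrightarrow>
         expectation (\<lambda>x. (indicator (U k) x - h x) * u x) = 0)"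
      using kronecker_conditional_expectation[OF Um] by blast
    from bchoice[OF this] obtain h :: "nat \<Rightarrow> 'x \<Rightarrow> real" where H: "\<forall>k\<in>{1..K}. h k \<in> borel_measurable kronecker_algebra \<and>
      (\<forall>x. 0 \<le> h k x \<and> h k x \<le> 1) \<and>
      (\<forall>u b. u \<in> borel_measurable kronecker_algebra \<longrightarrow> (\<forall>x. \<bar>u x\<bar> \<le> b) \<longrightarrow>
         expectation (\<lambda>x. (indicator (U k) x - h k x) * u x) = 0)"
      by (rule exE)
    have hm: "\<And>k. k \<in> {1..K} \<Longrightarrow> h k \<in> borel_measurable kronecker_algebra"
      and h01: "\<And>k x. k \<in> {1..K} \<Longrightarrow> 0 \<le> h k x \<and> h k x \<le> 1"
      and orth: "\<And>k u b. k \<in> {1..K} \<Longrightarrow> u \<in> borel_measurable kronecker_algebra \<Longrightarrow> (\<And>x. \<bar>u x\<bar> \<le> b) \<Longrightarrow>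
         expectation (\<lambda>x. (indicator (U k) x - h k x) * u x) = 0"
      using H by blast+
    define l where "l = expectation (\<lambda>x. \<Prod>k=1..K. h k x)"
    have "l \<noteq> 0"
    proof
      assume "l = 0"
      then have z: "expectation (\<lambda>x. \<Prod>k=1..K. h k x) = 0" by (simp add: l_def)
      obtain \<alpha> where \<alpha>: "finite \<alpha> \<and> \<alpha> \<subseteq> kronecker_events \<and> disjoint \<alpha> \<and> prob (\<Union>\<alpha>) = 1 \<and>
         (\<forall>B\<in>\<alpha>. \<exists>k\<in>{1..K}. B \<inter> U k = {})"
        using kronecker_partition[of K U h, OF Um hm h01 orth z] by (rule exE)
      have fp: "finite_partition \<alpha>" using \<alpha> by (auto simp: finite_partition_def kronecker_events_def)
      have "admissible K x \<alpha>"
        unfolding admissible_def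
      proof
        fix B assume "B \<in> \<alpha>"
        then obtain k where k: "k \<in> {1..K}" "B \<inter> U k = {}" using \<alpha> by blast
        then have "U k \<inter> closure B = {}" using open_Int_closure_eq_empty[OF Uo(1)[OF k(1)], of B] by blast
        then have "x k \<notin> closure B" using Uo(2)[OF k(1)] by blast
        then show "\<exists>k\<in>{1..K}. x k \<notin> closure B" using k by blast
      qed
      then have "0 < max_seq_entropy G \<phi> M \<alpha>"
        using x fp by (simp add: seq_entropy_tuples_def measurable_partitions_iff)
      moreover have "max_seq_entropy G \<phi> M \<alpha> \<le> 0" using max_seq_entropy_kronecker[OF fp] \<alpha> by blast
      ultimately show False by simp
    qed
    moreover have "0 \<le> l" unfolding l_def using h01 by (intro integral_nonneg_AE) (auto intro!: prod_nonneg)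
    ultimately have l: "0 < l" by simp
    have "\<exists>y. (\<forall>k\<in>{1..K}. y k \<in> A) \<and> limsup (\<lambda>n. ereal (hit_frequency \<phi> K y U (F n))) > ereal (l / 4)"
      if A: "A \<in> sets (completion M)" "0 < prob A" for A
    proof -
      obtain A' where A'm: "A' \<in> sets (completion M)" and A'c: "A' \<subseteq> A \<and> 0 < prob A' \<and> (\<forall>\<^sub>F n in sequentially. l / 2 < (\<Sum>g\<in>F n. \<Prod>k\<in>{1..K}.
            expectation (\<lambda>x. indicator A' x * indicator (U k) (\<phi> g x)) / prob A') / card (F n))"
        using correlated_visits[of "{1..K}" U h l A, OF finite_atLeastAtMost Um hm h01 orth l_def l A]
        by (rule bexE)
      then have A': "A' \<in> sets (completion M)" "A' \<subseteq> A" "0 < prob A'"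
        and ev: "\<forall>\<^sub>F n in sequentially. l / 2 < (\<Sum>g\<in>F n. \<Prod>k\<in>{1..K}.
            expectation (\<lambda>x. indicator A' x * indicator (U k) (\<phi> g x)) / prob A') / card (F n)"
        by blast+
      have l2: "0 < l / 2" using l by simp
      obtain y where y: "(\<forall>k\<in>{1..K}. y k \<in> A') \<and>
        ereal (l / 2 / 2) < limsup (\<lambda>n. ereal (real (card {g\<in>F n. \<forall>k\<in>{1..K}. \<phi> g (y k) \<in> U k}) / real (card (F n))))"
        using exists_frequent_visits[of "{1..K}" U A' "l / 2", OF finite_atLeastAtMost Um A'(1,3) l2 ev]
        by (rule exE)
      then show ?thesis using A'(2) by (intro exI[of _ y]) (auto simp: hit_frequency_def)
    qed
    then show ?thesis using l by (intro exI[of _ "l / 4"]) auto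
  qed
  show "x \<in> mean_sensitive_tuples \<phi> M F K"
    unfolding mean_sensitive_tuples_def using x sens by (simp add: seq_entropy_tuples_def)
qed

end

theorem theorem1p6:
  fixes G :: "('g, 'm) monoid_scheme"
    and \<phi> :: "'g \<Rightarrow> 'x \<Rightarrow> 'x::metric_space"
    and M :: "'x measure"
    and F :: "nat \<Rightarrow> 'g set"
    and K :: nat
  assumes "group G" and "countable (carrier G)" and "infinite (carrier G)" and "amenable G"
    and "compact (UNIV :: 'x set)"
    and "acts_by_homeomorphisms G \<phi>"
    and "sets M = sets borel" and "prob_space M"
    and "invariant_measure G \<phi> M" and "ergodic_measure G \<phi> M"
    and "folner_seq G F" and "tempered G F"
    and "K \<ge> 2"
  shows "seq_entropy_tuples G \<phi> M K = mean_sensitive_tuples \<phi> M F K \<and>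
         mean_sensitive_tuples \<phi> M F K = sensitive_in_the_mean_tuples \<phi> M F K"
proof -
  interpret homeomorphism_action G M \<phi> F
    by (intro homeomorphism_action.intro homeomorphism_action_axioms.intro
        ergodic_folner_action_completion assms)
  have "1 \<le> K" using assms(13) by simp
  then show ?thesis
    using mean_sensitive_subset[of K] sensitive_in_the_mean_subset[OF _ assms(12), of K] seq_entropy_subset[of K]
    by blast
qed

end
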